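(* Let $s\in\mathbb N$, let $(\mathcal A,\mathcal H,D)$ be an $s$-summable spectral triple, fix $f\in\mathcal E^{s,\gamma}$ for some $\gamma\in(0,1)$, and equip $\mathcal A$ with the norm $\|a\|_1=\|a\|+\|[D,a]\|$. Then for any bounded subset $\Sigma\subset\mathcal A$ there exists $C_\Sigma$ such that $$\left|\tilde\psi_{2k+1}(a_0,\ldots,a_{2k+1})\right|\le\frac{C_\Sigma}{k!}$$ for all $k\in\mathbb N_0$ and all $a_0,\ldots,a_{2k+1}\in\Sigma$.
   Context: Notation: $\mathbb N=\{1,2,\ldots\}$, $\mathbb N_0=\{0,1,2,\ldots\}$. $\mathcal S^s$ is the Schatten class of $s$-summable operators. Spectral triple: for $s\in\mathbb N$, an $s$-summable spectral triple $(\mathcal A,\mathcal H,D)$ consists of a separable Hilbert space $\mathcal H$, a (possibly unbounded) self-adjoint operator $D$ in $\mathcal H$ and a unital $*$-algebra $\mathcal A\subseteq B(\mathcal H)$ (with unit the identity operator), such that for all $a\in\mathcal A$: $a\operatorname{dom}D\subseteq\operatorname{dom}D$ and $[D,a]$ extends to a bounded operator (again denoted $[D,a]$); and $(D-i)^{-1}\in\mathcal S^s$. Fourier transform: $\hat g(x)=\int_{\mathbb R}\frac{dy}{2\pi}g(y)e^{-iyx}$, extended to distributions; for continuous $g$, "$\hat g\in L^1$" means the distributional Fourier transform is an $L^1$ function, and then $g(x)=\int\hat g(y)e^{ixy}dy$. Function class: with $u(x):=x-i$, for $\gamma\in(0,1]$, $\mathcal E^{s,\gamma}$ is the set of $f\in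 C^\infty(\mathbb R,\mathbb C)$ for which there is $C_f\ge1$ with $\|\widehat{(fu^m)^{(n)}}\|_{L^1}\le C_f^{n+1}(n!)^\gamma$ for all integers $0\le m\le s$ and all $n\in\mathbb N_0$. Multiple operator integral: for $f\in C^n$ with $\widehat{f^{(n)}}\in L^1$ and $V_1,\ldots,V_n\in B(\mathcal H)$, $$T^{D}_{f^{[n]}}(V_1,\ldots,V_n)y:=\int_{\Delta_n}\int_{\mathbb R}e^{its_0D}V_1e^{its_1D}\cdots V_ne^{its_nD}y\,\widehat{f^{(n)}}(t)\,dt\,d\sigma(s_0,\ldots,s_n)\qquad(y\in\mathcal H),$$ where $\Delta_n=\{s\in\mathbb R_{\ge0}^{n+1}:\sum_j s_j=1\}$ and $\sigma$ is the standard measure of total mass $1/n!$. Bracket: $\langle V_1,\ldots,V_n\rangle:=\sum_{j=1}^n\operatorname{Tr}\big(T^D_{f^{[n]}}(V_j,\ldots,V_n,V_1,\ldots,V_{j-1})\big)$ (these operators are trace class). Cochains: for $n\ge1$ and $a_j\in\mathcal A$, $\phi_n(a_0,\ldots,a_n):=\langle a_0[D,a_1],[D,a_2],\ldots,[D,a_n]\rangle$; $B_0\phi(a_0,\ldots,a_{n-1}):=\phi(1,a_0,\ldots,a_{n-1})$; $\psi_{2k+1}:=\phi_{2k+1}-\tfrac12B_0\phi_{2k+2}$; $\tilde\psi_{2k+1}:=(-1)^k\frac{k!}{(2k+1)!}\psi_{2k+1}$ for $k\ge0$. *)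

theory Defs
  imports "HOL-Analysis.Analysis"
begin

section \<open>Complex Hilbert spaces and operators\<close>

text \<open>
  The inner product is linear in the second argument. Completeness comes from \<^class>\<open>banach\<close>;
  separability is expressed by adding the sort \<^class>\<open>second_countable_topology\<close>.
\<close>

class chilbert_space = banach +
  fixes scaleC :: "complex \<Rightarrow> 'a \<Rightarrow> 'a" (infixr "*\<^sub>C" 75)
    and cinner :: "'a \<Rightarrow> 'a \<Rightarrow> complex"
  assumes scaleC_add_right: "c *\<^sub>C (x + y) = c *\<^sub>C x + c *\<^sub>C y"
    and scaleC_add_left: "(c + d) *\<^sub>C x = c *\<^sub>C x + d *\<^sub>C x"
    and scaleC_scaleC: "c *\<^sub>C d *\<^sub>C x = (c * d) *\<^sub>C x"
    and scaleR_scaleC: "r *\<^sub>R x = complex_of_real r *\<^sub>C x"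
    and cinner_commute: "cinner x y = cnj (cinner y x)"
    and cinner_add_right: "cinner x (y + z) = cinner x y + cinner x z"
    and cinner_scaleC_right: "cinner x (c *\<^sub>C y) = c * cinner x y"
    and norm_eq_sqrt_cinner: "norm x = sqrt (Re (cinner x x))"

instantiation complex :: chilbert_space
begin

definition scaleC_complex :: "complex \<Rightarrow> complex \<Rightarrow> complex"
  where "scaleC_complex c x = c * x"

definition cinner_complex :: "complex \<Rightarrow> complex \<Rightarrow> complex"
  where "cinner_complex x y = cnj x * y"

instance
  by standard
    (simp_all add: scaleC_complex_def cinner_complex_def algebra_simps scaleR_conv_of_real
      cmod_def power2_eq_square)

end

definition bounded_clinear :: "('h::chilbert_space \<Rightarrow> 'h) \<Rightarrow> bool"
  where "bounded_clinear T \<longleftrightarrow> bounded_linear T \<and> (\<forall>c x. T (c *\<^sub>C x) = c *\<^sub>C T x)"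

definition adj :: "('h::chilbert_space \<Rightarrow> 'h) \<Rightarrow> 'h \<Rightarrow> 'h"
  where "adj T = (THE S. \<forall>x y. cinner (T x) y = cinner x (S y))"

definition positive_op :: "('h::chilbert_space \<Rightarrow> 'h) \<Rightarrow> bool"
  where "positive_op P \<longleftrightarrow> bounded_clinear P \<and> (\<forall>x. cinner x (P x) \<in> \<real>\<^sub>\<ge>\<^sub>0)"

definition unitary :: "('h::chilbert_space \<Rightarrow> 'h) \<Rightarrow> bool"
  where "unitary U \<longleftrightarrow>
    bounded_clinear U \<and> surj U \<and> (\<forall>x y. cinner (U x) (U y) = cinner x y)"

definition orthonormal_basis :: "'h::chilbert_space set \<Rightarrow> bool"
  where "orthonormal_basis B \<longleftrightarrow>
    (\<forall>x\<in>B. \<forall>y\<in>B. cinner x y = (if x = y then 1 else 0)) \<and>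
    (\<forall>x. (\<forall>e\<in>B. cinner e x = 0) \<longrightarrow> x = 0)"

text \<open>
  A bounded operator is trace class exactly if its diagonal sums converge (unconditionally) in
  every orthonormal basis, so \<open>op_trace\<close> carries no information about other operators.
\<close>

definition has_trace :: "('h::chilbert_space \<Rightarrow> 'h) \<Rightarrow> complex \<Rightarrow> bool"
  where "has_trace T c \<longleftrightarrow>
    (\<forall>B. orthonormal_basis B \<longrightarrow> ((\<lambda>e. cinner e (T e)) has_sum c) B)"

definition op_trace :: "('h::chilbert_space \<Rightarrow> 'h) \<Rightarrow> complex"
  where "op_trace T = (THE c. has_trace T c)"

text \<open>
  The operator \<open>P\<close> below is the absolute value \<open>(T\<^sup>* T)\<^sup>1\<^sup>/\<^sup>2\<close>, and the condition is that
  \<open>P\<^sup>s\<close> has finite trace.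
\<close>

definition schatten :: "nat \<Rightarrow> ('h::chilbert_space \<Rightarrow> 'h) set"
  where "schatten s = {T. bounded_clinear T \<and>
    (\<exists>P. positive_op P \<and> P \<circ> P = adj T \<circ> T \<and> (\<exists>c. has_trace (P ^^ s) c))}"

section \<open>Unbounded operators and spectral triples\<close>

text \<open>
  An unbounded operator is a partial map, defined on its domain. The last conjunct says that the
  operator coincides with its adjoint, including the domains.
\<close>

definition self_adjoint :: "('h::chilbert_space \<rightharpoonup> 'h) \<Rightarrow> bool"
  where "self_adjoint D \<longleftrightarrow>
    0 \<in> dom D \<and>
    (\<forall>x\<in>dom D. \<forall>y\<in>dom D. D (x + y) = Some (the (D x) + the (D y))) \<and>
    (\<forall>c. \<forall>x\<in>dom D. D (c *\<^sub>C x) = Some (c *\<^sub>C the (D x))) \<and>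
    closure (dom D) = UNIV \<and>
    (\<forall>y z. D y = Some z \<longleftrightarrow> (\<forall>x\<in>dom D. cinner (the (D x)) y = cinner x z))"

text \<open>The resolvent \<open>(D - i)\<^sup>-\<^sup>1\<close>.\<close>

definition resolvent_i :: "('h::chilbert_space \<rightharpoonup> 'h) \<Rightarrow> 'h \<Rightarrow> 'h"
  where "resolvent_i D = inv_into (dom D) (\<lambda>x. the (D x) - \<i> *\<^sub>C x)"

definition is_comm :: "('h::chilbert_space \<rightharpoonup> 'h) \<Rightarrow> ('h \<Rightarrow> 'h) \<Rightarrow> ('h \<Rightarrow> 'h) \<Rightarrow> bool"
  where "is_comm D a b \<longleftrightarrow>
    bounded_clinear b \<and> (\<forall>x\<in>dom D. b x = the (D (a x)) - a (the (D x)))"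

text \<open>The bounded extension of \<open>[D, a]\<close>, unique because the domain of \<open>D\<close> is dense.\<close>

definition comm :: "('h::chilbert_space \<rightharpoonup> 'h) \<Rightarrow> ('h \<Rightarrow> 'h) \<Rightarrow> 'h \<Rightarrow> 'h"
  where "comm D a = (THE b. is_comm D a b)"

definition unital_star_algebra :: "('h::chilbert_space \<Rightarrow> 'h) set \<Rightarrow> bool"
  where "unital_star_algebra A \<longleftrightarrow>
    (\<forall>a\<in>A. bounded_clinear a) \<and>
    id \<in> A \<and>
    (\<forall>a\<in>A. \<forall>b\<in>A. (\<lambda>x. a x + b x) \<in> A) \<and>
    (\<forall>c. \<forall>a\<in>A. (\<lambda>x. c *\<^sub>C a x) \<in> A) \<and>
    (\<forall>a\<in>A. \<forall>b\<in>A. a \<circ> b \<in> A) \<and>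
    (\<forall>a\<in>A. adj a \<in> A)"

definition spectral_triple ::
    "nat \<Rightarrow> ('h::{chilbert_space, second_countable_topology} \<Rightarrow> 'h) set \<Rightarrow> ('h \<rightharpoonup> 'h) \<Rightarrow> bool"
  where "spectral_triple s A D \<longleftrightarrow>
    self_adjoint D \<and>
    unital_star_algebra A \<and>
    (\<forall>a\<in>A. a ` dom D \<subseteq> dom D \<and> (\<exists>b. is_comm D a b)) \<and>
    resolvent_i D \<in> schatten s"

definition norm1 :: "('h::chilbert_space \<rightharpoonup> 'h) \<Rightarrow> ('h \<Rightarrow> 'h) \<Rightarrow> real"
  where "norm1 D a = onorm a + onorm (comm D a)"

text \<open>
  \<open>exp_i D t\<close> is \<open>exp (i t D)\<close>: the strongly continuous one-parameter unitary group with
  infinitesimal generator \<open>i D\<close>, which exists uniquely for self-adjoint \<open>D\<close> by Stone's theorem.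
\<close>

definition unitary_group_of ::
    "('h::chilbert_space \<rightharpoonup> 'h) \<Rightarrow> (real \<Rightarrow> 'h \<Rightarrow> 'h) \<Rightarrow> bool"
  where "unitary_group_of D U \<longleftrightarrow>
    (\<forall>t. unitary (U t)) \<and>
    U 0 = id \<and>
    (\<forall>t t'. U (t + t') = U t \<circ> U t') \<and>
    (\<forall>x. continuous_on UNIV (\<lambda>t. U t x)) \<and>
    (\<forall>x y. D x = Some y \<longleftrightarrow> ((\<lambda>t. U t x) has_vector_derivative \<i> *\<^sub>C y) (at 0))"

definition exp_i :: "('h::chilbert_space \<rightharpoonup> 'h) \<Rightarrow> real \<Rightarrow> 'h \<Rightarrow> 'h"
  where "exp_i D = (THE U. unitary_group_of D U)"

section \<open>Fourier transform and the function class\<close>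

definition nth_deriv :: "nat \<Rightarrow> (real \<Rightarrow> complex) \<Rightarrow> real \<Rightarrow> complex"
  where "nth_deriv n = (\<lambda>g x. vector_derivative g (at x)) ^^ n"

definition smooth :: "(real \<Rightarrow> complex) \<Rightarrow> bool"
  where "smooth g \<longleftrightarrow> (\<forall>n x. nth_deriv n g differentiable (at x))"

definition schwartz :: "(real \<Rightarrow> complex) \<Rightarrow> bool"
  where "schwartz \<phi> \<longleftrightarrow>
    smooth \<phi> \<and> (\<forall>j k. \<exists>C. \<forall>x. \<bar>x\<bar> ^ k * cmod (nth_deriv j \<phi> x) \<le> C)"

definition fourier_integral :: "(real \<Rightarrow> complex) \<Rightarrow> real \<Rightarrow> complex"
  where "fourier_integral g x =
    (\<integral>y. g y * exp (- \<i> * of_real y * of_real x) / of_real (2 * pi) \<partial>lborel)"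

text \<open>
  The distributional Fourier transform of \<open>g\<close> is the integrable function \<open>h\<close>. Asking that \<open>g\<close>
  be integrable against Schwartz functions excludes nothing: a continuous function whose Fourier
  transform is integrable is bounded.
\<close>

definition has_L1_fourier :: "(real \<Rightarrow> complex) \<Rightarrow> (real \<Rightarrow> complex) \<Rightarrow> bool"
  where "has_L1_fourier g h \<longleftrightarrow>
    integrable lborel h \<and>
    (\<forall>\<phi>. schwartz \<phi> \<longrightarrow>
      integrable lborel (\<lambda>x. g x * \<phi> x) \<and>
      (\<integral>x. h x * \<phi> x \<partial>lborel) = (\<integral>x. g x * fourier_integral \<phi> x \<partial>lborel))"

text \<open>The transform is determined up to a null set, hence the choice of a representative.\<close>

definition fourier :: "(real \<Rightarrow> complex) \<Rightarrow> real \<Rightarrow> complex"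
  where "fourier g = (SOME h. has_L1_fourier g h)"

definition E_class :: "nat \<Rightarrow> real \<Rightarrow> (real \<Rightarrow> complex) set"
  where "E_class s \<gamma> = {f. smooth f \<and>
    (\<exists>C\<ge>1. \<forall>m\<le>s. \<forall>n.
      let g = nth_deriv n (\<lambda>x. f x * (of_real x - \<i>) ^ m) in
        (\<exists>h. has_L1_fourier g h) \<and>
        (\<integral>x. cmod (fourier g x) \<partial>lborel) \<le> C ^ (n + 1) * fact n powr \<gamma>)}"

section \<open>Multiple operator integrals\<close>

text \<open>
  Lebesgue measure on \<open>{s\<^sub>1, \<dots>, s\<^sub>n \<ge> 0, s\<^sub>1 + \<dots> + s\<^sub>n \<le> 1}\<close>, transported to the standard simplex
  by \<open>s\<^sub>0 = 1 - (s\<^sub>1 + \<dots> + s\<^sub>n)\<close>.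
\<close>

definition simplex_measure :: "nat \<Rightarrow> (nat \<Rightarrow> real) measure"
  where "simplex_measure n =
    distr
      (restrict_space (Pi\<^sub>M {1..n} (\<lambda>_. lborel))
        {s. (\<forall>j\<in>{1..n}. 0 \<le> s j) \<and> sum s {1..n} \<le> 1})
      (Pi\<^sub>M {0..n} (\<lambda>_. borel))
      (\<lambda>s. \<lambda>j\<in>{0..n}. if j = 0 then 1 - sum s {1..n} else s j)"

lemma emeasure_simplex_measure:
  "emeasure (simplex_measure n) (space (simplex_measure n)) = ennreal (1 / fact n)"
proof -
  let ?M = "Pi\<^sub>M {1..n} (\<lambda>_. lborel) :: (nat \<Rightarrow> real) measure"
  let ?R = "{s :: nat \<Rightarrow> real. (\<forall>j\<in>{1..n}. 0 \<le> s j) \<and> sum s {1..n} \<le> 1}"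
  let ?T = "\<lambda>s :: nat \<Rightarrow> real. \<lambda>j\<in>{0..n}. if j = 0 then 1 - sum s {1..n} else s j"
  have "?T \<in> ?M \<rightarrow>\<^sub>M Pi\<^sub>M {0..n} (\<lambda>_. borel)"
  proof (rule measurable_restrict)
    fix j assume "j \<in> {0..n}"
    then show "(\<lambda>s. if j = 0 then 1 - sum s {1..n} else s j) \<in> ?M \<rightarrow>\<^sub>M borel"
      by (cases "j = 0") auto
  qed
  then have T: "?T \<in> restrict_space ?M ?R \<rightarrow>\<^sub>M Pi\<^sub>M {0..n} (\<lambda>_. borel)"
    by (rule measurable_restrict_space1)
  have "?R \<inter> space ?M = Pi\<^sub>E {1..n} (\<lambda>_. {0..}) \<inter> (\<lambda>x. sum x {1..n}) -` {..1} \<inter> space ?M"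
    by (auto simp: space_PiM)
  also have "\<dots> \<in> sets ?M" by measurable
  finally have R: "?R \<inter> space ?M \<in> sets ?M" .
  have "emeasure (simplex_measure n) (space (simplex_measure n))
      = emeasure (restrict_space ?M ?R) (space (restrict_space ?M ?R))"
    unfolding simplex_measure_def space_distr
    using measurable_space[OF T] by (subst emeasure_distr[OF T]) (auto intro!: arg_cong[where f = "emeasure _"])
  also have "\<dots> = emeasure ?M (?R \<inter> space ?M)"
    using R by (simp add: space_restrict_space emeasure_restrict_space)
  also have "\<dots> = ennreal (1 / fact n)"
    using emeasure_std_simplex_aux[of "{1..n}" 1] by simp
  finally show ?thesis .
qed

text \<open>
  With \<open>Vs = [V\<^sub>1, \<dots>, V\<^sub>n]\<close>, the operator \<open>moi_word U Vs t s n\<close> is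
  \<open>U(t s\<^sub>0) V\<^sub>1 U(t s\<^sub>1) \<cdots> V\<^sub>n U(t s\<^sub>n)\<close>.
\<close>

primrec moi_word ::
    "(real \<Rightarrow> 'h \<Rightarrow> 'h) \<Rightarrow> ('h \<Rightarrow> 'h) list \<Rightarrow> real \<Rightarrow> (nat \<Rightarrow> real) \<Rightarrow> nat \<Rightarrow> 'h \<Rightarrow> 'h"
  where
    "moi_word U Vs t s 0 = U (t * s 0)"
  | "moi_word U Vs t s (Suc k) = moi_word U Vs t s k \<circ> Vs ! k \<circ> U (t * s (Suc k))"

definition moi ::
    "('h::{chilbert_space, second_countable_topology} \<rightharpoonup> 'h) \<Rightarrow> (real \<Rightarrow> complex) \<Rightarrow>
      ('h \<Rightarrow> 'h) list \<Rightarrow> 'h \<Rightarrow> 'h"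
  where "moi D f Vs y =
    (let n = length Vs in
      \<integral>s. (\<integral>t. fourier (nth_deriv n f) t *\<^sub>C moi_word (exp_i D) Vs t s n y \<partial>lborel)
        \<partial>simplex_measure n)"

definition bracket ::
    "('h::{chilbert_space, second_countable_topology} \<rightharpoonup> 'h) \<Rightarrow> (real \<Rightarrow> complex) \<Rightarrow>
      ('h \<Rightarrow> 'h) list \<Rightarrow> complex"
  where "bracket D f Vs = (\<Sum>j<length Vs. op_trace (moi D f (rotate j Vs)))"

section \<open>Cochains\<close>

text \<open>
  An \<open>n\<close>-cochain takes its arguments \<open>a\<^sub>0, \<dots>, a\<^sub>n\<close> as a sequence and ignores the later entries.
\<close>

definition phi ::
    "('h::{chilbert_space, second_countable_topology} \<rightharpoonup> 'h) \<Rightarrow> (real \<Rightarrow> complex) \<Rightarrow>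
      nat \<Rightarrow> (nat \<Rightarrow> 'h \<Rightarrow> 'h) \<Rightarrow> complex"
  where "phi D f n a =
    bracket D f ((a 0 \<circ> comm D (a 1)) # map (\<lambda>j. comm D (a j)) [2..<n + 1])"

definition B0 :: "((nat \<Rightarrow> 'h \<Rightarrow> 'h) \<Rightarrow> complex) \<Rightarrow> (nat \<Rightarrow> 'h \<Rightarrow> 'h) \<Rightarrow> complex"
  where "B0 \<phi> a = \<phi> (case_nat id a)"

text \<open>\<open>psi_odd D f k\<close> and \<open>psi_tilde D f k\<close> are the cochains of degree \<open>2 k + 1\<close>.\<close>

definition psi_odd ::
    "('h::{chilbert_space, second_countable_topology} \<rightharpoonup> 'h) \<Rightarrow> (real \<Rightarrow> complex) \<Rightarrow>
      nat \<Rightarrow> (nat \<Rightarrow> 'h \<Rightarrow> 'h) \<Rightarrow> complex"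
  where "psi_odd D f k a = phi D f (2 * k + 1) a - 1 / 2 * B0 (phi D f (2 * k + 2)) a"

definition psi_tilde ::
    "('h::{chilbert_space, second_countable_topology} \<rightharpoonup> 'h) \<Rightarrow> (real \<Rightarrow> complex) \<Rightarrow>
      nat \<Rightarrow> (nat \<Rightarrow> 'h \<Rightarrow> 'h) \<Rightarrow> complex"
  where "psi_tilde D f k a = (- 1) ^ k * (fact k / fact (2 * k + 1)) * psi_odd D f k a"

end

theory Submission
  imports Defs "HOL-Probability.Characteristic_Functions" "HOL-Real_Asymp.Real_Asymp"
begin

text \<open>
  Write \<open>R = (D - i)\<^sup>-\<^sup>1\<close> and \<open>u(x) = x - i\<close>. The cochains are sums of traces of multiple operator
  integrals \<open>T\<^sub>f\<^sub>,\<^sub>n(V\<^sub>1, \<dots>, V\<^sub>n)\<close> whose entries satisfy \<open>\<parallel>V\<^sub>j\<parallel> \<le> K\<close> for a \<open>K\<close> that depends only on the bounded set.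
  The heart of the matter is that each of these traces is bounded by one constant, whatever \<open>n\<close> is
  (\<open>bracket_bound\<close>). The degree \<open>2 k + 1\<close> cochain collects \<open>2 k + 1\<close> of them from \<open>\<phi>\<close> and half of \<open>2 k + 2\<close> from \<open>B\<^sub>0 \<phi>\<close>,
  and \<open>(3 k + 2) k! / (2 k + 1)! \<le> 2 / k!\<close>.

  For the constant bound, the divided differences of \<open>f\<close> satisfy
  \<open>(x\<^sub>n - i) f[x\<^sub>0, \<dots>, x\<^sub>n] = (f u)[x\<^sub>0, \<dots>, x\<^sub>n] - f[x\<^sub>0, \<dots>, x\<^bsub>n-1\<^esub>]\<close>, which for operators says
  \<open>T\<^sub>f\<^sub>,\<^sub>n(V\<^sub>1, \<dots>, V\<^sub>n) = (T\<^bsub>f u,n\<^esub>(V\<^sub>1, \<dots>, V\<^sub>n) - T\<^bsub>f,n-1\<^esub>(V\<^sub>1, \<dots>, V\<^bsub>n-1\<^esub>) V\<^sub>n) R\<close>. Used \<open>s\<close> times, this turns the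
  operator into at most \<open>2\<^sup>s\<close> terms of the form \<open>T\<^bsub>f u^m,l\<^esub>(V\<^sub>1, \<dots>, V\<^sub>l)\<close> times a word with \<open>s\<close> letters \<open>R\<close> and bounded
  operators in between. The integrand of such a term is again a word with \<open>s\<close> letters \<open>R\<close>, and by the
  Hoelder inequality for Schatten classes its trace is at most \<open>K\<^sup>n Tr \<bar>R\<bar>\<^sup>s\<close> (\<open>word_trace_le\<close>). The integral over
  the simplex and the line contributes the \<open>L\<^sup>1\<close> norm divided by \<open>n!\<close>, at most \<open>C\<^bsup>n+1\<^esup> (n!)\<^bsup>\<gamma>-1\<^esup>\<close>, and since
  \<open>\<gamma> < 1\<close> this compensates \<open>K\<^sup>n\<close> (\<open>E_class_bound\<close>).

  All this is carried out with finite matrices. The operator \<open>D\<close> has an orthonormal basis of eigenvectors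
  (\<open>schatten_resolvent_eigenbasis\<close>), in which \<open>exp(i t D)\<close> is diagonal (\<open>exp_i_eq_diag_group\<close>). Finite partial
  sums of the diagonal of \<open>T\<^sub>f\<^sub>,\<^sub>n\<close> in this basis are limits of those obtained after compressing every \<open>V\<^sub>j\<close> to
  finitely many eigenvectors (\<open>moi_truncation_limit\<close>). There \<open>T\<^sub>f\<^sub>,\<^sub>n\<close> becomes a finite sum of
  divided differences at eigenvalues, so that the recursion follows from the scalar identity
  (\<open>div_diff_mult_linear_Suc\<close>); the latter is an integration by parts on the simplex, once
  \<open>f\<^bsup>(n)\<^esup>\<close> is recovered from its Fourier transform (\<open>fourier_inversion\<close>). A bound on all finite partial sums
  suffices, because \<open>op_trace\<close> is either their limit or a fixed number (\<open>op_trace_le\<close>).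
\<close>

section \<open>Complex Hilbert spaces\<close>

lemma cinner_add_left: "cinner (x + y) z = cinner x z + cinner y (z::'a::chilbert_space)"
  by (metis cinner_commute cinner_add_right complex_cnj_add)

lemma cinner_scaleC_left: "cinner (c *\<^sub>C x) y = cnj c * cinner x (y::'a::chilbert_space)"
  by (metis cinner_commute cinner_scaleC_right complex_cnj_mult complex_cnj_cnj)

lemma cinner_zero_right [simp]: "cinner x (0::'a::chilbert_space) = 0"
  using cinner_add_right[of x 0 0] by simp

lemma cinner_zero_left [simp]: "cinner (0::'a::chilbert_space) x = 0"
  using cinner_add_left[of 0 0 x] by simp

lemma cinner_minus_right: "cinner x (- y) = - cinner x (y::'a::chilbert_space)"
  using cinner_add_right[of x y "- y"] by (simp add: eq_neg_iff_add_eq_0 add.commute)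

lemma cinner_minus_left: "cinner (- x) y = - cinner x (y::'a::chilbert_space)"
  using cinner_add_left[of x "- x" y] by (simp add: eq_neg_iff_add_eq_0 add.commute)

lemma cinner_diff_right: "cinner x (y - z) = cinner x y - cinner x (z::'a::chilbert_space)"
  using cinner_add_right[of x y "- z"] by (simp add: cinner_minus_right)

lemma cinner_diff_left: "cinner (x - y) z = cinner x z - cinner y (z::'a::chilbert_space)"
  using cinner_add_left[of x "- y" z] by (simp add: cinner_minus_left)

lemma scaleC_zero_right [simp]: "c *\<^sub>C (0::'a::chilbert_space) = 0"
  using scaleC_add_right[of c 0 0] by simp

lemma scaleC_zero_left [simp]: "0 *\<^sub>C (x::'a::chilbert_space) = 0"
  using scaleC_add_left[of 0 0 x] by simp

lemma scaleC_one [simp]: "1 *\<^sub>C (x::'a::chilbert_space) = x"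
  using scaleR_scaleC[of 1 x] by simp

lemma scaleC_minus_left: "(- c) *\<^sub>C (x::'a::chilbert_space) = - (c *\<^sub>C x)"
  using scaleC_add_left[of c "- c" x] by (simp add: eq_neg_iff_add_eq_0 add.commute)

lemma scaleC_minus_right: "c *\<^sub>C (- x) = - (c *\<^sub>C (x::'a::chilbert_space))"
  using scaleC_add_right[of c x "- x"] by (simp add: eq_neg_iff_add_eq_0 add.commute)

lemma scaleC_diff_right: "c *\<^sub>C (x - y) = c *\<^sub>C x - c *\<^sub>C (y::'a::chilbert_space)"
  using scaleC_add_right[of c x "- y"] by (simp add: scaleC_minus_right)

lemma scaleC_diff_left: "(c - d) *\<^sub>C x = c *\<^sub>C x - d *\<^sub>C (x::'a::chilbert_space)"
  using scaleC_add_left[of c "- d" x] by (simp add: scaleC_minus_left)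

lemma cnj_mult_self: "cnj z * z = of_real ((cmod z)\<^sup>2)"
  by (subst mult.commute) (rule complex_norm_square[symmetric])

lemma cinner_self: "cinner x x = complex_of_real ((norm (x::'a::chilbert_space))\<^sup>2)"
proof -
  have "Im (cinner x x) = 0"
    using cinner_commute[of x x] by (metis cnj.simps(2) equal_neg_zero)
  moreover have "Re (cinner x x) \<ge> 0"
    using norm_eq_sqrt_cinner[of x] norm_ge_zero[of x] by (metis real_sqrt_ge_0_iff)
  ultimately show ?thesis
    using norm_eq_sqrt_cinner[of x] by (simp add: complex_eq_iff)
qed

lemma cmod_cinner_self: "cmod (cinner x x) = (norm (x::'a::chilbert_space))\<^sup>2"
  by (simp add: cinner_self del: of_real_power)

lemma norm_scaleC: "norm (c *\<^sub>C (x::'a::chilbert_space)) = cmod c * norm x"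
proof -
  have "complex_of_real ((norm (c *\<^sub>C x))\<^sup>2) = cnj c * c * of_real ((norm x)\<^sup>2)"
    by (simp only: cinner_self[symmetric] cinner_scaleC_left cinner_scaleC_right mult.assoc mult.left_commute)
  also have "cnj c * c = of_real ((cmod c)\<^sup>2)"
    by (metis complex_norm_square mult.commute of_real_power)
  finally have "(norm (c *\<^sub>C x))\<^sup>2 = (cmod c * norm x)\<^sup>2"
    by (metis of_real_eq_iff of_real_mult power_mult_distrib)
  then show ?thesis by (simp add: power2_eq_iff_nonneg)
qed

lemma norm_sq_diff_scaleC:
  "(norm (x - c *\<^sub>C y))\<^sup>2 = (norm x)\<^sup>2 - 2 * Re (c * cinner x y) + (cmod c)\<^sup>2 * (norm (y::'a::chilbert_space))\<^sup>2"
proof -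
  have "complex_of_real ((norm (x - c *\<^sub>C y))\<^sup>2)
      = cinner x x - c * cinner x y - cnj (c * cinner x y) + cinner (c *\<^sub>C y) (c *\<^sub>C y)"
    unfolding cinner_self[symmetric]
    by (simp add: cinner_diff_left cinner_diff_right cinner_scaleC_right cinner_scaleC_left
        cinner_commute[of y x, symmetric] algebra_simps)
  also have "\<dots> = complex_of_real ((norm x)\<^sup>2 - 2 * Re (c * cinner x y) + (cmod c)\<^sup>2 * (norm y)\<^sup>2)"
    unfolding cinner_self norm_scaleC by (simp add: complex_eq_iff power_mult_distrib)
  finally show ?thesis using of_real_eq_iff by blast
qed

lemma cauchy_schwarz: "cmod (cinner x y) \<le> norm x * norm (y::'a::chilbert_space)"
proof (cases "y = 0")
  case False
  define c where "c = cnj (cinner x y) / of_real ((norm y)\<^sup>2)"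
  have ny: "(norm y)\<^sup>2 > 0" using False by simp
  have a: "c * cinner x y = of_real ((cmod (cinner x y))\<^sup>2 / (norm y)\<^sup>2)"
    unfolding c_def times_divide_eq_left of_real_divide complex_norm_square by (simp add: mult.commute)
  have b: "(cmod c)\<^sup>2 * (norm y)\<^sup>2 = (cmod (cinner x y))\<^sup>2 / (norm y)\<^sup>2"
    using ny by (simp add: c_def norm_divide power_divide norm_power power2_eq_square del: of_real_power of_real_mult norm_mult)
  have "0 \<le> (norm x)\<^sup>2 - 2 * Re (c * cinner x y) + (cmod c)\<^sup>2 * (norm y)\<^sup>2"
    unfolding norm_sq_diff_scaleC[symmetric] by simp
  then have "0 \<le> (norm x)\<^sup>2 - (cmod (cinner x y))\<^sup>2 / (norm y)\<^sup>2"
    unfolding a b by simp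
  then have "(cmod (cinner x y))\<^sup>2 \<le> (norm x)\<^sup>2 * (norm y)\<^sup>2"
    using ny by (simp add: divide_le_eq)
  then have "(cmod (cinner x y))\<^sup>2 \<le> (norm x * norm y)\<^sup>2" by (simp add: power_mult_distrib)
  then show ?thesis by (rule power2_le_imp_le) simp
qed simp

lemma bounded_bilinear_cinner: "bounded_bilinear (cinner :: 'a::chilbert_space \<Rightarrow> 'a \<Rightarrow> complex)"
proof
  show "\<exists>K. \<forall>(a::'a) b. norm (cinner a b) \<le> norm a * norm b * K"
    using cauchy_schwarz by (intro exI[of _ 1]) auto
qed (simp_all add: cinner_add_left cinner_add_right scaleR_scaleC cinner_scaleC_left
      cinner_scaleC_right scaleC_complex_def scaleR_conv_of_real)

lemma bounded_bilinear_scaleC: "bounded_bilinear (scaleC :: complex \<Rightarrow> 'a::chilbert_space \<Rightarrow> 'a)"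
proof
  show "\<exists>K. \<forall>a (b::'a). norm (a *\<^sub>C b) \<le> norm a * norm b * K"
    by (intro exI[of _ 1]) (simp add: norm_scaleC)
qed (simp_all add: scaleC_add_left scaleC_add_right scaleR_scaleC scaleC_scaleC
      scaleR_conv_of_real scaleC_complex_def mult.commute)

lemmas bounded_linear_cinner_right = bounded_bilinear.bounded_linear_right[OF bounded_bilinear_cinner]
lemmas tendsto_cinner = bounded_bilinear.tendsto[OF bounded_bilinear_cinner]
lemmas tendsto_scaleC = bounded_bilinear.tendsto[OF bounded_bilinear_scaleC]
lemmas cinner_sum_right = bounded_bilinear.sum_right[OF bounded_bilinear_cinner]
lemmas cinner_sum_left = bounded_bilinear.sum_left[OF bounded_bilinear_cinner]
lemmas scaleC_sum_right = bounded_bilinear.sum_right[OF bounded_bilinear_scaleC]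
lemma cinner_ext: "(\<And>z. cinner z x = cinner z y) \<Longrightarrow> x = (y::'a::chilbert_space)"
  using cinner_self[of "x - y"] by (simp add: cinner_diff_right)

subsection \<open>Orthonormal families\<close>

definition orthonormal :: "'a::chilbert_space set \<Rightarrow> bool"
  where "orthonormal B \<longleftrightarrow> (\<forall>x\<in>B. \<forall>y\<in>B. cinner x y = (if x = y then 1 else 0))"

lemma orthonormal_basis_orthonormal: "orthonormal_basis B \<Longrightarrow> orthonormal B"
  by (simp add: orthonormal_basis_def orthonormal_def)

lemma orthonormal_norm: "orthonormal B \<Longrightarrow> e \<in> B \<Longrightarrow> norm e = 1"
  using cinner_self[of e]
  by (metis norm_ge_zero of_real_eq_1_iff one_power2 orthonormal_def power2_eq_iff_nonneg zero_le_one)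

lemma orthonormal_cinner_sum:
  assumes "orthonormal B" "finite F" "F \<subseteq> B" "e \<in> B"
  shows "cinner e (\<Sum>f\<in>F. c f *\<^sub>C f) = (if e \<in> F then c e else 0)"
proof -
  have "cinner e (\<Sum>f\<in>F. c f *\<^sub>C f) = (\<Sum>f\<in>F. c f * (if e = f then 1 else 0))"
    using assms by (auto simp: cinner_sum_right cinner_scaleC_right orthonormal_def intro!: sum.cong)
  also have "\<dots> = (\<Sum>f\<in>F. if e = f then c f else 0)"
    by (rule sum.cong) auto
  also have "\<dots> = (if e \<in> F then c e else 0)"
    using assms(2) by (simp add: sum.delta)
  finally show ?thesis .
qed

lemma orthonormal_norm_sum:
  assumes "orthonormal B" "finite F" "F \<subseteq> B"
  shows "(norm (\<Sum>f\<in>F. c f *\<^sub>C f))\<^sup>2 = (\<Sum>f\<in>F. (cmod (c f))\<^sup>2)"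
proof -
  let ?x = "\<Sum>f\<in>F. c f *\<^sub>C f"
  have "complex_of_real ((norm ?x)\<^sup>2) = (\<Sum>e\<in>F. cnj (c e) * cinner e ?x)"
    unfolding cinner_self[symmetric] by (subst cinner_sum_left) (simp add: cinner_scaleC_left)
  also have "\<dots> = (\<Sum>e\<in>F. cnj (c e) * c e)"
    using assms by (intro sum.cong refl) (auto simp: orthonormal_cinner_sum[OF assms] subset_iff)
  also have "\<dots> = complex_of_real (\<Sum>f\<in>F. (cmod (c f))\<^sup>2)"
    unfolding cnj_mult_self by simp
  finally show ?thesis using of_real_eq_iff by blast
qed

lemma bessel:
  assumes "orthonormal B" "finite F" "F \<subseteq> B"
  shows "(\<Sum>e\<in>F. (cmod (cinner e x))\<^sup>2) \<le> (norm x)\<^sup>2"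
proof -
  define y where "y = (\<Sum>e\<in>F. cinner e x *\<^sub>C e)"
  have yy: "(norm y)\<^sup>2 = (\<Sum>e\<in>F. (cmod (cinner e x))\<^sup>2)"
    unfolding y_def using orthonormal_norm_sum[OF assms] .
  have "cinner y x = (\<Sum>e\<in>F. cnj (cinner e x) * cinner e x)"
    unfolding y_def by (simp add: cinner_sum_left cinner_scaleC_left)
  also have "\<dots> = of_real ((norm y)\<^sup>2)"
    unfolding yy cnj_mult_self by simp
  finally have "(norm y)\<^sup>2 \<le> norm y * norm x"
    using cauchy_schwarz[of y x] by (simp add: norm_power del: of_real_power)
  then have "norm y \<le> norm x" by (cases "norm y = 0") (auto simp: power2_eq_square)
  then show ?thesis unfolding yy[symmetric] by (simp add: power_mono)
qed

text \<open>
  The partial sums form a Cauchy net: by Pythagoras, their distances are governed by the convergent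
  sum of the \<open>\<bar>c\<^sub>e\<bar>\<^sup>2\<close>. This is the only place where completeness of the space enters the theory of bases.
\<close>

lemma orthonormal_summable:
  assumes B: "orthonormal B"
    and K: "\<And>F. finite F \<Longrightarrow> F \<subseteq> B \<Longrightarrow> (\<Sum>e\<in>F. (cmod (c e))\<^sup>2) \<le> K"
  shows "(\<lambda>e. c e *\<^sub>C e) summable_on B"
proof -
  let ?f = "\<lambda>e. c e *\<^sub>C e" and ?g = "\<lambda>e. (cmod (c e))\<^sup>2"
  have "?g summable_on B"
    by (rule nonneg_bdd_above_summable_on) (use K in \<open>auto simp: bdd_above_def\<close>)
  then obtain L where lim: "(sum ?g \<longlongrightarrow> L) (finite_subsets_at_top B)"
    unfolding summable_on_def has_sum_def by blast
  have "\<exists>P. eventually P (finite_subsets_at_top B) \<and>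
              (\<forall>F F'. P F \<and> P F' \<longrightarrow> dist (sum ?f F) (sum ?f F') < r)" if r: "r > 0" for r
  proof -
    define d where "d = r\<^sup>2 / 16"
    have d: "d > 0" using r by (simp add: d_def)
    have "eventually (\<lambda>F. dist (sum ?g F) L < d) (finite_subsets_at_top B)"
      using lim d by (auto simp: tendsto_iff)
    then obtain X where X: "finite X" "X \<subseteq> B"
        "\<And>Y. finite Y \<Longrightarrow> X \<subseteq> Y \<Longrightarrow> Y \<subseteq> B \<Longrightarrow> dist (sum ?g Y) L < d"
      by (auto simp: eventually_finite_subsets_at_top)
    define P where "P F \<longleftrightarrow> finite F \<and> X \<subseteq> F \<and> F \<subseteq> B" for F
    have ev: "eventually P (finite_subsets_at_top B)"
      unfolding eventually_finite_subsets_at_top P_def using X by auto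
    have close: "norm (sum ?f F - sum ?f X) < r / 2" if F: "P F" for F
    proof -
      have fin: "finite F" "X \<subseteq> F" "F \<subseteq> B" using F by (auto simp: P_def)
      have s: "sum ?f F - sum ?f X = sum ?f (F - X)"
        using fin by (simp add: sum_diff)
      have "(norm (sum ?f (F - X)))\<^sup>2 = sum ?g (F - X)"
        using fin by (intro orthonormal_norm_sum[OF B]) auto
      also have "\<dots> = sum ?g F - sum ?g X" using fin by (simp add: sum_diff)
      also have "\<dots> < 2 * d"
        using X(3)[OF fin] X(3)[OF X(1) order_refl X(2)] by (simp add: dist_real_def)
      also have "\<dots> \<le> (r / 2)\<^sup>2" by (simp add: d_def power2_eq_square)
      finally have "norm (sum ?f (F - X)) < r / 2" 
        by (rule power2_less_imp_less) (use r in simp)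
      then show ?thesis unfolding s .
    qed
    have "dist (sum ?f F) (sum ?f F') < r" if "P F" "P F'" for F F'
      using close[OF that(1)] close[OF that(2)] norm_triangle_ineq4[of "sum ?f F - sum ?f X" "sum ?f F' - sum ?f X"]
      by (simp add: dist_norm)
    then show ?thesis using ev by blast
  qed
  then have "cauchy_filter (filtermap (sum ?f) (finite_subsets_at_top B))"
    by (simp add: cauchy_filter_metric_filtermap)
  moreover have "complete (UNIV::'a set)"
    by (meson Cauchy_convergent UNIV_I complete_def convergent_def)
  ultimately obtain L' where "(sum ?f \<longlongrightarrow> L') (finite_subsets_at_top B)"
    using complete_uniform[where S=UNIV] by (force simp add: filterlim_def)
  then show ?thesis using summable_on_def has_sum_def by blast
qed

lemma orthonormal_cinner_has_sum:
  assumes "orthonormal B" "((\<lambda>e. c e *\<^sub>C e) has_sum y) B" "e \<in> B"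
  shows "cinner e y = c e"
proof -
  have "((\<lambda>f. cinner e (c f *\<^sub>C f)) has_sum cinner e y) B"
    by (rule has_sum_bounded_linear[OF bounded_linear_cinner_right assms(2)])
  moreover have "((\<lambda>f. cinner e (c f *\<^sub>C f)) has_sum c e) B"
  proof -
    have "((\<lambda>f. cinner e (c f *\<^sub>C f)) has_sum (\<Sum>f\<in>{e}. cinner e (c f *\<^sub>C f))) B
        \<longleftrightarrow> ((\<lambda>f. cinner e (c f *\<^sub>C f)) has_sum (\<Sum>f\<in>{e}. cinner e (c f *\<^sub>C f))) {e}"
      using assms by (intro has_sum_cong_neutral) (auto simp: cinner_scaleC_right orthonormal_def)
    moreover have "((\<lambda>f. cinner e (c f *\<^sub>C f)) has_sum (\<Sum>f\<in>{e}. cinner e (c f *\<^sub>C f))) {e}"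
      by (rule has_sum_finite) simp
    ultimately show ?thesis using assms by (simp add: cinner_scaleC_right orthonormal_def)
  qed
  ultimately show ?thesis by (rule has_sum_unique)
qed

lemma onb_expansion:
  assumes "orthonormal_basis B"
  shows "((\<lambda>e. cinner e x *\<^sub>C e) has_sum x) B"
proof -
  have o: "orthonormal B" using assms by (rule orthonormal_basis_orthonormal)
  have "(\<lambda>e. cinner e x *\<^sub>C e) summable_on B"
    by (rule orthonormal_summable[OF o, of _ "(norm x)\<^sup>2"]) (use bessel[OF o] in auto)
  then obtain y where y: "((\<lambda>e. cinner e x *\<^sub>C e) has_sum y) B" by (auto simp: summable_on_def)
  have "cinner e (x - y) = 0" if "e \<in> B" for e
    using orthonormal_cinner_has_sum[OF o y that] by (simp add: cinner_diff_right)
  then have "x - y = 0" using assms unfolding orthonormal_basis_def by blast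
  then show ?thesis using y by simp
qed

lemma onb_parseval:
  assumes "orthonormal_basis B"
  shows "((\<lambda>e. cinner x e * cinner e y) has_sum cinner x y) B"
  using has_sum_bounded_linear[OF bounded_linear_cinner_right onb_expansion[OF assms, of y], of x]
  by (simp add: cinner_scaleC_right mult.commute)

lemma onb_ext:
  assumes "orthonormal_basis B" "\<And>e. e \<in> B \<Longrightarrow> cinner e x = cinner e y"
  shows "x = y"
  using assms by (metis (no_types, lifting) cinner_diff_right eq_iff_diff_eq_0 orthonormal_basis_def)

lemma cinner_self_mult_cnj: "cinner x e * cinner e x = of_real ((cmod (cinner e x))\<^sup>2)" for x e :: "'a::chilbert_space"
  by (subst cinner_commute[of x e]) (rule cnj_mult_self)

lemma onb_norm_has_sum:
  assumes "orthonormal_basis B"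
  shows "((\<lambda>e. (cmod (cinner e x))\<^sup>2) has_sum (norm x)\<^sup>2) B"
proof -
  have "((\<lambda>e. complex_of_real ((cmod (cinner e x))\<^sup>2)) has_sum complex_of_real ((norm x)\<^sup>2)) B"
    using onb_parseval[OF assms, of x x] unfolding cinner_self cinner_self_mult_cnj .
  from has_sum_bounded_linear[OF bounded_linear_Re this] show ?thesis by simp
qed

text \<open>Zorn's lemma, in the form that also yields bases of eigenvectors.\<close>

lemma orthonormal_basis_exists:
  fixes P :: "'a::chilbert_space \<Rightarrow> bool"
  assumes step: "\<And>B x. orthonormal B \<Longrightarrow> (\<forall>e\<in>B. P e) \<Longrightarrow> (\<forall>e\<in>B. cinner e x = 0) \<Longrightarrow> x \<noteq> 0
     \<Longrightarrow> \<exists>y. P y \<and> norm y = 1 \<and> (\<forall>e\<in>B. cinner e y = 0)"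
  shows "\<exists>B. orthonormal_basis B \<and> (\<forall>e\<in>B. P e)"
proof -
  define \<S> where "\<S> = {B. orthonormal B \<and> (\<forall>e\<in>B. P e)}"
  have "\<exists>M\<in>\<S>. \<forall>X\<in>\<S>. M \<subseteq> X \<longrightarrow> X = M"
  proof (rule subset_Zorn_nonempty)
    show "\<S> \<noteq> {}" by (auto simp: \<S>_def orthonormal_def intro!: exI[of _ "{}"])
    fix \<C> assume ne: "\<C> \<noteq> {}" and ch: "subset.chain \<S> \<C>"
    have sub: "\<C> \<subseteq> \<S>" using ch by (auto simp: subset.chain_def)
    have "cinner x y = (if x = y then 1 else 0)" if xy: "x \<in> \<Union>\<C>" "y \<in> \<Union>\<C>" for x y
    proof -
      obtain X Y where XY: "X \<in> \<C>" "Y \<in> \<C>" "x \<in> X" "y \<in> Y" using xy by auto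
      have "X \<subseteq> Y \<or> Y \<subseteq> X" using ch XY by (auto simp: subset.chain_def)
      then obtain Z where "Z \<in> \<C>" "x \<in> Z" "y \<in> Z" using XY by auto
      then show ?thesis using sub by (auto simp: \<S>_def orthonormal_def)
    qed
    then show "\<Union>\<C> \<in> \<S>" using sub by (auto simp: \<S>_def orthonormal_def)
  qed
  then obtain M where M: "M \<in> \<S>" and max: "\<And>X. X \<in> \<S> \<Longrightarrow> M \<subseteq> X \<Longrightarrow> X = M" by blast
  have "x = 0" if x: "\<forall>e\<in>M. cinner e x = 0" for x
  proof (rule ccontr)
    assume "x \<noteq> 0"
    then obtain y where y: "P y" "norm y = 1" "\<forall>e\<in>M. cinner e y = 0"
      using step[of M x] M x by (auto simp: \<S>_def)
    have y1: "cinner y y = 1" using y(2) by (simp add: cinner_self)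
    have y0: "cinner y e = 0" if "e \<in> M" for e
      using y(3) that by (metis cinner_commute complex_cnj_zero)
    have "insert y M \<in> \<S>"
      using M y y1 y0 by (auto simp: \<S>_def orthonormal_def)
    then have "insert y M = M" by (rule max) auto
    then have "y \<in> M" by auto
    then show False using y(3) y1 by auto
  qed
  then have "orthonormal_basis M" "\<forall>e\<in>M. P e"
    using M by (auto simp: \<S>_def orthonormal_basis_def orthonormal_def)
  then show ?thesis by blast
qed

lemma onb_exists: "\<exists>B::'a::chilbert_space set. orthonormal_basis B"
proof -
  have "\<exists>B::'a set. orthonormal_basis B \<and> (\<forall>e\<in>B. True)"
  proof (rule orthonormal_basis_exists)
    fix B :: "'a set" and x assume "\<forall>e\<in>B. cinner e x = 0" "x \<noteq> 0"
    then show "\<exists>y. True \<and> norm y = 1 \<and> (\<forall>e\<in>B. cinner e y = 0)"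
      by (intro exI[of _ "(1 / complex_of_real (norm x)) *\<^sub>C x"])
         (auto simp: norm_scaleC norm_divide cinner_scaleC_right)
  qed
  then show ?thesis by blast
qed

subsection \<open>Bounded operators and adjoints\<close>

lemma bounded_clinear_linear: "bounded_clinear T \<Longrightarrow> bounded_linear T"
  and bounded_clinear_scaleC: "bounded_clinear T \<Longrightarrow> T (c *\<^sub>C x) = c *\<^sub>C T x"
  by (auto simp: bounded_clinear_def)

lemma bounded_clinear_add: "bounded_clinear T \<Longrightarrow> T (x + y) = T x + T y"
  and bounded_clinear_diff: "bounded_clinear T \<Longrightarrow> T (x - y) = T x - T y"
  and bounded_clinear_zero: "bounded_clinear T \<Longrightarrow> T 0 = 0"
  and bounded_clinear_sum: "bounded_clinear T \<Longrightarrow> T (sum g X) = (\<Sum>x\<in>X. T (g x))"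
  by (simp_all add: linear_add linear_diff linear_0 linear_sum bounded_clinear_linear bounded_linear.linear)

lemma bounded_clinear_norm: "bounded_clinear T \<Longrightarrow> norm (T x) \<le> onorm T * norm x"
  using onorm[of T] by (simp add: bounded_clinear_def)

lemma bounded_clinear_compose:
  "bounded_clinear S \<Longrightarrow> bounded_clinear T \<Longrightarrow> bounded_clinear (S \<circ> T)"
  by (auto simp: bounded_clinear_def o_def intro: bounded_linear_compose)

lemma bounded_clinear_id: "bounded_clinear id"
  by (simp add: bounded_clinear_def id_def bounded_linear_ident)

lemma bounded_clinear_pow: "bounded_clinear T \<Longrightarrow> bounded_clinear (T ^^ n)"
  by (induction n) (auto simp: bounded_clinear_id intro: bounded_clinear_compose)

text \<open>
  In an orthonormal basis \<open>B\<close> the adjoint has to be \<open>y \<mapsto> \<Sum>\<^bsub>e\<in>B\<^esub> \<langle>T e, y\<rangle> e\<close>. The coefficients are square summable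
  because \<open>\<Sum>\<^bsub>e\<in>F\<^esub> \<bar>\<langle>T e, y\<rangle>\<bar>\<^sup>2 = \<langle>T v, y\<rangle>\<close> for \<open>v = \<Sum>\<^bsub>e\<in>F\<^esub> \<langle>T e, y\<rangle> e\<close>.
\<close>

lemma adjoint_exists:
  fixes T :: "'a::chilbert_space \<Rightarrow> 'a"
  assumes T: "bounded_clinear T"
  shows "\<exists>S. \<forall>x y. cinner (T x) y = cinner x (S y)"
proof -
  obtain B :: "'a set" where B: "orthonormal_basis B" using onb_exists by blast
  have o: "orthonormal B" using B by (rule orthonormal_basis_orthonormal)
  have "\<exists>z. ((\<lambda>e. cinner (T e) y *\<^sub>C e) has_sum z) B" for y
  proof -
    have "(\<Sum>e\<in>F. (cmod (cinner (T e) y))\<^sup>2) \<le> (onorm T * norm y)\<^sup>2" if F: "finite F" "F \<subseteq> B" for F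
    proof -
      let ?c = "\<lambda>e. cinner (T e) y" 
      let ?v = "\<Sum>e\<in>F. ?c e *\<^sub>C e" and ?s = "\<Sum>e\<in>F. (cmod (?c e))\<^sup>2"
      have "cinner (T ?v) y = of_real ?s"
        by (simp add: bounded_clinear_sum[OF T] bounded_clinear_scaleC[OF T] cinner_sum_left
            cinner_scaleC_left cnj_mult_self del: of_real_power)
      then have "?s \<le> norm (T ?v) * norm y"
        using cauchy_schwarz[of "T ?v" y] by (simp add: sum_nonneg del: of_real_sum)
      also have "\<dots> \<le> onorm T * norm ?v * norm y"
        using bounded_clinear_norm[OF T] by (intro mult_right_mono) auto
      finally have "?s \<le> (onorm T * norm y) * norm ?v" by (simp add: mult_ac)
      moreover have "(norm ?v)\<^sup>2 = ?s" by (rule orthonormal_norm_sum[OF o F])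
      ultimately have "(norm ?v)\<^sup>2 \<le> (onorm T * norm y) * norm ?v" by simp
      then have "norm ?v \<le> onorm T * norm y"
        using onorm_pos_le[OF bounded_clinear_linear[OF T]]
        by (cases "norm ?v = 0") (auto simp: power2_eq_square)
      then show ?thesis unfolding \<open>(norm ?v)\<^sup>2 = ?s\<close>[symmetric] by (simp add: power_mono)
    qed
    from orthonormal_summable[OF o this] show ?thesis by (simp add: summable_on_def)
  qed
  then obtain S where S: "\<And>y. ((\<lambda>e. cinner (T e) y *\<^sub>C e) has_sum S y) B" by metis
  have eB: "cinner e (S y) = cinner (T e) y" if "e \<in> B" for e y
    using orthonormal_cinner_has_sum[OF o S that] .
  have "cinner (T x) y = cinner x (S y)" for x y
  proof -
    have "((\<lambda>e. T (cinner e x *\<^sub>C e)) has_sum T x) B"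
      by (rule has_sum_bounded_linear[OF bounded_clinear_linear[OF T] onb_expansion[OF B]])
    then have "((\<lambda>e. cinner y (T (cinner e x *\<^sub>C e))) has_sum cinner y (T x)) B"
      by (rule has_sum_bounded_linear[OF bounded_linear_cinner_right])
    moreover have "cinner y (T (cinner e x *\<^sub>C e)) = cinner (S y) e * cinner e x" if "e \<in> B" for e
      using eB[OF that, of y] cinner_commute[of y "T e"] cinner_commute[of "S y" e]
      by (simp add: bounded_clinear_scaleC[OF T] cinner_scaleC_right mult.commute)
    ultimately have "((\<lambda>e. cinner (S y) e * cinner e x) has_sum cinner y (T x)) B"
      by (simp cong: has_sum_cong)
    with onb_parseval[OF B, of "S y" x] have "cinner (S y) x = cinner y (T x)"
      by (metis has_sum_unique)
    then show ?thesis using cinner_commute[of "S y" x] cinner_commute[of y "T x"] by simp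
  qed
  then show ?thesis by blast
qed

lemma cinner_adj:
  assumes T: "bounded_clinear T"
  shows "cinner x (adj T y) = cinner (T x) y"
proof -
  obtain S where S: "\<forall>x y. cinner (T x) y = cinner x (S y)" using adjoint_exists[OF T] by blast
  have "S' = S" if "\<forall>x y. cinner (T x) y = cinner x (S' y)" for S'
  proof
    fix y
    have "cinner x (S' y) = cinner x (S y)" for x 
      using S[rule_format, of x y] that[rule_format, of x y] by simp
    then show "S' y = S y" by (rule cinner_ext)
  qed
  then have "adj T = S" unfolding adj_def using S by (intro the_equality)
  then show ?thesis using S by simp
qed

lemma add_self_eq_0_C: "(z::complex) + z = 0 \<Longrightarrow> z = 0"
  by (simp add: complex_eq_iff)

text \<open>
  Polarization: \<open>\<langle>z, P z\<rangle>\<close> is real for \<open>z = x + y\<close> and for \<open>z = x + i y\<close>.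
\<close>

lemma positive_op_symmetric:
  assumes "positive_op P"
  shows "cinner (P x) y = cinner x (P y)"
proof -
  have P: "bounded_clinear P" and pos: "\<And>x. cinner x (P x) \<in> \<real>\<^sub>\<ge>\<^sub>0"
    using assms by (auto simp: positive_op_def)
  let ?b = "\<lambda>x y. cinner x (P y) - cinner (P x) y"
  have re: "cinner z (P z) = cinner (P z) z" for z
  proof -
    have "cnj (cinner z (P z)) = cinner z (P z)"
      using pos[of z] by (auto elim!: nonneg_Reals_cases)
    then show ?thesis using cinner_commute[of "P z" z] by simp
  qed
  note exp = bounded_clinear_add[OF P] bounded_clinear_scaleC[OF P] cinner_add_left
    cinner_add_right cinner_scaleC_left cinner_scaleC_right complex_cnj_i
  have a: "?b x y + ?b y x = 0"
    using re[of "x + y", unfolded exp] re[of x] re[of y] by algebra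
  have b: "\<i> * ?b x y - \<i> * ?b y x = 0"
    using re[of "x + \<i> *\<^sub>C y", unfolded exp] re[of x] re[of y] by algebra
  have "\<i> * (?b x y - ?b y x) = 0" using b by (simp only: right_diff_distrib)
  then have "?b x y = ?b y x" by simp
  then have "?b x y = 0" using a by (metis add_self_eq_0_C)
  then show ?thesis by simp
qed

section \<open>Eigenvectors of an operator with Schatten class resolvent\<close>

lemma has_sum_norm_le:
  fixes f :: "'a \<Rightarrow> 'b::real_normed_vector"
  assumes "(f has_sum l) A" "\<And>F. finite F \<Longrightarrow> F \<subseteq> A \<Longrightarrow> norm (sum f F) \<le> K"
  shows "norm l \<le> K"
proof (rule tendsto_upperbound)
  show "((\<lambda>F. norm (sum f F)) \<longlongrightarrow> norm l) (finite_subsets_at_top A)"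
    using assms(1) unfolding has_sum_def by (rule tendsto_norm)
  show "eventually (\<lambda>F. norm (sum f F) \<le> K) (finite_subsets_at_top A)"
    using assms(2) by (intro eventually_finite_subsets_at_top_weakI) auto
qed simp

subsection \<open>Hilbert--Schmidt operators are compact\<close>

lemma compact_coefficient_sums:
  fixes v :: "'i \<Rightarrow> 'a::chilbert_space"
  assumes "finite F"
  shows "compact {\<Sum>e\<in>F. c e *\<^sub>C v e | c. \<forall>e\<in>F. cmod (c e) \<le> 1}"
  using assms
proof (induction F rule: finite_induct)
  case (insert a F)
  let ?X = "{\<Sum>e\<in>F. c e *\<^sub>C v e | c. \<forall>e\<in>F. cmod (c e) \<le> 1}"
  have "continuous_on (cball 0 1) (\<lambda>c. c *\<^sub>C v a)"
    by (intro linear_continuous_on bounded_bilinear.bounded_linear_left[OF bounded_bilinear_scaleC])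
  then have "compact ((\<lambda>c. c *\<^sub>C v a) ` cball 0 1)" by (rule compact_continuous_image) simp
  then have cp: "compact {x + y | x y. x \<in> (\<lambda>c. c *\<^sub>C v a) ` cball 0 1 \<and> y \<in> ?X}"
    using insert.IH by (rule compact_sums)
  have "{\<Sum>e\<in>insert a F. c e *\<^sub>C v e | c. \<forall>e\<in>insert a F. cmod (c e) \<le> 1}
     = {x + y | x y. x \<in> (\<lambda>c. c *\<^sub>C v a) ` cball 0 1 \<and> y \<in> ?X}" (is "?L = ?R")
  proof (rule set_eqI, rule iffI)
    fix z assume "z \<in> ?L"
    then obtain c where c: "z = (\<Sum>e\<in>insert a F. c e *\<^sub>C v e)" "\<forall>e\<in>insert a F. cmod (c e) \<le> 1" by blast
    have "z = c a *\<^sub>C v a + (\<Sum>e\<in>F. c e *\<^sub>C v e)" "c a \<in> cball 0 1" "\<forall>e\<in>F. cmod (c e) \<le> 1"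
      using c insert.hyps by auto
    then show "z \<in> ?R" by blast
  next
    fix z assume "z \<in> ?R"
    then obtain k c where kc: "cmod k \<le> 1" "\<forall>e\<in>F. cmod (c e) \<le> 1" "z = k *\<^sub>C v a + (\<Sum>e\<in>F. c e *\<^sub>C v e)"
      by auto
    have "(\<Sum>e\<in>F. c e *\<^sub>C v e) = (\<Sum>e\<in>F. (c(a := k)) e *\<^sub>C v e)"
      using insert.hyps by (intro sum.cong) auto
    then have "z = (\<Sum>e\<in>insert a F. (c(a := k)) e *\<^sub>C v e)" using kc insert.hyps by simp
    moreover have "\<forall>e\<in>insert a F. cmod ((c(a := k)) e) \<le> 1" using kc by auto
    ultimately show "z \<in> ?L" by blast
  qed
  then show ?case using cp by simp
qed simp

lemma hilbert_schmidt_tail: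
  assumes B: "orthonormal_basis B" and T: "bounded_clinear T"
    and F: "finite F" "F \<subseteq> B"
    and small: "\<And>G. finite G \<Longrightarrow> G \<subseteq> B - F \<Longrightarrow> (\<Sum>e\<in>G. (norm (T e))\<^sup>2) \<le> \<epsilon>\<^sup>2" and "\<epsilon> \<ge> 0"
  shows "norm (T x - (\<Sum>e\<in>F. cinner e x *\<^sub>C T e)) \<le> norm x * \<epsilon>"
proof -
  have o: "orthonormal B" using B by (rule orthonormal_basis_orthonormal)
  let ?f = "\<lambda>e. cinner e x *\<^sub>C T e"
  have "(?f has_sum T x) B"
    using has_sum_bounded_linear[OF bounded_clinear_linear[OF T] onb_expansion[OF B, of x]]
    by (simp add: bounded_clinear_scaleC[OF T])
  then have "(?f has_sum (T x - sum ?f F)) (B - F)"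
    using F by (intro has_sum_Diff has_sum_finite) auto
  then show ?thesis
  proof (rule has_sum_norm_le)
    fix G assume G: "finite G" "G \<subseteq> B - F"
    have "norm (sum ?f G) \<le> (\<Sum>e\<in>G. cmod (cinner e x) * norm (T e))"
      using norm_sum[of ?f G] by (simp add: norm_scaleC)
    also have "\<dots> \<le> norm x * \<epsilon>"
    proof (rule power2_le_imp_le)
      have "(\<Sum>e\<in>G. cmod (cinner e x) * norm (T e))\<^sup>2 \<le>
          (\<Sum>e\<in>G. (cmod (cinner e x))\<^sup>2) * (\<Sum>e\<in>G. (norm (T e))\<^sup>2)"
        by (rule Cauchy_Schwarz_ineq_sum)
      also have "\<dots> \<le> (norm x)\<^sup>2 * \<epsilon>\<^sup>2"
        using G by (intro mult_mono small bessel[OF o] sum_nonneg) auto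
      finally show "(\<Sum>e\<in>G. cmod (cinner e x) * norm (T e))\<^sup>2 \<le> (norm x * \<epsilon>)\<^sup>2"
        by (simp add: power_mult_distrib)
    qed (use \<open>\<epsilon> \<ge> 0\<close> in simp)
    finally show "norm (sum ?f G) \<le> norm x * \<epsilon>" .
  qed
qed

text \<open>
  Outside a finite set \<open>F\<close> of basis vectors the Hilbert--Schmidt tail is small, so the image of the unit ball
  lies close to the compact set of the \<open>\<Sum>\<^bsub>e\<in>F\<^esub> c\<^sub>e T e\<close> with \<open>\<bar>c\<^sub>e\<bar> \<le> 1\<close>; it is therefore totally bounded.
\<close>

lemma hilbert_schmidt_compact:
  assumes B: "orthonormal_basis B" and T: "bounded_clinear T"
    and K: "\<And>F. finite F \<Longrightarrow> F \<subseteq> B \<Longrightarrow> (\<Sum>e\<in>F. (norm (T e))\<^sup>2) \<le> K"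
  shows "compact (closure (T ` cball 0 1))"
proof -
  have o: "orthonormal B" using B by (rule orthonormal_basis_orthonormal)
  have cov: "\<exists>k. finite k \<and> closure (T ` cball 0 1) \<subseteq> (\<Union>x\<in>k. ball x r)" if r: "r > 0" for r
  proof -
    let ?g = "\<lambda>e. (norm (T e))\<^sup>2"
    define \<epsilon> where "\<epsilon> = r / 4"
    have e: "\<epsilon> > 0" using r by (simp add: \<epsilon>_def)
    have "?g summable_on B"
      by (rule nonneg_bdd_above_summable_on) (use K in \<open>auto simp: bdd_above_def\<close>)
    then obtain L where L: "(?g has_sum L) B" by (auto simp: summable_on_def)
    from has_sum_finite_approximation[OF L, of "\<epsilon>\<^sup>2"] e
    obtain F where F: "finite F" "F \<subseteq> B" "dist (sum ?g F) L \<le> \<epsilon>\<^sup>2" by auto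
    have small: "(\<Sum>e\<in>G. (norm (T e))\<^sup>2) \<le> \<epsilon>\<^sup>2" if G: "finite G" "G \<subseteq> B - F" for G
    proof -
      have "sum ?g (F \<union> G) \<le> L"
        using F G by (intro has_sum_mono2[OF has_sum_finite L]) auto
      moreover have "sum ?g (F \<union> G) = sum ?g F + sum ?g G"
        using F G by (intro sum.union_disjoint) auto
      ultimately show ?thesis using F(3) by (simp add: dist_real_def)
    qed
    let ?C = "{\<Sum>e\<in>F. c e *\<^sub>C T e | c. \<forall>e\<in>F. cmod (c e) \<le> 1}"
    have "compact ?C" using F(1) by (rule compact_coefficient_sums)
    then obtain k where k: "finite k" "?C \<subseteq> (\<Union>x\<in>k. ball x \<epsilon>)"
      unfolding compact_eq_totally_bounded using e by blast
    have "T ` cball 0 1 \<subseteq> (\<Union>x\<in>k. cball x (2 * \<epsilon>))"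
    proof
      fix z assume "z \<in> T ` cball 0 1"
      then obtain x where x: "norm x \<le> 1" "z = T x" by auto
      let ?w = "\<Sum>e\<in>F. cinner e x *\<^sub>C T e"
      have "norm (T x - ?w) \<le> norm x * \<epsilon>"
        by (rule hilbert_schmidt_tail[OF B T F(1,2) small]) (use e in auto)
      also have "\<dots> \<le> 1 * \<epsilon>" using x e by (intro mult_right_mono) auto
      finally have d: "dist ?w z \<le> \<epsilon>" using x by (simp add: dist_norm norm_minus_commute)
      have "cmod (cinner e x) \<le> 1" if "e \<in> F" for e
        using cauchy_schwarz[of e x] orthonormal_norm[OF o, of e] F(2) that x by auto
      then have "?w \<in> ?C" by (intro CollectI exI[of _ "\<lambda>e. cinner e x"]) simp
      then obtain y where y: "y \<in> k" "dist y ?w < \<epsilon>" using k(2) by auto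
      then have "dist y z \<le> 2 * \<epsilon>" using d dist_triangle[of y z ?w] by simp
      then show "z \<in> (\<Union>x\<in>k. cball x (2 * \<epsilon>))" using y by auto
    qed
    then have "closure (T ` cball 0 1) \<subseteq> (\<Union>x\<in>k. cball x (2 * \<epsilon>))"
      using k(1) by (intro closure_minimal closed_UN) auto
    also have "\<dots> \<subseteq> (\<Union>x\<in>k. ball x r)" using e r by (auto simp: \<epsilon>_def)
    finally show ?thesis using k(1) by blast
  qed
  have "complete (closure (T ` cball 0 1))" by (simp add: complete_eq_closed)
  then show ?thesis using cov unfolding compact_eq_totally_bounded by blast
qed

lemma hilbert_schmidt_subsequence:
  assumes "orthonormal_basis B" "bounded_clinear T"
    and "\<And>F. finite F \<Longrightarrow> F \<subseteq> B \<Longrightarrow> (\<Sum>e\<in>F. (norm (T e))\<^sup>2) \<le> K"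
    and x: "\<And>n. norm (x n) \<le> 1"
  obtains l and r :: "nat \<Rightarrow> nat" where "strict_mono r" "(\<lambda>n. T (x (r n))) \<longlonglongrightarrow> l"
proof -
  have "seq_compact (closure (T ` cball 0 1))"
    using hilbert_schmidt_compact[OF assms(1-3)] by (rule compact_imp_seq_compact)
  moreover have "\<forall>n. T (x n) \<in> closure (T ` cball 0 1)"
    using x closure_subset by fastforce
  ultimately obtain l r where "strict_mono r" "((\<lambda>n. T (x n)) \<circ> r) \<longlonglongrightarrow> l"
    by (rule seq_compactE)
  then show ?thesis using that by (simp add: o_def)
qed

subsection \<open>Powers of a positive operator\<close>

lemma positive_op_pow: "positive_op P \<Longrightarrow> positive_op (P ^^ n)"
proof (induction n rule: nat_induct2)
  case 0
  then show ?case
    using bounded_clinear_id by (simp add: positive_op_def id_def cinner_self del: of_real_power)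
next
  case (step n)
  have P: "bounded_clinear P" using step.prems by (simp add: positive_op_def)
  have "cinner x ((P ^^ (n + 2)) x) = cinner (P x) ((P ^^ n) (P x))" for x
    by (simp add: positive_op_symmetric[OF step.prems] funpow_swap1)
  then show ?case using step P bounded_clinear_pow[OF P] by (simp only: positive_op_def) auto
qed simp

text \<open>
  Expand \<open>0 \<le> \<langle>x - t T x, T (x - t T x)\<rangle>\<close> for \<open>t = 1 / (\<parallel>T\<parallel> + 1)\<close>. It follows that a positive operator
  with finite trace is Hilbert--Schmidt.
\<close>

lemma positive_op_norm_sq_le:
  assumes T: "positive_op T"
  shows "(norm (T x))\<^sup>2 \<le> (onorm T + 1) * Re (cinner x (T x))"
proof -
  have bT: "bounded_clinear T" using T by (simp add: positive_op_def)
  define N where "N = onorm T + 1"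
  have N: "N > 0" using onorm_pos_le[OF bounded_clinear_linear[OF bT]] by (simp add: N_def)
  let ?t = "complex_of_real (1 / N)"
  have pos: "Re (cinner z (T z)) \<ge> 0" for z
    using T by (auto simp: positive_op_def elim!: nonneg_Reals_cases dest: spec[of _ z])
  have "cinner (x - ?t *\<^sub>C T x) (T (x - ?t *\<^sub>C T x))
     = cinner x (T x) - 2 * ?t * of_real ((norm (T x))\<^sup>2) + ?t * ?t * cinner (T x) (T (T x))"
    using positive_op_symmetric[OF T, of x "T x"] cinner_self[of "T x"]
    by (simp add: bounded_clinear_diff[OF bT] bounded_clinear_scaleC[OF bT] cinner_diff_left
        cinner_diff_right cinner_scaleC_left cinner_scaleC_right algebra_simps del: of_real_power)
  then have "0 \<le> Re (cinner x (T x)) - 2 * (1 / N) * (norm (T x))\<^sup>2 + (1/N) * (1/N) * Re (cinner (T x) (T (T x)))"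
    using pos[of "x - ?t *\<^sub>C T x"] by (simp del: of_real_power of_real_divide)
  moreover have "(1/N) * (1/N) * Re (cinner (T x) (T (T x))) \<le> (1/N) * (1/N) * (N * (norm (T x))\<^sup>2)"
  proof (rule mult_left_mono)
    have "Re (cinner (T x) (T (T x))) \<le> norm (T x) * norm (T (T x))"
      using complex_Re_le_cmod cauchy_schwarz order_trans by blast
    also have "\<dots> \<le> norm (T x) * (N * norm (T x))"
    proof (rule mult_left_mono)
      have "norm (T (T x)) \<le> onorm T * norm (T x)" by (rule bounded_clinear_norm[OF bT])
      also have "\<dots> \<le> N * norm (T x)" unfolding N_def by (intro mult_right_mono) auto
      finally show "norm (T (T x)) \<le> N * norm (T x)" .
    qed simp
    finally show "Re (cinner (T x) (T (T x))) \<le> N * (norm (T x))\<^sup>2" by (simp add: power2_eq_square mult_ac)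
  qed simp
  moreover have "(1/N) * (1/N) * (N * (norm (T x))\<^sup>2) = (1 / N) * (norm (T x))\<^sup>2" using N by simp
  ultimately have "(1 / N) * (norm (T x))\<^sup>2 \<le> Re (cinner x (T x))" by argo
  then have "(norm (T x))\<^sup>2 \<le> N * Re (cinner x (T x))" using N by (simp add: field_simps)
  then show ?thesis unfolding N_def .
qed

subsection \<open>The resolvent\<close>

definition eigvec :: "('h::chilbert_space \<rightharpoonup> 'h) \<Rightarrow> 'h \<Rightarrow> bool"
  where "eigvec D e \<longleftrightarrow> e \<in> dom D \<and> (\<exists>d::real. the (D e) = complex_of_real d *\<^sub>C e)"

context
  fixes D :: "'h::chilbert_space \<rightharpoonup> 'h"
  assumes sa: "self_adjoint D"
begin

abbreviation (input) "Dv x \<equiv> the (D x)"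

lemma
  shows sa_zero: "0 \<in> dom D"
    and sa_add_dom: "x \<in> dom D \<Longrightarrow> y \<in> dom D \<Longrightarrow> x + y \<in> dom D"
    and sa_add: "x \<in> dom D \<Longrightarrow> y \<in> dom D \<Longrightarrow> Dv (x + y) = Dv x + Dv y"
    and sa_scale_dom: "x \<in> dom D \<Longrightarrow> c *\<^sub>C x \<in> dom D"
    and sa_scale: "x \<in> dom D \<Longrightarrow> Dv (c *\<^sub>C x) = c *\<^sub>C Dv x"
proof -
  have D: "0 \<in> dom D" "\<And>x y. x \<in> dom D \<Longrightarrow> y \<in> dom D \<Longrightarrow> D (x + y) = Some (Dv x + Dv y)"
    "\<And>c x. x \<in> dom D \<Longrightarrow> D (c *\<^sub>C x) = Some (c *\<^sub>C Dv x)"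
    using sa unfolding self_adjoint_def by blast+
  show "0 \<in> dom D" by (rule D(1))
  show "x + y \<in> dom D" "Dv (x + y) = Dv x + Dv y" if "x \<in> dom D" "y \<in> dom D"
    using D(2)[OF that] by auto
  show "c *\<^sub>C x \<in> dom D" "Dv (c *\<^sub>C x) = c *\<^sub>C Dv x" if "x \<in> dom D"
    using D(3)[OF that, of c] by auto
qed

lemma sa_diff_dom: "x \<in> dom D \<Longrightarrow> y \<in> dom D \<Longrightarrow> x - y \<in> dom D"
  and sa_diff: "x \<in> dom D \<Longrightarrow> y \<in> dom D \<Longrightarrow> Dv (x - y) = Dv x - Dv y"
proof -
  assume a: "x \<in> dom D" "y \<in> dom D"
  have e: "x - y = x + (- 1) *\<^sub>C y" by (simp add: scaleC_minus_left)
  show "x - y \<in> dom D" unfolding e by (intro sa_add_dom sa_scale_dom a)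
  show "Dv (x - y) = Dv x - Dv y"
    unfolding e sa_add[OF a(1) sa_scale_dom[OF a(2)]] sa_scale[OF a(2)]
    by (simp add: scaleC_minus_left)
qed

lemma sa_symmetric: "x \<in> dom D \<Longrightarrow> y \<in> dom D \<Longrightarrow> cinner (Dv x) y = cinner x (Dv y)"
  using sa unfolding self_adjoint_def by (metis domD option.sel)

lemma sa_maximal:
  assumes "\<And>x. x \<in> dom D \<Longrightarrow> cinner (Dv x) y = cinner x z"
  shows "y \<in> dom D" "Dv y = z"
  using sa assms unfolding self_adjoint_def by (metis domI, metis option.sel)

lemma sa_dense: "closure (dom D) = UNIV"
  using sa unfolding self_adjoint_def by blast

lemma sa_norm_minus_i:
  assumes x: "x \<in> dom D"
  shows "(norm (Dv x - \<i> *\<^sub>C x))\<^sup>2 = (norm (Dv x))\<^sup>2 + (norm x)\<^sup>2"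
proof -
  have "cinner (Dv x) x = cnj (cinner (Dv x) x)"
    using sa_symmetric[OF x x] cinner_commute[of x "Dv x"] by simp
  then have "Im (cinner (Dv x) x) = 0" by (simp add: complex_eq_iff)
  then show ?thesis unfolding norm_sq_diff_scaleC by simp
qed

context
  assumes R: "bounded_clinear (resolvent_i D)"
begin

text \<open>
  Outside the range of \<open>D - i\<close> the function \<open>resolvent_i D\<close> takes one fixed value. If \<open>z\<close> were such a
  point and \<open>y\<close> in the range, then \<open>y + z\<close> is not in the range either, and by linearity \<open>R y = R (y + z) - R z = 0\<close>. Hence
  \<open>D - i\<close> vanishes, its domain is \<open>0\<close>, and by density so is the whole space.
\<close>

lemma resolvent_surj: "z \<in> (\<lambda>x. Dv x - \<i> *\<^sub>C x) ` dom D"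
proof (rule ccontr)
  let ?f = "\<lambda>x. Dv x - \<i> *\<^sub>C x" and ?R = "resolvent_i D"
  assume z: "z \<notin> ?f ` dom D"
  have out: "?R y = (SOME x. False)" if "y \<notin> ?f ` dom D" for y
    unfolding resolvent_i_def inv_into_def using that by (intro arg_cong[where f = Eps]) auto
  have "?R y = 0" if y: "y \<in> ?f ` dom D" for y
  proof -
    have "y + z \<notin> ?f ` dom D"
    proof
      assume "y + z \<in> ?f ` dom D"
      then obtain a where a: "a \<in> dom D" "y + z = ?f a" by auto
      obtain b where b: "b \<in> dom D" "y = ?f b" using y by auto
      have "z = ?f (a - b)" using a b by (simp add: sa_diff scaleC_diff_right algebra_simps)
      then show False using z sa_diff_dom[OF a(1) b(1)] by blast
    qed
    then have "?R (y + z) = ?R z" using out z by simp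
    then show ?thesis by (simp add: bounded_clinear_add[OF R])
  qed
  then have R0: "?R y = 0" if "y \<in> ?f ` dom D" for y using that by blast
  have f0: "?f 0 = 0" using sa_scale[OF sa_zero, of 0] by simp
  have "x = 0" if a: "x \<in> dom D" for x
  proof -
    have "?f (?R (?f x)) = ?f x"
      unfolding resolvent_i_def by (rule f_inv_into_f) (rule imageI[OF a])
    moreover have "?R (?f x) = 0" by (rule R0[OF imageI[OF a]])
    ultimately have "?f x = 0" using f0 by simp
    then show "x = 0" using sa_norm_minus_i[OF a] by (simp add: sum_power2_eq_zero_iff)
  qed
  then have "dom D = {0}" using sa_zero by auto
  then have "z = 0" using sa_dense by (metis UNIV_I closure_closed closed_singleton singletonD)
  moreover have "0 \<in> ?f ` dom D" using sa_zero sa_scale[OF sa_zero, of 0] by (intro image_eqI[of _ _ 0]) auto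
  ultimately show False using z by simp
qed

lemma resolvent_dom: "resolvent_i D z \<in> dom D"
  unfolding resolvent_i_def by (rule inv_into_into[OF resolvent_surj])

lemma resolvent_eq: "Dv (resolvent_i D z) - \<i> *\<^sub>C resolvent_i D z = z"
  using f_inv_into_f[OF resolvent_surj, of z] unfolding resolvent_i_def .

lemma resolvent_left: "a \<in> dom D \<Longrightarrow> resolvent_i D (Dv a - \<i> *\<^sub>C a) = a"
proof -
  assume a: "a \<in> dom D"
  let ?b = "resolvent_i D (Dv a - \<i> *\<^sub>C a)"
  have "Dv (?b - a) - \<i> *\<^sub>C (?b - a) = 0"
    using resolvent_eq[of "Dv a - \<i> *\<^sub>C a"]
    by (simp add: sa_diff[OF resolvent_dom a] scaleC_diff_right algebra_simps)
  then have "norm (?b - a) = 0"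
    using sa_norm_minus_i[OF sa_diff_dom[OF resolvent_dom a], of "Dv a - \<i> *\<^sub>C a"] by (simp add: sum_power2_eq_zero_iff)
  then show ?thesis by simp
qed

text \<open>The operator \<open>R\<^sup>* R\<close> is \<open>(1 + D\<^sup>2)\<^sup>-\<^sup>1\<close>.\<close>

lemma resolvent_adj_comp:
  fixes x :: 'h
  defines "v \<equiv> adj (resolvent_i D) (resolvent_i D x)"
  shows "v \<in> dom D" "Dv v \<in> dom D" "Dv (Dv v) = x - v"
proof -
  let ?R = "resolvent_i D"
  have "cinner (Dv a) v = cinner a (?R x - \<i> *\<^sub>C v)" if a: "a \<in> dom D" for a
  proof -
    have "cinner (Dv a - \<i> *\<^sub>C a) v = cinner a (?R x)"
      unfolding v_def by (simp add: cinner_adj[OF R] resolvent_left[OF a])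
    then show ?thesis
      by (simp add: cinner_diff_left cinner_diff_right cinner_scaleC_left cinner_scaleC_right algebra_simps)
  qed
  from sa_maximal[OF this] have v: "v \<in> dom D" and Dvv: "Dv v = ?R x - \<i> *\<^sub>C v" by auto
  show "v \<in> dom D" by (rule v)
  show "Dv v \<in> dom D" unfolding Dvv by (intro sa_diff_dom sa_scale_dom v resolvent_dom)
  have "Dv (Dv v) = Dv (?R x) - \<i> *\<^sub>C (?R x - \<i> *\<^sub>C v)"
    unfolding Dvv[symmetric] by (subst Dvv) (simp add: sa_diff sa_scale_dom sa_scale v resolvent_dom)
  also have "\<dots> = x - v"
    using resolvent_eq[of x] by (simp add: scaleC_diff_right scaleC_scaleC scaleC_minus_left algebra_simps)
  finally show "Dv (Dv v) = x - v" .
qed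

subsection \<open>An eigenbasis\<close>

lemma resolvent_adj_comp_orthogonal:
  assumes e: "eigvec D e" and x: "cinner e x = 0"
  shows "cinner e (adj (resolvent_i D) (resolvent_i D x)) = 0"
proof -
  let ?v = "adj (resolvent_i D) (resolvent_i D x)"
  obtain d where d: "e \<in> dom D" "Dv e = complex_of_real d *\<^sub>C e" using e by (auto simp: eigvec_def)
  note v = resolvent_adj_comp[of x]
  have "cinner e (x - ?v) = cinner (Dv e) (Dv ?v)"
    using sa_symmetric[OF d(1) v(2)] v(3) by simp
  also have "\<dots> = of_real d * cinner (Dv e) ?v"
    using sa_symmetric[OF d(1) v(1)] by (simp add: d(2) cinner_scaleC_left)
  also have "\<dots> = of_real (d\<^sup>2) * cinner e ?v" by (simp add: d(2) cinner_scaleC_left power2_eq_square)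
  finally have "of_real (d\<^sup>2) * cinner e ?v = cinner e (x - ?v)" by simp
  then have "(of_real (1 + d\<^sup>2)) * cinner e ?v = 0"
    using x unfolding cinner_diff_right by (simp add: distrib_right)
  moreover have "complex_of_real (1 + d\<^sup>2) \<noteq> 0"
    using zero_le_power2[of d] by (simp only: of_real_eq_0_iff)
  ultimately show ?thesis by (metis mult_eq_0_iff)
qed

text \<open>
  From \<open>R\<^sup>* R x = q x\<close> it follows that \<open>D\<^sup>2 x = c\<^sup>2 x\<close> with \<open>c\<^sup>2 = 1 / q - 1\<close>, that is \<open>(D + c) (D - c) x = 0\<close>. So either
  \<open>x\<close> or \<open>(D - c) x\<close> is an eigenvector of \<open>D\<close>.
\<close>

lemma eigvec_of_resolvent_eigvec:
  fixes q :: real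
  assumes x: "x \<noteq> 0" and q: "q > 0"
    and eq: "adj (resolvent_i D) (resolvent_i D x) = complex_of_real q *\<^sub>C x"
    and orth: "\<forall>e\<in>B. eigvec D e" "\<forall>e\<in>B. cinner e x = 0"
  shows "\<exists>y. eigvec D y \<and> norm y = 1 \<and> (\<forall>e\<in>B. cinner e y = 0)"
proof -
  note v = resolvent_adj_comp[of x, unfolded eq]
  have q': "complex_of_real (1 / q) * complex_of_real q = 1" using q by simp
  have xx: "x = complex_of_real (1 / q) *\<^sub>C complex_of_real q *\<^sub>C x"
    unfolding scaleC_scaleC q' by simp
  have xd: "x \<in> dom D" using sa_scale_dom[OF v(1), of "complex_of_real (1 / q)"] xx by simp
  have Dqx: "Dv (complex_of_real q *\<^sub>C x) = complex_of_real q *\<^sub>C Dv x" by (rule sa_scale[OF xd])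
  have Dx: "Dv x = complex_of_real (1 / q) *\<^sub>C complex_of_real q *\<^sub>C Dv x"
    unfolding scaleC_scaleC q' by simp
  have Dxd: "Dv x \<in> dom D"
    using sa_scale_dom[OF v(2), of "complex_of_real (1 / q)"] unfolding Dqx Dx[symmetric] .
  have "complex_of_real q *\<^sub>C Dv (Dv x) = x - complex_of_real q *\<^sub>C x"
    using v(3) unfolding Dqx sa_scale[OF Dxd] .
  then have "complex_of_real (1 / q) *\<^sub>C complex_of_real q *\<^sub>C Dv (Dv x)
      = complex_of_real (1 / q) *\<^sub>C (x - complex_of_real q *\<^sub>C x)" by simp
  then have DD: "Dv (Dv x) = complex_of_real (1 / q - 1) *\<^sub>C x"
    unfolding scaleC_scaleC q' scaleC_diff_right by (simp add: scaleC_diff_left)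
  have "complex_of_real ((norm (Dv x))\<^sup>2) = complex_of_real ((1 / q - 1) * (norm x)\<^sup>2)"
    using sa_symmetric[OF xd Dxd] unfolding DD cinner_scaleC_right cinner_self by simp
  then have "(1 / q - 1) * (norm x)\<^sup>2 = (norm (Dv x))\<^sup>2" by (simp only: of_real_eq_iff)
  then have "(1 / q - 1) * (norm x)\<^sup>2 \<ge> 0" by simp
  then have nn: "1 / q - 1 \<ge> 0" using x by (simp add: zero_le_mult_iff)
  define c where "c = sqrt (1 / q - 1)"
  have cc: "complex_of_real (1 / q - 1) = of_real c * of_real c"
    using nn by (simp add: c_def flip: of_real_mult)
  define y where "y = Dv x - complex_of_real c *\<^sub>C x"
  have yd: "y \<in> dom D" unfolding y_def by (intro sa_diff_dom Dxd sa_scale_dom xd)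
  have Dy: "Dv y = complex_of_real (- c) *\<^sub>C y"
    unfolding y_def sa_diff[OF Dxd sa_scale_dom[OF xd]] DD cc sa_scale[OF xd]
    by (simp add: scaleC_diff_right scaleC_scaleC scaleC_minus_left)
  have or: "\<forall>e\<in>B. cinner e y = 0"
  proof
    fix e assume e: "e \<in> B"
    obtain d where d: "e \<in> dom D" "Dv e = complex_of_real d *\<^sub>C e" using e orth(1) by (auto simp: eigvec_def)
    show "cinner e y = 0" unfolding y_def cinner_diff_right sa_symmetric[OF d(1) xd, symmetric]
      using orth(2) e by (simp add: d(2) cinner_scaleC_left cinner_scaleC_right)
  qed
  have norm1: ?thesis if z: "z \<noteq> 0" "eigvec D z" "\<forall>e\<in>B. cinner e z = 0" for z
  proof (intro exI conjI)
    let ?z = "complex_of_real (1 / norm z) *\<^sub>C z"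
    show "eigvec D ?z"
      using z(2) by (auto simp: eigvec_def sa_scale_dom sa_scale scaleC_scaleC mult.commute)
    show "norm ?z = 1" using z(1) by (simp add: norm_scaleC norm_divide)
    show "\<forall>e\<in>B. cinner e ?z = 0" using z(3) by (simp add: cinner_scaleC_right)
  qed
  show ?thesis
  proof (cases "y = 0")
    case True
    then have "eigvec D x" using xd by (auto simp: eigvec_def y_def)
    then show ?thesis using norm1 x orth(2) by blast
  next
    case False
    have "eigvec D y" using yd Dy unfolding eigvec_def by blast
    then show ?thesis using norm1 False or by blast
  qed
qed

text \<open>
  The spectral theorem for compact operators, applied to \<open>S = R\<^sup>* R = P\<^sup>2\<close> on the orthogonal complement of
  the eigenvectors found so far. Unit vectors \<open>x\<^sub>n\<close> for which \<open>\<parallel>R x\<^sub>n\<parallel>\<^sup>2\<close> approaches its supremum \<open>q\<close> satisfy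
  \<open>(S - q) x\<^sub>n \<longlonglongrightarrow> 0\<close>, hence also \<open>(S\<^sup>s - q\<^sup>s) x\<^sub>n \<longlonglongrightarrow> 0\<close>; and \<open>S\<^sup>s = (P\<^sup>s)\<^sup>2\<close> is compact since \<open>P\<^sup>s\<close> has a finite trace. So a
  subsequence of \<open>x\<^sub>n\<close> converges, to an eigenvector of \<open>S\<close>.
\<close>

lemma resolvent_eigvec_exists:
  assumes P: "positive_op P" "P \<circ> P = adj (resolvent_i D) \<circ> resolvent_i D"
    and tr: "has_trace (P ^^ s) c"
    and B: "\<forall>e\<in>B. eigvec D e" and x0: "\<forall>e\<in>B. cinner e x0 = 0" "x0 \<noteq> 0"
  shows "\<exists>y. eigvec D y \<and> norm y = 1 \<and> (\<forall>e\<in>B. cinner e y = 0)"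
proof -
  let ?R = "resolvent_i D"
  define S where "S = P \<circ> P"
  have bP: "bounded_clinear P" using P by (simp add: positive_op_def)
  have bS: "bounded_clinear S" unfolding S_def by (intro bounded_clinear_compose bP)
  have SR: "S x = adj ?R (?R x)" for x using P(2) by (metis S_def comp_apply)
  have RS: "cinner y (S x) = cinner (?R y) (?R x)" for x y unfolding SR by (rule cinner_adj[OF R])
  define M where "M = {x. \<forall>e\<in>B. cinner e x = 0}"
  have SM: "S x \<in> M" if "x \<in> M" for x
    using that B resolvent_adj_comp_orthogonal unfolding M_def SR by blast
  have scM: "a *\<^sub>C x \<in> M" if "x \<in> M" for x a using that by (simp add: M_def cinner_scaleC_right)
  define U where "U = {x \<in> M. norm x = 1}"
  define q where "q = Sup ((\<lambda>x. (norm (?R x))\<^sup>2) ` U)"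
  have x1: "complex_of_real (1 / norm x) *\<^sub>C x \<in> U" if "x \<in> M" "x \<noteq> 0" for x
    using that by (simp add: U_def scM norm_scaleC norm_divide)
  have ne: "U \<noteq> {}" using x1[of x0] x0 by (auto simp: M_def)
  have bdd: "bdd_above ((\<lambda>x. (norm (?R x))\<^sup>2) ` U)"
  proof (rule bdd_aboveI2)
    fix x assume "x \<in> U"
    then have "norm (?R x) \<le> onorm ?R" using bounded_clinear_norm[OF R, of x] by (simp add: U_def)
    then show "(norm (?R x))\<^sup>2 \<le> (onorm ?R)\<^sup>2" by (simp add: power_mono)
  qed
  have Rinj: "x = 0" if "?R x = 0" for x
    using resolvent_eq[of x] that sa_scale[OF sa_zero, of 0] by simp
  have Rq1: "(norm (?R x))\<^sup>2 \<le> q" if "x \<in> U" for x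
    unfolding q_def by (rule cSup_upper[OF imageI[OF that] bdd])
  have qpos: "q > 0"
  proof -
    obtain u where u: "u \<in> U" using ne by auto
    then have "u \<noteq> 0" by (auto simp: U_def)
    then have "?R u \<noteq> 0" using Rinj by blast
    then have "0 < (norm (?R u))\<^sup>2" by simp
    also have "\<dots> \<le> q" by (rule Rq1[OF u])
    finally show ?thesis .
  qed
  have Rq: "norm (?R x) \<le> sqrt q * norm x" if "x \<in> M" for x
  proof (cases "x = 0")
    case False
    have "norm (?R (complex_of_real (1 / norm x) *\<^sub>C x)) \<le> sqrt q"
      using Rq1[OF x1[OF that False]] by (rule real_le_rsqrt)
    then show ?thesis using False
      by (simp add: bounded_clinear_scaleC[OF R] norm_scaleC norm_divide field_simps)
  qed (simp add: bounded_clinear_zero[OF R])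
  \<comment> \<open>\<open>S\<close> maps \<open>M\<close> into itself, so the bound for \<open>R\<close> on \<open>M\<close> may be used for \<open>S x\<close> as well.\<close>
  have Sq: "norm (S x) \<le> q * norm x" if x: "x \<in> M" for x
  proof (cases "S x = 0")
    case False
    have "(norm (S x))\<^sup>2 = cmod (cinner (?R (S x)) (?R x))"
      using RS[of "S x" x] by (simp add: cmod_cinner_self[symmetric])
    also have "\<dots> \<le> norm (?R (S x)) * norm (?R x)" by (rule cauchy_schwarz)
    also have "\<dots> \<le> (sqrt q * norm (S x)) * (sqrt q * norm x)"
      using x SM qpos by (intro mult_mono Rq) auto
    also have "\<dots> = norm (S x) * (q * norm x)" using qpos by simp
    finally show ?thesis using False by (simp add: power2_eq_square)
  qed (use qpos in simp)
  have "\<exists>x\<in>U. q - 1 / real (Suc n) < (norm (?R x))\<^sup>2" for n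
    using less_cSup_iff[OF _ bdd, of "q - 1 / real (Suc n)"] ne unfolding q_def[symmetric] by auto
  then obtain x where x: "\<And>n. x n \<in> U" "\<And>n. q - 1 / real (Suc n) < (norm (?R (x n)))\<^sup>2" by metis
  have xM: "x n \<in> M" and xn: "norm (x n) = 1" for n using x(1)[of n] by (auto simp: U_def)
  let ?q = "complex_of_real q"
  have dif: "(\<lambda>n. S (x n) - ?q *\<^sub>C x n) \<longlonglongrightarrow> 0"
  proof -
    have le: "(norm (S (x n) - ?q *\<^sub>C x n))\<^sup>2 \<le> 2 * q * (1 / real (Suc n))" for n
    proof -
      have "Re (?q * cinner (S (x n)) (x n)) = q * (norm (?R (x n)))\<^sup>2"
        using RS[of "x n" "x n"] cinner_commute[of "S (x n)" "x n"] by (simp add: cinner_self)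
      moreover have "(norm (S (x n)))\<^sup>2 \<le> q\<^sup>2"
        using Sq[OF xM, of n] qpos by (simp add: xn power_mono)
      moreover have "q * (q - 1 / real (Suc n)) \<le> q * (norm (?R (x n)))\<^sup>2"
        using x(2)[of n] qpos by (intro mult_left_mono) auto
      ultimately show ?thesis unfolding norm_sq_diff_scaleC using qpos
        by (simp add: xn power2_eq_square right_diff_distrib)
    qed
    have "(\<lambda>n. (norm (S (x n) - ?q *\<^sub>C x n))\<^sup>2) \<longlonglongrightarrow> 0"
    proof (rule tendsto_sandwich[OF _ _ tendsto_const])
      show "(\<lambda>n. 2 * q * (1 / real (Suc n))) \<longlonglongrightarrow> 0"
        using tendsto_mult_right_zero[OF lim_inverse_n'[THEN LIMSEQ_Suc], of "2 * q"] by simp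
    qed (use le in \<open>auto intro!: always_eventually\<close>)
    then have "(\<lambda>n. sqrt ((norm (S (x n) - ?q *\<^sub>C x n))\<^sup>2)) \<longlonglongrightarrow> sqrt 0" by (rule tendsto_real_sqrt)
    then show ?thesis by (simp add: tendsto_norm_zero_iff)
  qed
  have lS: "bounded_linear S" by (rule bounded_clinear_linear[OF bS])
  have difk: "(\<lambda>n. (S ^^ k) (x n) - (?q ^ k) *\<^sub>C x n) \<longlonglongrightarrow> 0" for k
  proof (induction k)
    case (Suc k)
    have "(\<lambda>n. S ((S ^^ k) (x n) - (?q ^ k) *\<^sub>C x n) + (?q ^ k) *\<^sub>C (S (x n) - ?q *\<^sub>C x n)) \<longlonglongrightarrow> S 0 + (?q ^ k) *\<^sub>C 0"
      by (intro tendsto_add bounded_linear.tendsto[OF lS] Suc tendsto_scaleC tendsto_const dif)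
    then show ?case
      by (simp add: bounded_clinear_zero[OF bS] bounded_clinear_diff[OF bS] bounded_clinear_scaleC[OF bS]
          scaleC_diff_right scaleC_scaleC mult.commute)
  qed simp
  have SP: "S ^^ s = (P ^^ s) \<circ> (P ^^ s)"
    by (metis S_def funpow_add funpow_mult mult_2 numeral_2_eq_2 funpow_Suc_right funpow_0 comp_id id_def
        funpow.simps mult.commute o_id)
  define T where "T = P ^^ s"
  have T: "positive_op T" unfolding T_def by (rule positive_op_pow[OF P(1)])
  have bT: "bounded_clinear T" using T by (simp add: positive_op_def)
  obtain E :: "'h set" where E: "orthonormal_basis E" using onb_exists by blast
  have "((\<lambda>e. cinner e (T e)) has_sum c) E" using tr E by (simp add: has_trace_def T_def)
  from has_sum_bounded_linear[OF bounded_linear_Re this]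
  have trE: "((\<lambda>e. Re (cinner e (T e))) has_sum Re c) E" .
  have Tpos: "Re (cinner e (T e)) \<ge> 0" for e
    using T by (auto simp: positive_op_def elim!: nonneg_Reals_cases dest: spec[of _ e])
  have oT: "onorm T \<ge> 0" by (rule onorm_pos_le[OF bounded_clinear_linear[OF bT]])
  have HS: "(\<Sum>e\<in>F. (norm (T e))\<^sup>2) \<le> (onorm T + 1) * Re c" if F: "finite F" "F \<subseteq> E" for F
  proof -
    have "(\<Sum>e\<in>F. (norm (T e))\<^sup>2) \<le> (\<Sum>e\<in>F. (onorm T + 1) * Re (cinner e (T e)))"
      by (intro sum_mono positive_op_norm_sq_le[OF T])
    also have "\<dots> = (onorm T + 1) * (\<Sum>e\<in>F. Re (cinner e (T e)))" by (rule sum_distrib_left[symmetric])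
    also have "\<dots> \<le> (onorm T + 1) * Re c"
      using F oT Tpos by (intro mult_left_mono has_sum_mono2[OF has_sum_finite trE]) auto
    finally show ?thesis .
  qed
  obtain l and r :: "nat \<Rightarrow> nat" where r: "strict_mono r" "(\<lambda>n. T (x (r n))) \<longlonglongrightarrow> l"
    by (rule hilbert_schmidt_subsequence[OF E bT HS, where x = x]) (auto simp: xn)
  have "(\<lambda>n. T (T (x (r n)))) \<longlonglongrightarrow> T l"
    by (rule bounded_linear.tendsto[OF bounded_clinear_linear[OF bT] r(2)])
  moreover have "(\<lambda>n. (S ^^ s) (x (r n)) - (?q ^ s) *\<^sub>C x (r n)) \<longlonglongrightarrow> 0"
    using LIMSEQ_subseq_LIMSEQ[OF difk r(1)] by (simp add: o_def)
  ultimately have "(\<lambda>n. T (T (x (r n))) - ((S ^^ s) (x (r n)) - (?q ^ s) *\<^sub>C x (r n))) \<longlonglongrightarrow> T l - 0"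
    by (rule tendsto_diff)
  then have "(\<lambda>n. (?q ^ s) *\<^sub>C x (r n)) \<longlonglongrightarrow> T l" by (simp add: SP T_def)
  then have "(\<lambda>n. (1 / ?q ^ s) *\<^sub>C (?q ^ s) *\<^sub>C x (r n)) \<longlonglongrightarrow> (1 / ?q ^ s) *\<^sub>C T l"
    by (intro tendsto_scaleC tendsto_const)
  then have lim: "(\<lambda>n. x (r n)) \<longlonglongrightarrow> (1 / ?q ^ s) *\<^sub>C T l" (is "_ \<longlonglongrightarrow> ?y")
    using qpos by (simp add: scaleC_scaleC)
  have "(\<lambda>n. norm (x (r n))) \<longlonglongrightarrow> norm ?y" by (rule tendsto_norm[OF lim])
  then have ny: "norm ?y = 1" unfolding xn by (simp add: LIMSEQ_const_iff)
  have yB: "cinner e ?y = 0" if e: "e \<in> B" for e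
  proof -
    have "(\<lambda>n. cinner e (x (r n))) \<longlonglongrightarrow> cinner e ?y" by (intro tendsto_cinner tendsto_const lim)
    moreover have "cinner e (x (r n)) = 0" for n using xM[of "r n"] e by (simp add: M_def)
    ultimately show ?thesis by (simp add: LIMSEQ_const_iff)
  qed
  have "(\<lambda>n. S (x (r n)) - ?q *\<^sub>C x (r n)) \<longlonglongrightarrow> S ?y - ?q *\<^sub>C ?y"
    by (intro tendsto_diff bounded_linear.tendsto[OF lS] tendsto_scaleC tendsto_const lim)
  moreover have "(\<lambda>n. S (x (r n)) - ?q *\<^sub>C x (r n)) \<longlonglongrightarrow> 0"
    using LIMSEQ_subseq_LIMSEQ[OF dif r(1)] by (simp add: o_def)
  ultimately have "S ?y = ?q *\<^sub>C ?y" using LIMSEQ_unique by fastforce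
  then show ?thesis
    using eigvec_of_resolvent_eigvec[of ?y q B] ny qpos B yB unfolding SR by fastforce
qed

end

end

text \<open>
  On an eigenvector of \<open>D\<close> with eigenvalue \<open>d\<close>, the absolute value \<open>P\<close> of the resolvent acts as \<open>m = 1 / \<bar>d - i\<bar>\<close>:
  with \<open>P\<^sup>2 e = m\<^sup>2 e\<close>, the vector \<open>y = (P - m) e\<close> has \<open>P y = - m y\<close>, so it vanishes by positivity. The trace of
  \<open>P\<^sup>s\<close> is thus the sum of the \<open>m\<^sup>s\<close>.
\<close>

lemma schatten_resolvent_eigenbasis:
  fixes D :: "'h::chilbert_space \<rightharpoonup> 'h"
  assumes sa: "self_adjoint D" and sch: "resolvent_i D \<in> schatten s"
  shows "\<exists>B d \<tau>. orthonormal_basis B \<and> (\<forall>e\<in>B. D e = Some (complex_of_real (d e) *\<^sub>C e)) \<and>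
    (\<forall>F. finite F \<longrightarrow> F \<subseteq> B \<longrightarrow> (\<Sum>e\<in>F. (1 / cmod (complex_of_real (d e) - \<i>)) ^ s) \<le> \<tau>)"
proof -
  let ?R = "resolvent_i D"
  obtain P c where R: "bounded_clinear ?R" and P: "positive_op P" "P \<circ> P = adj ?R \<circ> ?R"
    and tr: "has_trace (P ^^ s) c" using sch by (auto simp: schatten_def)
  have bP: "bounded_clinear P" using P by (simp add: positive_op_def)
  obtain B where B: "orthonormal_basis B" "\<forall>e\<in>B. eigvec D e"
    using orthonormal_basis_exists[of "eigvec D"] resolvent_eigvec_exists[OF sa R P tr] by blast
  then obtain d where d: "\<And>e. e \<in> B \<Longrightarrow> e \<in> dom D" "\<And>e. e \<in> B \<Longrightarrow> the (D e) = complex_of_real (d e) *\<^sub>C e"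
    unfolding eigvec_def by (metis (no_types))
  have o: "orthonormal B" using B(1) by (rule orthonormal_basis_orthonormal)
  define m where "m e = 1 / cmod (complex_of_real (d e) - \<i>)" for e
  have nz: "complex_of_real (d e) - \<i> \<noteq> 0" for e by (auto simp: complex_eq_iff)
  have m: "m e > 0" for e using nz[of e] by (simp add: m_def)
  have Re: "?R e = (1 / (complex_of_real (d e) - \<i>)) *\<^sub>C e" if "e \<in> B" for e
  proof -
    have "?R ((complex_of_real (d e) - \<i>) *\<^sub>C e) = e"
      using resolvent_left[OF sa R d(1)[OF that]] d(2)[OF that] by (simp add: scaleC_diff_left)
    then have "(1 / (complex_of_real (d e) - \<i>)) *\<^sub>C (complex_of_real (d e) - \<i>) *\<^sub>C ?R e
       = (1 / (complex_of_real (d e) - \<i>)) *\<^sub>C e"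
      by (simp add: bounded_clinear_scaleC[OF R])
    then show ?thesis using nz[of e] by (simp add: scaleC_scaleC)
  qed
  have Pe: "P e = complex_of_real (m e) *\<^sub>C e" if e: "e \<in> B" for e
  proof -
    have "P (P e) = complex_of_real ((m e)\<^sup>2) *\<^sub>C e"
    proof (rule onb_ext[OF B(1)])
      fix e' assume e': "e' \<in> B"
      have "cinner e' (P (P e)) = cinner (?R e') (?R e)"
        using P(2) cinner_adj[OF R, of e' "?R e"] by (metis comp_apply)
      also have "\<dots> = (if e' = e then of_real ((m e)\<^sup>2) else 0)"
        using o e e' nz[of e]
        by (auto simp: Re cinner_scaleC_left cinner_scaleC_right orthonormal_def m_def power_divide
            norm_divide complex_norm_square simp del: of_real_power complex_cnj_diff)
      also have "\<dots> = cinner e' (complex_of_real ((m e)\<^sup>2) *\<^sub>C e)"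
        using o e e' by (auto simp: cinner_scaleC_right orthonormal_def)
      finally show "cinner e' (P (P e)) = cinner e' (complex_of_real ((m e)\<^sup>2) *\<^sub>C e)" .
    qed
    define y where "y = P e - complex_of_real (m e) *\<^sub>C e"
    have "P y = complex_of_real (- m e) *\<^sub>C y"
      unfolding y_def bounded_clinear_diff[OF bP] bounded_clinear_scaleC[OF bP] \<open>P (P e) = _\<close>
      by (simp add: scaleC_diff_right scaleC_scaleC scaleC_minus_left power2_eq_square)
    then have "cinner y (P y) = complex_of_real (- m e * (norm y)\<^sup>2)"
      by (simp add: cinner_scaleC_right cinner_self)
    moreover have "cinner y (P y) \<in> \<real>\<^sub>\<ge>\<^sub>0" using P(1) by (simp add: positive_op_def)
    ultimately have "- m e * (norm y)\<^sup>2 \<ge> 0" by (simp only: nonneg_Reals_of_real_iff)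
    then have "y = 0" using m[of e] by (simp add: mult_le_0_iff)
    then show ?thesis by (simp add: y_def)
  qed
  have Ps: "(P ^^ k) e = complex_of_real (m e ^ k) *\<^sub>C e" if "e \<in> B" for e k
    by (induction k) (auto simp: Pe[OF that] bounded_clinear_scaleC[OF bP] scaleC_scaleC mult.commute)
  have "((\<lambda>e. cinner e ((P ^^ s) e)) has_sum c) B" using tr B(1) by (simp add: has_trace_def)
  moreover have "cinner e ((P ^^ s) e) = complex_of_real (m e ^ s)" if "e \<in> B" for e
    using o that unfolding Ps[OF that] by (simp add: cinner_scaleC_right orthonormal_def)
  ultimately have "((\<lambda>e. complex_of_real (m e ^ s)) has_sum c) B" by (simp cong: has_sum_cong)
  from has_sum_bounded_linear[OF bounded_linear_Re this]
  have hs: "((\<lambda>e. m e ^ s) has_sum Re c) B" by simp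
  have "(\<Sum>e\<in>F. m e ^ s) \<le> Re c" if "finite F" "F \<subseteq> B" for F
    using that m by (intro has_sum_mono2[OF has_sum_finite hs]) (auto intro: less_imp_le)
  moreover have "D e = Some (complex_of_real (d e) *\<^sub>C e)" if "e \<in> B" for e
    using d[OF that] by (metis domD option.sel)
  ultimately show ?thesis using B(1) unfolding m_def by blast
qed

section \<open>The unitary group of a diagonal operator\<close>

definition diag_group :: "'h::chilbert_space set \<Rightarrow> ('h \<Rightarrow> real) \<Rightarrow> real \<Rightarrow> 'h \<Rightarrow> 'h"
  where "diag_group B d t x = (\<Sum>\<^sub>\<infinity>e\<in>B. (iexp (t * d e) * cinner e x) *\<^sub>C e)"

lemma norm_iexp [simp]: "cmod (iexp x) = 1"
  by (simp add: norm_exp_eq_Re)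

context
  fixes D :: "'h::chilbert_space \<rightharpoonup> 'h" and B d
  assumes sa: "self_adjoint D" and B: "orthonormal_basis B"
    and D: "\<forall>e\<in>B. D e = Some (complex_of_real (d e) *\<^sub>C e)"
begin

lemma orthonormal_B: "orthonormal B" using B by (rule orthonormal_basis_orthonormal)

lemma diag_group_has_sum: "((\<lambda>e. (iexp (t * d e) * cinner e x) *\<^sub>C e) has_sum diag_group B d t x) B"
proof -
  have "(\<lambda>e. (iexp (t * d e) * cinner e x) *\<^sub>C e) summable_on B"
    by (rule orthonormal_summable[OF orthonormal_B, of _ "(norm x)\<^sup>2"])
       (simp add: norm_mult bessel[OF orthonormal_B])
  then show ?thesis unfolding diag_group_def by (rule has_sum_infsum)
qed

lemma diag_group_coeff: "e \<in> B \<Longrightarrow> cinner e (diag_group B d t x) = iexp (t * d e) * cinner e x"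
  by (rule orthonormal_cinner_has_sum[OF orthonormal_B diag_group_has_sum])

lemma diag_group_norm: "norm (diag_group B d t x) = norm x"
proof -
  have "((\<lambda>e. (cmod (cinner e x))\<^sup>2) has_sum (norm (diag_group B d t x))\<^sup>2) B"
    using onb_norm_has_sum[OF B, of "diag_group B d t x"]
    by (simp add: diag_group_coeff norm_mult cong: has_sum_cong)
  then have "(norm (diag_group B d t x))\<^sup>2 = (norm x)\<^sup>2" using onb_norm_has_sum[OF B, of x] has_sum_unique by blast
  then show ?thesis by (simp add: power2_eq_iff_nonneg)
qed

lemma diag_group_add: "diag_group B d t (x + y) = diag_group B d t x + diag_group B d t y"
  and diag_group_scaleC: "diag_group B d t (c *\<^sub>C x) = c *\<^sub>C diag_group B d t x"
  by (rule onb_ext[OF B]; simp add: diag_group_coeff cinner_add_right cinner_scaleC_right algebra_simps)+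

lemma diag_group_bounded_clinear: "bounded_clinear (diag_group B d t)"
  unfolding bounded_clinear_def
proof (intro conjI allI)
  show "bounded_linear (diag_group B d t)"
    by (rule bounded_linear_intro[where K = 1])
       (simp_all add: diag_group_add scaleR_scaleC diag_group_scaleC diag_group_norm)
qed (rule diag_group_scaleC)

lemma diag_group_comp: "diag_group B d (t + t') = diag_group B d t \<circ> diag_group B d t'"
  by (rule ext, rule onb_ext[OF B])
     (simp add: diag_group_coeff distrib_right distrib_left exp_add mult_ac)

lemma diag_group_zero: "diag_group B d 0 = id"
  by (rule ext, rule onb_ext[OF B]) (simp add: diag_group_coeff)

lemma diag_group_unitary: "unitary (diag_group B d t)"
  unfolding unitary_def
proof (intro conjI allI diag_group_bounded_clinear)
  have "diag_group B d t (diag_group B d (- t) x) = x" for x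
    using diag_group_comp[of t "- t"] diag_group_zero by (metis add.right_inverse comp_apply id_apply)
  then show "surj (diag_group B d t)" by (metis surjI)
  fix x y
  have "cinner (diag_group B d t x) e * cinner e (diag_group B d t y) = cinner x e * cinner e y" if "e \<in> B" for e
  proof -
    have "cinner (diag_group B d t x) e * cinner e (diag_group B d t y) = (cnj (iexp (t * d e)) * iexp (t * d e)) * (cinner x e * cinner e y)"
      using diag_group_coeff[OF that, of t x] diag_group_coeff[OF that, of t y] cinner_commute[of "diag_group B d t x" e]
        cinner_commute[of x e] by (simp add: mult_ac)
    then show ?thesis by (simp only: cnj_mult_self norm_iexp) simp
  qed
  then have "((\<lambda>e. cinner x e * cinner e y) has_sum cinner (diag_group B d t x) (diag_group B d t y)) B"
    using onb_parseval[OF B, of "diag_group B d t x" "diag_group B d t y"] by (simp cong: has_sum_cong)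
  then show "cinner (diag_group B d t x) (diag_group B d t y) = cinner x y" using onb_parseval[OF B, of x y] has_sum_unique by blast
qed

lemma diag_group_eigenvector: "e \<in> B \<Longrightarrow> diag_group B d t e = iexp (t * d e) *\<^sub>C e"
proof (rule onb_ext[OF B])
  fix f assume "e \<in> B" "f \<in> B"
  then show "cinner f (diag_group B d t e) = cinner f (iexp (t * d e) *\<^sub>C e)"
    using orthonormal_B by (auto simp: diag_group_coeff cinner_scaleC_right orthonormal_def)
qed

lemma diag_group_continuous: "continuous_on UNIV (\<lambda>t. diag_group B d t x)"
proof (rule uniform_limit_theorem)
  let ?p = "\<lambda>F. \<Sum>e\<in>F. cinner e x *\<^sub>C e"
  show "\<forall>\<^sub>F F in finite_subsets_at_top B. continuous_on UNIV (\<lambda>t. diag_group B d t (?p F))"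
  proof (rule eventually_finite_subsets_at_top_weakI)
    fix F assume F: "finite F" "F \<subseteq> B"
    have "diag_group B d t (?p F) = (\<Sum>e\<in>F. cinner e x *\<^sub>C iexp (t * d e) *\<^sub>C e)" for t
      using F by (subst bounded_clinear_sum[OF diag_group_bounded_clinear])
        (auto simp: diag_group_scaleC diag_group_eigenvector intro!: sum.cong)
    moreover have "continuous_on UNIV (\<lambda>t. \<Sum>e\<in>F. cinner e x *\<^sub>C iexp (t * d e) *\<^sub>C e)"
      by (intro continuous_intros bounded_bilinear.continuous_on[OF bounded_bilinear_scaleC])
    ultimately show "continuous_on UNIV (\<lambda>t. diag_group B d t (?p F))" by simp
  qed
  show "uniform_limit UNIV (\<lambda>F t. diag_group B d t (?p F)) (\<lambda>t. diag_group B d t x) (finite_subsets_at_top B)"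
    unfolding uniform_limit_iff
  proof (intro allI impI)
    fix r :: real assume "r > 0"
    have "(?p \<longlongrightarrow> x) (finite_subsets_at_top B)" using onb_expansion[OF B, of x] unfolding has_sum_def .
    then have "\<forall>\<^sub>F F in finite_subsets_at_top B. dist (?p F) x < r" using \<open>r > 0\<close> by (rule tendstoD)
    then show "\<forall>\<^sub>F F in finite_subsets_at_top B. \<forall>t\<in>UNIV. dist (diag_group B d t (?p F)) (diag_group B d t x) < r"
      by eventually_elim
        (simp add: dist_norm diag_group_norm flip: bounded_clinear_diff[OF diag_group_bounded_clinear])
  qed
qed simp

text \<open>
  The domain of a self-adjoint operator is as large as its eigenbasis allows.
\<close>

lemma diag_operator_iff:
  "D x = Some y \<longleftrightarrow> (\<forall>e\<in>B. cinner e y = complex_of_real (d e) * cinner e x)"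
proof
  have dB: "e \<in> dom D" "the (D e) = complex_of_real (d e) *\<^sub>C e" if "e \<in> B" for e using D that by auto
  {
    assume "D x = Some y"
    then have "cinner e y = cinner (the (D e)) x" if "e \<in> B" for e
      using sa_symmetric[OF sa dB(1)[OF that], of x] by (simp add: domI)
    then show "\<forall>e\<in>B. cinner e y = complex_of_real (d e) * cinner e x"
      by (simp add: dB cinner_scaleC_left)
  }
  assume y: "\<forall>e\<in>B. cinner e y = complex_of_real (d e) * cinner e x"
  have "cinner (the (D a)) x = cinner a y" if a: "a \<in> dom D" for a
  proof -
    have "cinner (the (D a)) e * cinner e x = cinner a e * cinner e y" if "e \<in> B" for e
      using sa_symmetric[OF sa a dB(1)[OF that]] y that by (simp add: dB cinner_scaleC_right)
    then have "((\<lambda>e. cinner a e * cinner e y) has_sum cinner (the (D a)) x) B"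
      using onb_parseval[OF B, of "the (D a)" x] by (simp cong: has_sum_cong)
    then show ?thesis using onb_parseval[OF B, of a y] has_sum_unique by blast
  qed
  from sa_maximal[OF sa this] show "D x = Some y" by (metis domD option.sel)
qed

lemma iexp_taylor1: "cmod (iexp x - 1 - \<i> * of_real x) \<le> x\<^sup>2"
  and iexp_taylor1': "cmod (iexp x - 1 - \<i> * of_real x) \<le> 2 * \<bar>x\<bar>"
proof -
  have "cmod (iexp x - 1 - \<i> * of_real x) * 2 \<le> x\<^sup>2"
    using iexp_approx1[of x 1] by (simp add: diff_diff_eq power2_eq_square)
  then show "cmod (iexp x - 1 - \<i> * of_real x) \<le> x\<^sup>2" using zero_le_power2[of x] by linarith
  show "cmod (iexp x - 1 - \<i> * of_real x) \<le> 2 * \<bar>x\<bar>"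
    using iexp_approx2[of x 1] by (simp add: diff_diff_eq)
qed

text \<open>
  The coefficients of the Taylor remainder \<open>z h = U\<^sub>h x - x - i h y\<close> are at most \<open>h\<^sup>2 d\<^sub>e\<^sup>2 \<bar>x\<^sub>e\<bar>\<close>, and also at most
  \<open>2 \<bar>h\<bar> \<bar>y\<^sub>e\<bar>\<close>. The first bound serves on a finite set of basis vectors, the second outside, where the \<open>y\<^sub>e\<close> are small.
\<close>

lemma diag_group_derivative:
  assumes y: "D x = Some y"
  shows "((\<lambda>t. diag_group B d t x) has_vector_derivative \<i> *\<^sub>C y) (at 0)"
  unfolding has_vector_derivative_def has_derivative_at
proof (intro conjI bounded_linear_scaleR_left)
  have yc: "cinner e y = complex_of_real (d e) * cinner e x" if "e \<in> B" for e
    using y that unfolding diag_operator_iff by blast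
  define z where "z h = diag_group B d h x - x - h *\<^sub>R (\<i> *\<^sub>C y)" for h
  have zc: "cinner e (z h) = (iexp (h * d e) - 1 - \<i> * of_real (h * d e)) * cinner e x" if "e \<in> B" for e h
    unfolding z_def scaleR_scaleC cinner_diff_right cinner_scaleC_right diag_group_coeff[OF that] yc[OF that]
    by (simp add: algebra_simps)
  let ?g = "\<lambda>e. (cmod (cinner e y))\<^sup>2"
  have "\<exists>\<delta>>0. \<forall>h. h \<noteq> 0 \<and> \<bar>h\<bar> < \<delta> \<longrightarrow> norm (z h) / \<bar>h\<bar> < r" if r: "r > 0" for r
  proof -
    define \<epsilon> where "\<epsilon> = r / 4"
    have e: "\<epsilon> > 0" using r by (simp add: \<epsilon>_def)
    note L = onb_norm_has_sum[OF B, of y]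
    from has_sum_finite_approximation[OF L, of "\<epsilon>\<^sup>2"] e
    obtain F where F: "finite F" "F \<subseteq> B" "dist (sum ?g F) ((norm y)\<^sup>2) \<le> \<epsilon>\<^sup>2" by auto
    have small: "sum ?g G \<le> \<epsilon>\<^sup>2" if G: "finite G" "G \<subseteq> B - F" for G
    proof -
      have "sum ?g (F \<union> G) \<le> (norm y)\<^sup>2"
        using F G by (intro has_sum_mono2[OF has_sum_finite L]) auto
      moreover have "sum ?g (F \<union> G) = sum ?g F + sum ?g G"
        using F G by (intro sum.union_disjoint) auto
      ultimately show ?thesis using F(3) by (simp add: dist_real_def)
    qed
    define C where "C = (\<Sum>e\<in>F. (d e)^4 * (cmod (cinner e x))\<^sup>2)"
    have C: "C \<ge> 0" unfolding C_def by (intro sum_nonneg) auto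
    have bd: "(norm (z h))\<^sup>2 \<le> h^4 * C + 4 * h\<^sup>2 * \<epsilon>\<^sup>2" for h
    proof (rule has_sum_le_finite_sums[OF onb_norm_has_sum[OF B]])
      fix G assume G: "finite G" "G \<subseteq> B"
      let ?k = "\<lambda>e. (cmod (cinner e (z h)))\<^sup>2"
      have "sum ?k G \<le> sum ?k (F \<union> (G - F))"
        using F G by (intro sum_mono2) auto
      also have "\<dots> = sum ?k F + sum ?k (G - F)" using F G by (intro sum.union_disjoint) auto
      also have "sum ?k F \<le> (\<Sum>e\<in>F. h^4 * ((d e)^4 * (cmod (cinner e x))\<^sup>2))"
      proof (rule sum_mono)
        fix e assume "e \<in> F"
        then have eB: "e \<in> B" using F by auto
        have "?k e = (cmod (iexp (h * d e) - 1 - \<i> * of_real (h * d e)))\<^sup>2 * (cmod (cinner e x))\<^sup>2"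
          unfolding zc[OF eB] norm_mult power_mult_distrib ..
        also have "\<dots> \<le> ((h * d e)\<^sup>2)\<^sup>2 * (cmod (cinner e x))\<^sup>2"
          by (intro mult_right_mono power_mono iexp_taylor1) auto
        finally show "?k e \<le> h^4 * ((d e)^4 * (cmod (cinner e x))\<^sup>2)" 
          by (simp add: power_mult_distrib flip: power_mult)
      qed
      also have "\<dots> = h^4 * C" unfolding C_def by (rule sum_distrib_left[symmetric])
      also have "sum ?k (G - F) \<le> (\<Sum>e\<in>G - F. 4 * h\<^sup>2 * ?g e)"
      proof (rule sum_mono)
        fix e assume "e \<in> G - F"
        then have eB: "e \<in> B" using G by auto
        have "?k e = (cmod (iexp (h * d e) - 1 - \<i> * of_real (h * d e)))\<^sup>2 * (cmod (cinner e x))\<^sup>2"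
          unfolding zc[OF eB] norm_mult power_mult_distrib ..
        also have "\<dots> \<le> (2 * \<bar>h * d e\<bar>)\<^sup>2 * (cmod (cinner e x))\<^sup>2"
          by (intro mult_right_mono power_mono iexp_taylor1') auto
        finally show "?k e \<le> 4 * h\<^sup>2 * ?g e"
          by (simp add: power_mult_distrib yc[OF eB] norm_mult)
      qed
      also have "\<dots> = 4 * h\<^sup>2 * sum ?g (G - F)" by (rule sum_distrib_left[symmetric])
      also have "\<dots> \<le> 4 * h\<^sup>2 * \<epsilon>\<^sup>2" using G by (intro mult_left_mono small) auto
      finally show "sum ?k G \<le> h^4 * C + 4 * h\<^sup>2 * \<epsilon>\<^sup>2" by simp
    qed
    define \<delta> where "\<delta> = \<epsilon> / sqrt (C + 1)"
    have "norm (z h) / \<bar>h\<bar> < r" if h: "h \<noteq> 0" "\<bar>h\<bar> < \<delta>" for h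
    proof -
      have "h\<^sup>2 \<le> \<delta>\<^sup>2" using h by (metis abs_ge_zero less_imp_le power2_abs power_mono)
      also have "\<dots> = \<epsilon>\<^sup>2 / (C + 1)" using C by (simp add: \<delta>_def power_divide)
      finally have "h\<^sup>2 * (C + 1) \<le> \<epsilon>\<^sup>2" using C by (simp add: field_simps)
      then have hC: "h\<^sup>2 * C \<le> \<epsilon>\<^sup>2" using zero_le_power2[of h] unfolding distrib_left by linarith
      have "(norm (z h))\<^sup>2 \<le> h\<^sup>2 * (h\<^sup>2 * C + 4 * \<epsilon>\<^sup>2)" using bd[of h] by (simp add: algebra_simps power2_eq_square power4_eq_xxxx)
      also have "\<dots> \<le> h\<^sup>2 * (9 * \<epsilon>\<^sup>2)" using hC zero_le_power2[of \<epsilon>] by (intro mult_left_mono) (linarith, simp)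
      also have "\<dots> = (3 * \<epsilon> * \<bar>h\<bar>)\<^sup>2" by (simp add: power_mult_distrib)
      finally have "norm (z h) \<le> 3 * \<epsilon> * \<bar>h\<bar>" by (rule power2_le_imp_le) (use e in simp)
      also have "\<dots> < r * \<bar>h\<bar>" using r h by (intro mult_strict_right_mono) (auto simp: \<epsilon>_def)
      finally show ?thesis using h by (simp add: field_simps)
    qed
    moreover have "\<delta> > 0" using e C by (simp add: \<delta>_def)
    ultimately show ?thesis by blast
  qed
  then show "(\<lambda>h. norm (diag_group B d (0 + h) x - diag_group B d 0 x - h *\<^sub>R \<i> *\<^sub>C y) / norm h) \<midarrow>0\<rightarrow> 0"
    unfolding LIM_eq by (simp add: diag_group_zero z_def)
qed

lemma diag_group_unitary_group: "unitary_group_of D (diag_group B d)"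
  unfolding unitary_group_of_def
proof (intro conjI allI diag_group_unitary diag_group_zero diag_group_comp diag_group_continuous iffI diag_group_derivative)
  fix x y assume der: "((\<lambda>t. diag_group B d t x) has_vector_derivative \<i> *\<^sub>C y) (at 0)"
  have "cinner e y = complex_of_real (d e) * cinner e x" if e: "e \<in> B" for e
  proof -
    have "((\<lambda>t. cinner e (diag_group B d t x)) has_vector_derivative cinner e (\<i> *\<^sub>C y)) (at 0)"
      by (rule bounded_linear.has_vector_derivative[OF bounded_linear_cinner_right der])
    then have "((\<lambda>t. iexp (t * d e) * cinner e x) has_vector_derivative \<i> * cinner e y) (at 0)"
      by (simp add: diag_group_coeff[OF e] cinner_scaleC_right)
    moreover have "((\<lambda>t. iexp (t * d e) * cinner e x) has_vector_derivative (\<i> * of_real (d e)) * iexp (0 * d e) * cinner e x) (at 0)"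
    proof -
      have "((\<lambda>t. exp (t *\<^sub>R (\<i> * of_real (d e)))) has_vector_derivative exp (0 *\<^sub>R (\<i> * of_real (d e))) * (\<i> * of_real (d e))) (at 0)"
        by (rule exp_scaleR_has_vector_derivative_right)
      then have "((\<lambda>t. exp (t *\<^sub>R (\<i> * of_real (d e))) * cinner e x) has_vector_derivative
          exp (0 *\<^sub>R (\<i> * of_real (d e))) * (\<i> * of_real (d e)) * cinner e x) (at 0)"
        by (rule has_vector_derivative_mult_left)
      then show ?thesis by (simp add: scaleR_conv_of_real mult_ac)
    qed
    ultimately have "\<i> * cinner e y = \<i> * of_real (d e) * cinner e x"
      using vector_derivative_unique_at by fastforce
    then show ?thesis by simp
  qed
  then show "D x = Some y" unfolding diag_operator_iff by blast
qed

text \<open>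
  On an eigenvector \<open>e\<close> the curve \<open>t \<mapsto> exp(-i t d\<^sub>e) V\<^sub>t e\<close> has derivative \<open>0\<close>, so it is constant.
\<close>

lemma unitary_group_unique:
  assumes V: "unitary_group_of D V"
  shows "V = diag_group B d"
proof (intro ext)
  fix t x
  have bV: "bounded_clinear (V t)" for t using V by (simp add: unitary_group_of_def unitary_def)
  have VB: "V t e = iexp (t * d e) *\<^sub>C e" if e: "e \<in> B" for e t
  proof -
    define w where "w = (\<lambda>t. exp (t *\<^sub>R (- \<i> * of_real (d e))) *\<^sub>C V t e)"
    have der0: "((\<lambda>t. V t e) has_vector_derivative \<i> *\<^sub>C complex_of_real (d e) *\<^sub>C e) (at 0)"
      using V D e by (simp add: unitary_group_of_def)
    have derV: "((\<lambda>t. V t e) has_vector_derivative (\<i> * complex_of_real (d e)) *\<^sub>C V t e) (at t)" for t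
    proof -
      have "((\<lambda>s. s - t) has_vector_derivative 1) (at t)"
        by (auto intro!: derivative_eq_intros)
      then have "(((\<lambda>t. V t e) \<circ> (\<lambda>s. s - t)) has_vector_derivative 1 *\<^sub>R (\<i> *\<^sub>C complex_of_real (d e) *\<^sub>C e)) (at t)"
        by (rule vector_diff_chain_at) (simp add: der0)
      then have "((\<lambda>s. V t (V (s - t) e)) has_vector_derivative V t (\<i> *\<^sub>C complex_of_real (d e) *\<^sub>C e)) (at t)"
        by (intro bounded_linear.has_vector_derivative[OF bounded_clinear_linear[OF bV]]) (simp add: o_def)
      moreover have "V t (V (s - t) e) = V s e" for s
        using V unfolding unitary_group_of_def by (metis add.commute comp_apply diff_add_cancel)
      ultimately show ?thesis by (simp add: bounded_clinear_scaleC[OF bV] scaleC_scaleC)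
    qed
    have "(w has_vector_derivative 0) (at t)" for t
    proof -
      have "(w has_vector_derivative
          exp (t *\<^sub>R (- \<i> * of_real (d e))) *\<^sub>C ((\<i> * complex_of_real (d e)) *\<^sub>C V t e) +
          (exp (t *\<^sub>R (- \<i> * of_real (d e))) * (- \<i> * of_real (d e))) *\<^sub>C V t e) (at t)"
        unfolding w_def
        by (rule bounded_bilinear.has_vector_derivative[OF bounded_bilinear_scaleC
              exp_scaleR_has_vector_derivative_right derV])
      then show ?thesis by (simp add: scaleC_scaleC scaleC_minus_left)
    qed
    then obtain k where k: "\<And>t. w t = k"
      using has_vector_derivative_zero_constant[of UNIV w] by auto
    have "w t = w 0" using k by simp
    also have "\<dots> = e" using V by (simp add: w_def unitary_group_of_def)
    finally have "exp (t *\<^sub>R (\<i> * of_real (d e))) *\<^sub>C w t = exp (t *\<^sub>R (\<i> * of_real (d e))) *\<^sub>C e" by simp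
    then show ?thesis by (simp add: w_def scaleC_scaleC scaleR_conv_of_real mult_ac flip: exp_add)
  qed
  have "((\<lambda>e. V t (cinner e x *\<^sub>C e)) has_sum V t x) B"
    by (rule has_sum_bounded_linear[OF bounded_clinear_linear[OF bV] onb_expansion[OF B]])
  then have "((\<lambda>e. (iexp (t * d e) * cinner e x) *\<^sub>C e) has_sum V t x) B"
    by (simp add: bounded_clinear_scaleC[OF bV] VB scaleC_scaleC mult.commute cong: has_sum_cong)
  then show "V t x = diag_group B d t x" using diag_group_has_sum has_sum_unique by blast
qed

lemma exp_i_eq_diag_group: "exp_i D = diag_group B d"
  unfolding exp_i_def using diag_group_unitary_group unitary_group_unique by (rule the_equality)

end

section \<open>A trace inequality for words in a diagonal matrix and contractions\<close>

context
  fixes G :: "'i set"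
begin

definition mat_mult :: "('i \<Rightarrow> 'i \<Rightarrow> complex) \<Rightarrow> ('i \<Rightarrow> 'i \<Rightarrow> complex) \<Rightarrow> 'i \<Rightarrow> 'i \<Rightarrow> complex"
  where "mat_mult A B i k = (\<Sum>j\<in>G. A i j * B j k)"

definition mtrace :: "('i \<Rightarrow> 'i \<Rightarrow> complex) \<Rightarrow> complex"
  where "mtrace A = (\<Sum>i\<in>G. A i i)"

definition contraction :: "('i \<Rightarrow> 'i \<Rightarrow> complex) \<Rightarrow> bool"
  where "contraction V \<longleftrightarrow> (\<forall>x. (\<Sum>i\<in>G. (cmod (\<Sum>j\<in>G. V i j * x j))\<^sup>2) \<le> (\<Sum>j\<in>G. (cmod (x j))\<^sup>2))"

definition hs_norm_sq :: "('i \<Rightarrow> 'i \<Rightarrow> complex) \<Rightarrow> real"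
  where "hs_norm_sq X = (\<Sum>i\<in>G. \<Sum>j\<in>G. (cmod (X i j))\<^sup>2)"

definition conj_transpose :: "('i \<Rightarrow> 'i \<Rightarrow> complex) \<Rightarrow> 'i \<Rightarrow> 'i \<Rightarrow> complex"
  where "conj_transpose V i j = cnj (V j i)"

definition scale_rows :: "('i \<Rightarrow> real) \<Rightarrow> ('i \<Rightarrow> 'i \<Rightarrow> complex) \<Rightarrow> 'i \<Rightarrow> 'i \<Rightarrow> complex"
  where "scale_rows l X i j = complex_of_real (l i) * X i j"

definition scale_cols :: "('i \<Rightarrow> 'i \<Rightarrow> complex) \<Rightarrow> ('i \<Rightarrow> real) \<Rightarrow> 'i \<Rightarrow> 'i \<Rightarrow> complex"
  where "scale_cols X l i j = X i j * complex_of_real (l j)"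

definition identity_mat :: "'i \<Rightarrow> 'i \<Rightarrow> complex"
  where "identity_mat i j = (if i = j then 1 else 0)"

lemma mat_mult_assoc: "mat_mult (mat_mult A B) C = mat_mult A (mat_mult B C)"
proof (intro ext)
  fix i k
  have "mat_mult (mat_mult A B) C i k = (\<Sum>j\<in>G. \<Sum>l\<in>G. A i l * B l j * C j k)"
    by (simp add: mat_mult_def sum_distrib_right)
  also have "\<dots> = (\<Sum>l\<in>G. \<Sum>j\<in>G. A i l * B l j * C j k)" by (rule sum.swap)
  also have "\<dots> = mat_mult A (mat_mult B C) i k" by (simp add: mat_mult_def sum_distrib_left mult.assoc)
  finally show "mat_mult (mat_mult A B) C i k = mat_mult A (mat_mult B C) i k" .
qed

lemma mat_mult_scale_rows: "mat_mult (scale_rows l X) Y = scale_rows l (mat_mult X Y)"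
  by (intro ext) (simp add: mat_mult_def scale_rows_def sum_distrib_left mult.assoc)

lemma mat_mult_scale_cols: "mat_mult X (scale_cols Y l) = scale_cols (mat_mult X Y) l"
  by (intro ext) (simp add: mat_mult_def scale_cols_def sum_distrib_right mult.assoc)

lemma scale_rows_scale_cols: "scale_rows l (scale_cols X m) = scale_cols (scale_rows l X) m"
  by (intro ext) (simp add: scale_rows_def scale_cols_def mult.assoc)

lemma scale_cols_mat_mult: "mat_mult (scale_cols X l) Y = mat_mult X (scale_rows l Y)"
  by (intro ext) (simp add: mat_mult_def scale_cols_def scale_rows_def mult.assoc)

lemma conj_transpose_mat_mult: "conj_transpose (mat_mult A B) = mat_mult (conj_transpose B) (conj_transpose A)"
  by (intro ext) (simp add: mat_mult_def conj_transpose_def mult.commute)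

lemma conj_transpose_scale_rows: "conj_transpose (scale_rows l A) = scale_cols (conj_transpose A) l"
  by (intro ext) (simp add: scale_rows_def scale_cols_def conj_transpose_def mult.commute)

lemma contractionD: "contraction V \<Longrightarrow> (\<Sum>i\<in>G. (cmod (\<Sum>j\<in>G. V i j * x j))\<^sup>2) \<le> (\<Sum>j\<in>G. (cmod (x j))\<^sup>2)"
  by (simp add: contraction_def)

lemma contraction_mat_mult: "contraction A \<Longrightarrow> contraction B \<Longrightarrow> contraction (mat_mult A B)"
  unfolding contraction_def
proof
  fix x assume A: "\<forall>x. (\<Sum>i\<in>G. (cmod (\<Sum>j\<in>G. A i j * x j))\<^sup>2) \<le> (\<Sum>j\<in>G. (cmod (x j))\<^sup>2)"
    and B: "\<forall>x. (\<Sum>i\<in>G. (cmod (\<Sum>j\<in>G. B i j * x j))\<^sup>2) \<le> (\<Sum>j\<in>G. (cmod (x j))\<^sup>2)"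
  have "(\<Sum>j\<in>G. mat_mult A B i j * x j) = (\<Sum>l\<in>G. A i l * (\<Sum>j\<in>G. B l j * x j))" for i
  proof -
    have "(\<Sum>j\<in>G. mat_mult A B i j * x j) = (\<Sum>j\<in>G. \<Sum>l\<in>G. A i l * B l j * x j)"
      by (simp add: mat_mult_def sum_distrib_right)
    also have "\<dots> = (\<Sum>l\<in>G. \<Sum>j\<in>G. A i l * B l j * x j)" by (rule sum.swap)
    finally show ?thesis by (simp add: sum_distrib_left mult.assoc)
  qed
  then show "(\<Sum>i\<in>G. (cmod (\<Sum>j\<in>G. mat_mult A B i j * x j))\<^sup>2) \<le> (\<Sum>j\<in>G. (cmod (x j))\<^sup>2)"
    using A[rule_format, of "\<lambda>l. \<Sum>j\<in>G. B l j * x j"] B[rule_format, of x] by simp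
qed

lemma cauchy_schwarz_sum:
  "(cmod (\<Sum>i\<in>I. a i * b i))\<^sup>2 \<le> (\<Sum>i\<in>I. (cmod (a i))\<^sup>2) * (\<Sum>i\<in>I. (cmod (b i))\<^sup>2)"
proof -
  have "cmod (\<Sum>i\<in>I. a i * b i) \<le> (\<Sum>i\<in>I. cmod (a i) * cmod (b i))"
    using norm_sum[of "\<lambda>i. a i * b i" I] by (simp add: norm_mult)
  then have "(cmod (\<Sum>i\<in>I. a i * b i))\<^sup>2 \<le> (\<Sum>i\<in>I. cmod (a i) * cmod (b i))\<^sup>2"
    by (simp add: power_mono)
  also have "\<dots> \<le> (\<Sum>i\<in>I. (cmod (a i))\<^sup>2) * (\<Sum>i\<in>I. (cmod (b i))\<^sup>2)" by (rule Cauchy_Schwarz_ineq_sum)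
  finally show ?thesis .
qed

lemma contraction_conj_transpose:
  assumes V: "contraction V"
  shows "contraction (conj_transpose V)"
  unfolding contraction_def
proof
  fix x
  define y where "y = (\<lambda>i. \<Sum>j\<in>G. conj_transpose V i j * x j)"
  define Y where "Y = (\<Sum>i\<in>G. (cmod (y i))\<^sup>2)"
  define X where "X = (\<Sum>i\<in>G. (cmod (x i))\<^sup>2)"
  define z where "z = (\<lambda>j. \<Sum>i\<in>G. V j i * y i)"
  have "complex_of_real Y = (\<Sum>i\<in>G. cnj (y i) * y i)"
    unfolding Y_def of_real_sum complex_norm_square by (simp only: mult.commute)
  also have "\<dots> = (\<Sum>i\<in>G. \<Sum>j\<in>G. cnj (y i) * conj_transpose V i j * x j)"
    by (subst (2) y_def) (simp add: sum_distrib_left mult.assoc)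
  also have "\<dots> = (\<Sum>j\<in>G. \<Sum>i\<in>G. cnj (y i) * conj_transpose V i j * x j)" by (rule sum.swap)
  also have "\<dots> = (\<Sum>j\<in>G. cnj (z j) * x j)"
    by (simp add: z_def sum_distrib_left conj_transpose_def mult_ac)
  finally have eq: "complex_of_real Y = (\<Sum>j\<in>G. cnj (z j) * x j)" .
  have "Y\<^sup>2 = (cmod (\<Sum>j\<in>G. cnj (z j) * x j))\<^sup>2"
    unfolding eq[symmetric] by simp
  also have "\<dots> \<le> (\<Sum>j\<in>G. (cmod (cnj (z j)))\<^sup>2) * X" unfolding X_def by (rule cauchy_schwarz_sum)
  also have "\<dots> \<le> Y * X"
    using contractionD[OF V, of y] unfolding complex_mod_cnj z_def Y_def X_def
    by (intro mult_right_mono) (auto intro: sum_nonneg)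
  finally have "Y * Y \<le> X * Y" by (simp add: power2_eq_square mult.commute)
  moreover have "Y \<ge> 0" "X \<ge> 0" by (auto simp: X_def Y_def intro: sum_nonneg)
  ultimately have "Y \<le> X" by (cases "Y = 0") auto
  then show "(\<Sum>i\<in>G. (cmod (\<Sum>j\<in>G. conj_transpose V i j * x j))\<^sup>2) \<le> (\<Sum>j\<in>G. (cmod (x j))\<^sup>2)"
    unfolding X_def Y_def y_def .
qed

lemma hs_norm_sq_cong: "(\<And>i j. i \<in> G \<Longrightarrow> j \<in> G \<Longrightarrow> X i j = Y i j) \<Longrightarrow> hs_norm_sq X = hs_norm_sq Y"
  unfolding hs_norm_sq_def by (intro sum.cong) auto

lemma hs_norm_sq_nonneg: "hs_norm_sq X \<ge> 0"
  unfolding hs_norm_sq_def by (intro sum_nonneg) auto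

lemma hs_norm_sq_contraction_le: "contraction C \<Longrightarrow> hs_norm_sq (mat_mult C X) \<le> hs_norm_sq X"
proof -
  assume C: "contraction C"
  have "hs_norm_sq (mat_mult C X) = (\<Sum>j\<in>G. \<Sum>i\<in>G. (cmod (\<Sum>l\<in>G. C i l * X l j))\<^sup>2)"
    unfolding hs_norm_sq_def mat_mult_def by (rule sum.swap)
  also have "\<dots> \<le> (\<Sum>j\<in>G. \<Sum>l\<in>G. (cmod (X l j))\<^sup>2)" by (intro sum_mono contractionD[OF C])
  also have "\<dots> = hs_norm_sq X" unfolding hs_norm_sq_def by (rule sum.swap)
  finally show ?thesis .
qed

lemma hs_norm_sq_conj_transpose: "hs_norm_sq (conj_transpose X) = hs_norm_sq X"
  unfolding hs_norm_sq_def conj_transpose_def by (subst sum.swap) simp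

lemma trace_cauchy_schwarz: "(cmod (mtrace (mat_mult Y Z)))\<^sup>2 \<le> hs_norm_sq Y * hs_norm_sq Z"
proof -
  have "mtrace (mat_mult Y Z) = (\<Sum>(i,k)\<in>G \<times> G. Y i k * Z k i)"
    unfolding mtrace_def mat_mult_def by (rule sum.cartesian_product)
  then have "(cmod (mtrace (mat_mult Y Z)))\<^sup>2 \<le> (\<Sum>p\<in>G \<times> G. (cmod (Y (fst p) (snd p)))\<^sup>2) * (\<Sum>p\<in>G \<times> G. (cmod (Z (snd p) (fst p)))\<^sup>2)"
    using cauchy_schwarz_sum[of "\<lambda>p. Y (fst p) (snd p)" "\<lambda>p. Z (snd p) (fst p)" "G \<times> G"]
    by (simp add: case_prod_beta)
  also have "(\<Sum>p\<in>G \<times> G. (cmod (Y (fst p) (snd p)))\<^sup>2) = hs_norm_sq Y"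
    unfolding hs_norm_sq_def by (simp add: sum.cartesian_product case_prod_beta)
  also have "(\<Sum>p\<in>G \<times> G. (cmod (Z (snd p) (fst p)))\<^sup>2) = hs_norm_sq (conj_transpose Z)"
    unfolding hs_norm_sq_def conj_transpose_def by (simp add: sum.cartesian_product case_prod_beta)
  finally show ?thesis by (simp add: hs_norm_sq_conj_transpose)
qed

text \<open>
  A matrix in \<open>word l k\<close> is a product of \<open>k\<close> copies of the diagonal matrix \<open>l\<close> with contractions between and around
  them. The closure under equality on \<open>G\<close> disregards the entries outside of \<open>G \<times> G\<close>.
\<close>

inductive word :: "('i \<Rightarrow> real) \<Rightarrow> nat \<Rightarrow> ('i \<Rightarrow> 'i \<Rightarrow> complex) \<Rightarrow> bool" for l where
  word_contraction: "contraction C \<Longrightarrow> word l 0 C"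
| word_letter: "word l k X \<Longrightarrow> word l (Suc k) (scale_rows l X)"
| word_left: "contraction C \<Longrightarrow> word l k X \<Longrightarrow> word l k (mat_mult C X)"
| word_cong: "word l k X \<Longrightarrow> (\<And>i j. i \<in> G \<Longrightarrow> j \<in> G \<Longrightarrow> X i j = Y i j) \<Longrightarrow> word l k Y"

lemma contraction_cong: "contraction X \<Longrightarrow> (\<And>i j. i \<in> G \<Longrightarrow> j \<in> G \<Longrightarrow> X i j = Y i j) \<Longrightarrow> contraction Y"
  unfolding contraction_def by simp

lemma word_0: "word l 0 X \<Longrightarrow> contraction X"
  by (induction "0::nat" X rule: word.induct) (auto intro: contraction_mat_mult contraction_cong)

lemma word_mult: "word l k X \<Longrightarrow> word l m Y \<Longrightarrow> word l (k + m) (mat_mult X Y)"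
proof (induction rule: word.induct)
  case (word_cong k X X')
  show ?case
    by (rule word.word_cong[OF word_cong.IH[OF word_cong.prems]]) (simp add: mat_mult_def word_cong.hyps)
qed (auto simp: mat_mult_scale_rows mat_mult_assoc intro: word.intros)

context
  assumes fin: "finite G"
begin

lemma mat_mult_identity_mat_right: "k \<in> G \<Longrightarrow> mat_mult A identity_mat i k = A i k"
  using fin by (simp add: mat_mult_def identity_mat_def if_distrib sum.delta cong: if_cong)

lemma mat_mult_identity_mat_left: "i \<in> G \<Longrightarrow> mat_mult identity_mat A i k = A i k"
  using fin by (simp add: mat_mult_def identity_mat_def if_distrib sum.delta' if_distribR cong: if_cong)

lemma diag_sum: "i \<in> G \<Longrightarrow> (\<Sum>j\<in>G. (if i = j then p else 0) * x j) = p * (x i :: complex)"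
proof -
  assume i: "i \<in> G"
  have "(\<Sum>j\<in>G. (if i = j then p else 0) * x j) = (\<Sum>j\<in>G. if i = j then p * x j else 0)"
    by (intro sum.cong) auto
  then show ?thesis using fin i by (simp add: sum.delta')
qed

lemma contraction_identity_mat: "contraction identity_mat"
  unfolding contraction_def identity_mat_def by (simp add: diag_sum)

lemma contraction_diag:
  assumes p: "\<And>i. i \<in> G \<Longrightarrow> cmod (p i) \<le> 1"
  shows "contraction (\<lambda>i j. if i = j then p i else 0)"
  unfolding contraction_def
proof (intro allI sum_mono)
  fix x i assume i: "i \<in> G"
  have "cmod (p i) * cmod (x i) \<le> 1 * cmod (x i)" by (intro mult_right_mono p i) auto
  then show "(cmod (\<Sum>j\<in>G. (if i = j then p i else 0) * x j))\<^sup>2 \<le> (cmod (x i))\<^sup>2"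
    using i by (simp add: diag_sum norm_mult power_mono)
qed

lemma hs_norm_sq_identity_mat: "hs_norm_sq identity_mat = card G"
proof -
  have "hs_norm_sq identity_mat = (\<Sum>i\<in>G. \<Sum>j\<in>G. if i = j then 1 else 0)"
    unfolding hs_norm_sq_def identity_mat_def by (intro sum.cong) auto
  then show ?thesis using fin by (simp add: sum.delta)
qed

lemma hs_norm_sq_contraction: assumes C: "contraction C" shows "hs_norm_sq C \<le> card G"
proof -
  have "hs_norm_sq C = hs_norm_sq (mat_mult C identity_mat)" by (rule hs_norm_sq_cong) (simp add: mat_mult_identity_mat_right)
  then show ?thesis using hs_norm_sq_contraction_le[OF C, of identity_mat] hs_norm_sq_identity_mat by simp
qed

lemma word_right_letter: "word l k X \<Longrightarrow> word l (Suc k) (scale_cols X l)"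
proof -
  assume X: "word l k X"
  have "word l (Suc 0) (scale_rows l identity_mat)" by (intro word.intros contraction_identity_mat)
  from word_mult[OF X this] have "word l (Suc k) (mat_mult X (scale_rows l identity_mat))" by simp
  then show ?thesis
    by (rule word_cong) (simp add: mat_mult_identity_mat_right scale_cols_def flip: scale_cols_mat_mult)
qed

lemma word_conj_transpose: "word l k X \<Longrightarrow> word l k (conj_transpose X)"
proof (induction rule: word.induct)
  case (word_left C k X)
  then show ?case using word_mult[OF word_left.IH word_contraction[OF contraction_conj_transpose[OF word_left.hyps(1)]]] by (simp add: conj_transpose_mat_mult)
next
  case (word_cong k X Y)
  show ?case by (rule word.word_cong[OF word_cong.IH]) (simp add: conj_transpose_def word_cong.hyps)
qed (auto simp: conj_transpose_scale_rows intro: word_right_letter word.word_contraction contraction_conj_transpose)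

lemma word_split_right:
  "word l n X \<Longrightarrow> n = Suc k \<Longrightarrow> \<exists>W C. word l k W \<and> contraction C \<and> (\<forall>i\<in>G. \<forall>j\<in>G. X i j = mat_mult (scale_cols W l) C i j)"
proof (induction arbitrary: k rule: word.induct)
  case (word_letter m X)
  show ?case
  proof (cases m)
    case 0
    then have "contraction X" using word_letter.hyps word_0 by simp
    moreover have "\<forall>i\<in>G. \<forall>j\<in>G. scale_rows l X i j = mat_mult (scale_cols identity_mat l) X i j"
      by (simp add: scale_cols_mat_mult mat_mult_identity_mat_left)
    ultimately show ?thesis using word_contraction[OF contraction_identity_mat] 0 word_letter.prems by (intro exI[of _ identity_mat] exI[of _ X]) auto
  next
    case (Suc m')
    then obtain W C where W: "word l m' W" "contraction C" "\<forall>i\<in>G. \<forall>j\<in>G. X i j = mat_mult (scale_cols W l) C i j"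
      using word_letter.IH by blast
    have "\<forall>i\<in>G. \<forall>j\<in>G. scale_rows l X i j = mat_mult (scale_cols (scale_rows l W) l) C i j"
      using W(3) by (simp add: mat_mult_scale_rows flip: scale_rows_scale_cols) (simp add: scale_rows_def)
    moreover have "word l k (scale_rows l W)" using word.word_letter[OF W(1)] Suc word_letter.prems by simp
    ultimately show ?thesis using W(2) by blast
  qed
next
  case (word_left C' m X)
  then obtain W C where W: "word l k W" "contraction C" "\<forall>i\<in>G. \<forall>j\<in>G. X i j = mat_mult (scale_cols W l) C i j" by blast
  have "\<forall>i\<in>G. \<forall>j\<in>G. mat_mult C' X i j = mat_mult (scale_cols (mat_mult C' W) l) C i j"
    using W(3) unfolding mat_mult_scale_cols[symmetric] mat_mult_assoc by (simp add: mat_mult_def)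
  moreover have "word l k (mat_mult C' W)" by (rule word.word_left[OF word_left.hyps(1) W(1)])
  ultimately show ?case using W(2) by blast
next
  case (word_cong m X Y)
  then show ?case by metis
qed simp

lemma word_split: "word l (a + b) X \<Longrightarrow> \<exists>Y Z. word l a Y \<and> word l b Z \<and> (\<forall>i\<in>G. \<forall>j\<in>G. X i j = mat_mult Y Z i j)"
proof (induction b arbitrary: X)
  case 0
  then show ?case using word_contraction[OF contraction_identity_mat] by (intro exI[of _ X] exI[of _ identity_mat]) (simp add: mat_mult_identity_mat_right)
next
  case (Suc b)
  obtain W C where W: "word l (a + b) W" "contraction C" "\<forall>i\<in>G. \<forall>j\<in>G. X i j = mat_mult (scale_cols W l) C i j"
    using word_split_right[OF Suc.prems, of "a + b"] by auto
  obtain Y Z where YZ: "word l a Y" "word l b Z" "\<forall>i\<in>G. \<forall>j\<in>G. W i j = mat_mult Y Z i j"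
    using Suc.IH[OF W(1)] by blast
  have "\<forall>i\<in>G. \<forall>j\<in>G. X i j = mat_mult Y (mat_mult (scale_cols Z l) C) i j"
    using W(3) YZ(3) unfolding mat_mult_assoc[symmetric] mat_mult_scale_cols by (simp add: mat_mult_def scale_cols_def)
  moreover have "word l (Suc b) (mat_mult (scale_cols Z l) C)"
    using word_mult[OF word_right_letter[OF YZ(2)] word_contraction[OF W(2)]] by simp
  ultimately show ?case using YZ(1) by blast
qed

lemma word_letters: "word l m W \<Longrightarrow> word l (r + m) (scale_rows (\<lambda>i. l i ^ r) W)"
proof (induction r)
  case 0
  then show ?case by (simp add: scale_rows_def)
next
  case (Suc r)
  have "scale_rows (\<lambda>i. l i ^ Suc r) W = scale_rows l (scale_rows (\<lambda>i. l i ^ r) W)" by (intro ext) (simp add: scale_rows_def)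
  then show ?case using word.word_letter[OF Suc.IH[OF Suc.prems]] by simp
qed

lemma word_right_letters: "word l m W \<Longrightarrow> word l (m + r) (scale_cols W (\<lambda>i. l i ^ r))"
proof -
  assume W: "word l m W"
  have "conj_transpose (conj_transpose W) = W" by (intro ext) (simp add: conj_transpose_def)
  then show ?thesis using word_conj_transpose[OF word_letters[OF word_conj_transpose[OF W], of r]] by (simp add: conj_transpose_scale_rows add.commute)
qed

lemma word_hs_norm_sq_bounded: "\<exists>c. \<forall>X. word l k X \<longrightarrow> hs_norm_sq X \<le> c"
proof (induction k)
  case 0
  then show ?case using word_0 hs_norm_sq_contraction by blast
next
  case (Suc k)
  then obtain c where c: "\<And>X. word l k X \<Longrightarrow> hs_norm_sq X \<le> c" by blast
  define L where "L = (\<Sum>i\<in>G. (l i)\<^sup>2)"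
  have L: "(l i)\<^sup>2 \<le> L" if "i \<in> G" for i
    unfolding L_def using fin that by (intro member_le_sum) auto
  have L0: "L \<ge> 0" unfolding L_def by (intro sum_nonneg) auto
  have "hs_norm_sq X \<le> L * c" if "word l n X" "n = Suc k" for X n
    using that
  proof (induction rule: word.induct)
    case (word_letter m X)
    have "hs_norm_sq (scale_rows l X) = (\<Sum>i\<in>G. (l i)\<^sup>2 * (\<Sum>j\<in>G. (cmod (X i j))\<^sup>2))"
      by (simp add: hs_norm_sq_def scale_rows_def norm_mult power_mult_distrib sum_distrib_left)
    also have "\<dots> \<le> (\<Sum>i\<in>G. L * (\<Sum>j\<in>G. (cmod (X i j))\<^sup>2))"
      by (intro sum_mono mult_right_mono L sum_nonneg) auto
    also have "\<dots> = L * hs_norm_sq X" by (simp add: hs_norm_sq_def sum_distrib_left)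
    also have "\<dots> \<le> L * c" using word_letter by (intro mult_left_mono c L0) auto
    finally show ?case .
  next
    case (word_left C m X)
    then show ?case using hs_norm_sq_contraction_le[of C X] by auto
  next
    case (word_cong m X Y)
    then show ?case using hs_norm_sq_cong[of X Y] by auto
  qed simp
  then show ?case by blast
qed

lemma word_hs_norm_sq_first_letter:
  "word l n X \<Longrightarrow> n = Suc k \<Longrightarrow> \<exists>W. word l k W \<and> hs_norm_sq X \<le> hs_norm_sq (scale_rows l W)"
proof (induction rule: word.induct)
  case (word_left C m X)
  then show ?case using hs_norm_sq_contraction_le[of C X] by (meson order_trans)
next
  case (word_cong m X Y)
  then show ?case using hs_norm_sq_cong[of X Y] by auto
qed auto

text \<open>
  Reflection positivity. For \<open>W = W' l C\<close>, cut the trace \<open>Tr(l\<^bsup>r+1\<^esup> W W\<^sup>* l\<^bsup>r+1\<^esup>)\<close> cyclically into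
  \<open>l\<^bsup>r+2\<^esup> W'\<close> and \<open>l C W\<^sup>* l\<^sup>r\<close> and apply the Cauchy--Schwarz inequality. Both halves have as many letters as
  before, and the first one starts with one more pure power of \<open>l\<close>.
\<close>

lemma hs_norm_sq_reflection:
  assumes l: "\<And>i. l i \<ge> 0" and W: "word l (Suc m) W"
  shows "\<exists>W' Z. word l m W' \<and> word l (Suc m + Suc r) Z \<and>
    (hs_norm_sq (scale_rows (\<lambda>i. l i ^ Suc r) W))\<^sup>2 \<le> hs_norm_sq (scale_rows (\<lambda>i. l i ^ Suc (Suc r)) W') * hs_norm_sq Z"
proof -
  obtain W' C where W': "word l m W'" "contraction C" "\<And>i j. i \<in> G \<Longrightarrow> j \<in> G \<Longrightarrow> W i j = mat_mult (scale_cols W' l) C i j"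
    using word_split_right[OF W refl] by blast
  let ?Y = "scale_rows (\<lambda>i. l i ^ Suc (Suc r)) W'"
  let ?Z = "scale_rows l (mat_mult C (scale_cols (conj_transpose W) (\<lambda>i. l i ^ r)))"
  have Z: "word l (Suc m + Suc r) ?Z"
    using word_letter[OF word_left[OF W'(2) word_right_letters[OF word_conj_transpose[OF W], of r]]] by simp
  have "mtrace (mat_mult ?Y ?Z) = complex_of_real (hs_norm_sq (scale_rows (\<lambda>i. l i ^ Suc r) W))"
  proof -
    have "(\<Sum>k\<in>G. ?Y i k * ?Z k i) = complex_of_real (\<Sum>j\<in>G. (cmod (scale_rows (\<lambda>i. l i ^ Suc r) W i j))\<^sup>2)"
      if i: "i \<in> G" for i
    proof -
      have "(\<Sum>k\<in>G. ?Y i k * ?Z k i)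
        = (\<Sum>k\<in>G. \<Sum>j\<in>G. of_real (l i ^ Suc r * l i ^ Suc r) * (W' i k * of_real (l k) * C k j) * cnj (W i j))"
        by (simp add: scale_rows_def scale_cols_def conj_transpose_def mat_mult_def sum_distrib_left mult_ac)
      also have "\<dots> = (\<Sum>j\<in>G. \<Sum>k\<in>G. of_real (l i ^ Suc r * l i ^ Suc r) * (W' i k * of_real (l k) * C k j) * cnj (W i j))"
        by (rule sum.swap)
      also have "\<dots> = (\<Sum>j\<in>G. of_real (l i ^ Suc r * l i ^ Suc r) * mat_mult (scale_cols W' l) C i j * cnj (W i j))"
        by (simp add: mat_mult_def scale_cols_def sum_distrib_left sum_distrib_right mult_ac)
      also have "\<dots> = (\<Sum>j\<in>G. of_real (l i ^ Suc r * l i ^ Suc r) * (W i j * cnj (W i j)))"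
        using i by (intro sum.cong) (auto simp: W'(3))
      also have "\<dots> = (\<Sum>j\<in>G. complex_of_real ((cmod (scale_rows (\<lambda>i. l i ^ Suc r) W i j))\<^sup>2))"
      proof (intro sum.cong refl)
        fix j
        have "W i j * cnj (W i j) = of_real ((cmod (W i j))\<^sup>2)" by (rule complex_norm_square[symmetric])
        then show "of_real (l i ^ Suc r * l i ^ Suc r) * (W i j * cnj (W i j)) = complex_of_real ((cmod (scale_rows (\<lambda>i. l i ^ Suc r) W i j))\<^sup>2)"
          using l[of i] by (simp add: scale_rows_def norm_mult norm_power power2_eq_square mult_ac)
      qed
      finally show ?thesis by simp
    qed
    then show ?thesis by (simp add: mtrace_def mat_mult_def hs_norm_sq_def)
  qed
  then have "(hs_norm_sq (scale_rows (\<lambda>i. l i ^ Suc r) W))\<^sup>2 = (cmod (mtrace (mat_mult ?Y ?Z)))\<^sup>2" by simp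
  also have "\<dots> \<le> hs_norm_sq ?Y * hs_norm_sq ?Z" by (rule trace_cauchy_schwarz)
  finally show ?thesis using W'(1) Z by blast
qed

text \<open>
  Let \<open>M\<close> be the supremum of the left-hand side over all words with \<open>h\<close> letters. By reflection, a
  bound \<open>c < M\<close> for the words starting with \<open>l\<^bsup>r+2\<^esup>\<close> yields the bound \<open>sqrt (c M) < M\<close> for those starting
  with \<open>l\<^bsup>r+1\<^esup>\<close>. If the claim failed, \<open>c = \<Sum> l\<^sub>i\<^bsup>2h\<^esup>\<close> would be such a bound for \<open>l\<^sup>h C\<close>, and descending to \<open>r = 0\<close> would give a
  bound below \<open>M\<close> for all words.
\<close>

lemma word_hs_norm_sq_le:
  assumes l: "\<And>i. l i \<ge> 0" and X: "word l h X" and h: "h \<ge> 1"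
  shows "hs_norm_sq X \<le> (\<Sum>i\<in>G. l i ^ (2 * h))"
proof -
  let ?\<tau> = "\<Sum>i\<in>G. l i ^ (2 * h)"
  define M where "M = Sup (hs_norm_sq ` {X. word l h X})"
  have bdd: "bdd_above (hs_norm_sq ` {X. word l h X})"
    using word_hs_norm_sq_bounded[of l h] by (auto simp: bdd_above_def)
  have M: "hs_norm_sq X \<le> M" if "word l h X" for X
    unfolding M_def using that by (intro cSup_upper bdd) auto
  have "M \<le> ?\<tau>"
  proof (rule ccontr)
    assume "\<not> M \<le> ?\<tau>"
    then have gt: "?\<tau> < M" by simp
    have t0: "?\<tau> \<ge> 0" using l by (intro sum_nonneg) auto
    have M0: "M > 0" using gt t0 by linarith
    have "\<exists>c\<ge>0. c < M \<and> (\<forall>W. word l m W \<longrightarrow> m + Suc r = h \<longrightarrow> hs_norm_sq (scale_rows (\<lambda>i. l i ^ Suc r) W) \<le> c)" for m r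
    proof (induction m arbitrary: r)
      case 0
      have "hs_norm_sq (scale_rows (\<lambda>i. l i ^ h) C) \<le> ?\<tau>" if C: "contraction C" for C
      proof -
        have "(\<Sum>j\<in>G. (cmod (C i j))\<^sup>2) \<le> 1" if i: "i \<in> G" for i
        proof -
          have "(\<Sum>k\<in>G. (cmod (\<Sum>j\<in>G. conj_transpose C k j * identity_mat j i))\<^sup>2) \<le> (\<Sum>j\<in>G. (cmod (identity_mat j i))\<^sup>2)"
            by (rule contractionD[OF contraction_conj_transpose[OF C]])
          moreover have "(\<Sum>j\<in>G. conj_transpose C k j * identity_mat j i) = cnj (C i k)" for k
            using mat_mult_identity_mat_right[OF i, of "conj_transpose C" k] by (simp add: mat_mult_def conj_transpose_def)
          moreover have "(\<Sum>j\<in>G. (cmod (identity_mat j i))\<^sup>2) = (\<Sum>j\<in>G. if j = i then 1 else 0)"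
            by (intro sum.cong) (auto simp: identity_mat_def)
          ultimately show ?thesis using fin i by simp
        qed
        then have "(\<Sum>i\<in>G. l i ^ (2 * h) * (\<Sum>j\<in>G. (cmod (C i j))\<^sup>2)) \<le> (\<Sum>i\<in>G. l i ^ (2 * h) * 1)"
          using l by (intro sum_mono mult_left_mono) auto
        moreover have "hs_norm_sq (scale_rows (\<lambda>i. l i ^ h) C) = (\<Sum>i\<in>G. l i ^ (2 * h) * (\<Sum>j\<in>G. (cmod (C i j))\<^sup>2))"
          by (simp add: hs_norm_sq_def scale_rows_def norm_mult norm_power power_mult_distrib sum_distrib_left power_even_eq l)
        ultimately show ?thesis by simp
      qed
      then have "\<forall>W. word l 0 W \<longrightarrow> 0 + Suc r = h \<longrightarrow> hs_norm_sq (scale_rows (\<lambda>i. l i ^ Suc r) W) \<le> ?\<tau>"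
        using word_0 by auto
      then show ?case using gt t0 by blast
    next
      case (Suc m)
      obtain c where c: "c \<ge> 0" "c < M" "\<And>W. word l m W \<Longrightarrow> m + Suc (Suc r) = h \<Longrightarrow> hs_norm_sq (scale_rows (\<lambda>i. l i ^ Suc (Suc r)) W) \<le> c"
        using Suc.IH[of "Suc r"] by blast
      have "hs_norm_sq (scale_rows (\<lambda>i. l i ^ Suc r) W) \<le> sqrt (c * M)" if W: "word l (Suc m) W" "Suc m + Suc r = h" for W
      proof -
        obtain W' Z where W': "word l m W'" "word l (Suc m + Suc r) Z"
          "(hs_norm_sq (scale_rows (\<lambda>i. l i ^ Suc r) W))\<^sup>2 \<le> hs_norm_sq (scale_rows (\<lambda>i. l i ^ Suc (Suc r)) W') * hs_norm_sq Z"
          using hs_norm_sq_reflection[of l m W r] l W(1) by blast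
        have "hs_norm_sq (scale_rows (\<lambda>i. l i ^ Suc (Suc r)) W') * hs_norm_sq Z \<le> c * M"
          using c(1) W W' by (intro mult_mono c(3) M hs_norm_sq_nonneg) auto
        then show ?thesis using W'(3) by (intro real_le_rsqrt) linarith
      qed
      moreover have "sqrt (c * M) < M"
        using c M0 by (intro real_less_lsqrt) (auto simp: power2_eq_square)
      ultimately show ?case using c(1) M0 by (intro exI[of _ "sqrt (c * M)"]) auto
    qed
    from this[of "h - 1" 0] obtain c where c: "c < M" "\<And>W. word l (h - 1) W \<Longrightarrow> hs_norm_sq (scale_rows l W) \<le> c"
      using h by auto
    have "hs_norm_sq X \<le> c" if "word l h X" for X
      using word_hs_norm_sq_first_letter[OF that, of "h - 1"] h c(2) by fastforce
    then have "M \<le> c" unfolding M_def using X by (intro cSup_least) auto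
    then show False using c by simp
  qed
  then show ?thesis using M[OF X] by simp
qed

lemma word_square: "word (\<lambda>i. (l i)\<^sup>2) k X \<Longrightarrow> word l (2 * k) X"
proof (induction rule: word.induct)
  case (word_letter k X)
  have "scale_rows (\<lambda>i. (l i)\<^sup>2) X = scale_rows l (scale_rows l X)" by (intro ext) (simp add: scale_rows_def power2_eq_square)
  then show ?case using word.word_letter[OF word.word_letter[OF word_letter.IH]] by simp
qed (auto intro: word.intros)

text \<open>
  The Hoelder inequality for the trace of a product of \<open>s\<close> factors in the Schatten class of exponent \<open>s\<close>. With the
  letter \<open>sqrt l\<close> in place of \<open>l\<close> the word has \<open>2 s\<close> letters and can be cut into two halves of the
  same length, whatever the parity of \<open>s\<close>.
\<close>

theorem word_trace_le:
  assumes l: "\<And>i. l i \<ge> 0" and X: "word l s X" and s: "s \<ge> 1"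
  shows "cmod (mtrace X) \<le> (\<Sum>i\<in>G. l i ^ s)"
proof -
  define m where "m i = sqrt (l i)" for i
  have m: "m i \<ge> 0" "(m i)\<^sup>2 = l i" for i using l by (auto simp: m_def)
  have "word m (s + s) X" using word_square[of m s X] X m by (simp add: mult_2)
  from word_split[OF this] obtain Y Z where YZ: "word m s Y" "word m s Z" "\<forall>i\<in>G. \<forall>j\<in>G. X i j = mat_mult Y Z i j"
    by blast
  have t: "(\<Sum>i\<in>G. m i ^ (2 * s)) = (\<Sum>i\<in>G. l i ^ s)" by (simp add: power_mult m)
  have "mtrace X = mtrace (mat_mult Y Z)" unfolding mtrace_def using YZ(3) by (intro sum.cong) auto
  then have "(cmod (mtrace X))\<^sup>2 \<le> hs_norm_sq Y * hs_norm_sq Z" using trace_cauchy_schwarz by simp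
  also have "\<dots> \<le> (\<Sum>i\<in>G. l i ^ s) * (\<Sum>i\<in>G. l i ^ s)"
    using word_hs_norm_sq_le[OF m(1) YZ(1) s] word_hs_norm_sq_le[OF m(1) YZ(2) s] unfolding t
    using l by (intro mult_mono hs_norm_sq_nonneg sum_nonneg) auto
  finally have "(cmod (mtrace X))\<^sup>2 \<le> (\<Sum>i\<in>G. l i ^ s)\<^sup>2" unfolding power2_eq_square .
  then show ?thesis by (rule power2_le_imp_le) (intro sum_nonneg zero_le_power l)
qed

end

end

section \<open>Fourier inversion\<close>

subsection \<open>Gaussians are Schwartz functions\<close>

text \<open>
  The complex number \<open>b\<close> accounts for translations as well as modulations of the Gaussian.
\<close>

definition gauss :: "real \<Rightarrow> complex \<Rightarrow> real \<Rightarrow> complex"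
  where "gauss c b x = exp (of_real (- c * x\<^sup>2) + b * of_real x)"

lemma cmod_gauss: "cmod (gauss c b x) = exp (- c * x\<^sup>2 + Re b * x)"
  by (simp add: gauss_def norm_exp_eq_Re)

lemma gauss_derivative:
  "((\<lambda>x. poly p (of_real x) * gauss c b x) has_vector_derivative
     poly (pderiv p + p * [:b, of_real (- 2 * c):]) (of_real x) * gauss c b x) (at x)"
proof -
  have "((\<lambda>z. poly p z * exp (- of_real c * z\<^sup>2 + b * z)) has_field_derivative
      poly (pderiv p + p * [:b, of_real (- 2 * c):]) z * exp (- of_real c * z\<^sup>2 + b * z)) (at z)" for z
    by (auto intro!: derivative_eq_intros poly_DERIV simp: algebra_simps)
  from has_vector_derivative_real_field[OF this, of x UNIV]
  show ?thesis by (simp add: gauss_def)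
qed

fun gauss_poly :: "real \<Rightarrow> complex \<Rightarrow> nat \<Rightarrow> complex poly" where
  "gauss_poly c b 0 = 1"
| "gauss_poly c b (Suc n) = pderiv (gauss_poly c b n) + gauss_poly c b n * [:b, of_real (- 2 * c):]"

lemma nth_deriv_gauss: "nth_deriv n (gauss c b) = (\<lambda>x. poly (gauss_poly c b n) (of_real x) * gauss c b x)"
proof (induction n)
  case 0
  then show ?case by (simp add: nth_deriv_def)
next
  case (Suc n)
  have "nth_deriv (Suc n) (gauss c b) = (\<lambda>x. vector_derivative (nth_deriv n (gauss c b)) (at x))"
    by (simp add: nth_deriv_def)
  then show ?case unfolding Suc.IH
    by (simp only: vector_derivative_at[OF gauss_derivative] gauss_poly.simps)
qed

lemma gauss_times_power_bounded:
  assumes "c > 0"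
  shows "\<exists>C. \<forall>x. \<bar>x\<bar> ^ k * cmod (gauss c b x) \<le> C"
proof (intro exI allI)
  fix x :: real
  define \<beta> where "\<beta> = \<bar>Re b\<bar> + real k"
  have "\<bar>x\<bar> ^ k \<le> exp \<bar>x\<bar> ^ k" using exp_ge_add_one_self[of "\<bar>x\<bar>"] by (intro power_mono) (linarith, simp)
  also have "\<dots> = exp (real k * \<bar>x\<bar>)" by (simp add: exp_of_nat_mult)
  finally have "\<bar>x\<bar> ^ k * cmod (gauss c b x) \<le> exp (real k * \<bar>x\<bar>) * exp (- c * x\<^sup>2 + Re b * x)"
    unfolding cmod_gauss by (intro mult_right_mono) auto
  also have "\<dots> = exp (real k * \<bar>x\<bar> + (- c * x\<^sup>2 + Re b * x))" by (simp add: exp_add)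
  also have "\<dots> \<le> exp (\<beta>\<^sup>2 / (4 * c))"
  proof (subst exp_le_cancel_iff)
    have "Re b * x \<le> \<bar>Re b\<bar> * \<bar>x\<bar>" by (metis abs_ge_self abs_mult)
    then have "real k * \<bar>x\<bar> + (- c * x\<^sup>2 + Re b * x) \<le> \<beta> * \<bar>x\<bar> - c * \<bar>x\<bar>\<^sup>2" by (simp add: \<beta>_def algebra_simps)
    also have "\<dots> = \<beta>\<^sup>2 / (4 * c) - c * (\<bar>x\<bar> - \<beta> / (2 * c))\<^sup>2"
      using assms by (simp add: power2_diff field_simps power2_eq_square)
    also have "\<dots> \<le> \<beta>\<^sup>2 / (4 * c)" using assms by simp
    finally show "real k * \<bar>x\<bar> + (- c * x\<^sup>2 + Re b * x) \<le> \<beta>\<^sup>2 / (4 * c)" .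
  qed
  finally show "\<bar>x\<bar> ^ k * cmod (gauss c b x) \<le> exp (\<beta>\<^sup>2 / (4 * c))" .
qed

lemma gauss_times_poly_bounded:
  assumes "c > 0"
  shows "\<exists>C. \<forall>x. \<bar>x\<bar> ^ k * cmod (poly p (of_real x) * gauss c b x) \<le> C"
proof (induction p arbitrary: k)
  case (pCons a p)
  obtain C1 where C1: "\<And>x. \<bar>x\<bar> ^ k * cmod (gauss c b x) \<le> C1"
    using gauss_times_power_bounded[OF assms] by blast
  obtain C2 where C2: "\<And>x. \<bar>x\<bar> ^ Suc k * cmod (poly p (of_real x) * gauss c b x) \<le> C2"
    using pCons.IH[of "Suc k"] by blast
  have "\<bar>x\<bar> ^ k * cmod (poly (pCons a p) (of_real x) * gauss c b x) \<le> cmod a * C1 + C2" for x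
  proof -
    have "\<bar>x\<bar> ^ k * cmod (poly (pCons a p) (of_real x) * gauss c b x)
        \<le> \<bar>x\<bar> ^ k * (cmod (a * gauss c b x) + cmod (of_real x * (poly p (of_real x) * gauss c b x)))"
      by (intro mult_left_mono) (simp_all add: distrib_right mult.assoc norm_triangle_ineq del: norm_mult)
    also have "\<dots> = cmod a * (\<bar>x\<bar> ^ k * cmod (gauss c b x)) + \<bar>x\<bar> ^ Suc k * cmod (poly p (of_real x) * gauss c b x)"
      by (simp add: norm_mult algebra_simps)
    also have "\<dots> \<le> cmod a * C1 + C2" by (intro add_mono mult_left_mono C1 C2) auto
    finally show ?thesis .
  qed
  then show ?case by blast
qed auto

lemma schwartz_gauss:
  assumes "c > 0"
  shows "schwartz (gauss c b)"
  unfolding schwartz_def smooth_def nth_deriv_gauss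
  using gauss_times_poly_bounded[OF assms] differentiableI_vector[OF gauss_derivative] by blast

subsection \<open>The Fourier transform of a Gaussian\<close>

lemma gauss_integral:
  "(\<integral>x. iexp (t * x) * exp (- of_real (x\<^sup>2 / 2)) \<partial>lborel) = of_real (sqrt (2 * pi) * exp (- t\<^sup>2 / 2))"
proof -
  have "char std_normal_distribution t = of_real (exp (- (t\<^sup>2) / 2))" by (simp add: char_std_normal_distribution)
  moreover have "char std_normal_distribution t = (\<integral>x. std_normal_density x *\<^sub>R iexp (t * x) \<partial>lborel)"
    unfolding char_def by (subst integral_density) (auto simp: normal_density_nonneg)
  ultimately have "(\<integral>x. std_normal_density x *\<^sub>R iexp (t * x) \<partial>lborel) = of_real (exp (- t\<^sup>2 / 2))" by simp
  moreover have "std_normal_density x *\<^sub>R iexp (t * x) = of_real (1 / sqrt (2 * pi)) * (iexp (t * x) * exp (- of_real (x\<^sup>2 / 2)))" for x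
    by (simp add: std_normal_density_def scaleR_conv_of_real exp_of_real[symmetric])
  ultimately have "of_real (1 / sqrt (2 * pi)) * (\<integral>x. iexp (t * x) * exp (- of_real (x\<^sup>2 / 2)) \<partial>lborel) = complex_of_real (exp (- t\<^sup>2 / 2))"
    by simp
  then have "of_real (sqrt (2 * pi)) * of_real (1 / sqrt (2 * pi)) * (\<integral>x. iexp (t * x) * exp (- of_real (x\<^sup>2 / 2)) \<partial>lborel)
     = of_real (sqrt (2 * pi)) * complex_of_real (exp (- t\<^sup>2 / 2))" by (simp only: mult.assoc)
  moreover have "complex_of_real (sqrt (2 * pi)) * of_real (1 / sqrt (2 * pi)) = 1"
    by (simp flip: of_real_mult)
  ultimately show ?thesis by simp
qed

lemma fourier_gauss:
  assumes n: "n > 0"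
  shows "fourier_integral (gauss (1 / (2 * n\<^sup>2)) (\<i> * of_real x0)) y
    = of_real (normal_density x0 (1 / n) y)"
proof -
  have "fourier_integral (gauss (1 / (2 * n\<^sup>2)) (\<i> * of_real x0)) y
     = (\<integral>t. iexp ((x0 - y) * t) * exp (- of_real ((t / n)\<^sup>2 / 2)) / of_real (2 * pi) \<partial>lborel)"
    unfolding fourier_integral_def gauss_def
    by (intro Bochner_Integration.integral_cong refl)
       (simp add: exp_add[symmetric] power_divide algebra_simps)
  also have "\<dots> = (\<integral>t. iexp ((x0 - y) * t) * exp (- of_real ((t / n)\<^sup>2 / 2)) \<partial>lborel) / of_real (2 * pi)"
    by simp
  also have "(\<integral>t. iexp ((x0 - y) * t) * exp (- of_real ((t / n)\<^sup>2 / 2)) \<partial>lborel)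
     = \<bar>n\<bar> *\<^sub>R (\<integral>x. iexp ((x0 - y) * (0 + n * x)) * exp (- of_real (((0 + n * x) / n)\<^sup>2 / 2)) \<partial>lborel)"
    using n by (intro lborel_integral_real_affine) auto
  also have "(\<integral>x. iexp ((x0 - y) * (0 + n * x)) * exp (- of_real (((0 + n * x) / n)\<^sup>2 / 2)) \<partial>lborel)
     = (\<integral>x. iexp ((n * (x0 - y)) * x) * exp (- of_real (x\<^sup>2 / 2)) \<partial>lborel)"
    using n by (intro Bochner_Integration.integral_cong refl) (simp add: mult_ac)
  also have "\<dots> = of_real (sqrt (2 * pi) * exp (- (n * (x0 - y))\<^sup>2 / 2))" by (rule gauss_integral)
  also have "\<bar>n\<bar> *\<^sub>R complex_of_real (sqrt (2 * pi) * exp (- (n * (x0 - y))\<^sup>2 / 2)) / of_real (2 * pi)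
     = of_real (n * (sqrt (2 * pi) * exp (- (n * (x0 - y))\<^sup>2 / 2)) / (2 * pi))"
    using n by (simp add: scaleR_conv_of_real)
  also have "n * (sqrt (2 * pi) * exp (- (n * (x0 - y))\<^sup>2 / 2)) / (2 * pi) = normal_density x0 (1 / n) y"
  proof -
    have "sqrt (2 * pi) * sqrt (2 * pi) = 2 * pi" by simp
    then have "sqrt (2 * pi) / (2 * pi) = 1 / sqrt (2 * pi)" by (simp add: field_simps)
    then have "n * exp (- (n * (x0 - y))\<^sup>2 / 2) * (sqrt (2 * pi) / (2 * pi)) = n * exp (- (n * (x0 - y))\<^sup>2 / 2) * (1 / sqrt (2 * pi))"
      by (simp only:)
    then have "n * (sqrt (2 * pi) * exp (- (n * (x0 - y))\<^sup>2 / 2)) / (2 * pi) = n * exp (- (n * (x0 - y))\<^sup>2 / 2) / sqrt (2 * pi)"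
      by (simp add: mult_ac)
    also have "\<dots> = normal_density x0 (1 / n) y"
      using n by (simp add: normal_density_def real_sqrt_divide real_sqrt_mult power_divide power_mult_distrib
          power2_commute[of x0 y] mult_ac)
    finally show ?thesis .
  qed
  finally show ?thesis .
qed

subsection \<open>Inversion for continuous functions\<close>

text \<open>
  All that is known about the growth of \<open>g\<close> is its integrability against Gaussians. This is enough: away from \<open>x\<^sub>0\<close> the
  narrow Gaussians are at most \<open>\<epsilon>\<close> times the one of variance \<open>1\<close>.
\<close>

lemma gaussian_approximate_identity:
  fixes g :: "real \<Rightarrow> complex"
  assumes g: "continuous_on UNIV g" and int: "integrable lborel (\<lambda>y. g y * of_real (exp (- (y - x0)\<^sup>2 / 2)))"
    and intn: "\<And>n. integrable lborel (\<lambda>y. g y * of_real (normal_density x0 (1 / real (Suc n)) y))"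
  shows "(\<lambda>n. \<integral>y. g y * of_real (normal_density x0 (1 / real (Suc n)) y) \<partial>lborel) \<longlonglongrightarrow> g x0"
proof -
  let ?N = "\<lambda>n y. normal_density x0 (1 / real (Suc n)) y"
  have [measurable]: "g \<in> borel_measurable borel" by (rule borel_measurable_continuous_onI[OF g])
  have iN: "integrable lborel (?N n)" "integral\<^sup>L lborel (?N n) = 1" for n
    by (auto intro!: integrable_normal_density integral_normal_density)
  have iE: "integrable lborel (\<lambda>y. exp (- (y - x0)\<^sup>2 / 2))"
  proof -
    have "integrable lborel (\<lambda>y. sqrt (2 * pi) * normal_density x0 1 y)" by (intro integrable_mult_right integrable_normal_density) simp
    then show ?thesis by (simp add: normal_density_def)
  qed
  let ?k = "\<lambda>y. cmod (g y - g x0) * exp (- (y - x0)\<^sup>2 / 2)"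
  have ik: "integrable lborel ?k"
  proof -
    have "integrable lborel (\<lambda>y. norm (g y * of_real (exp (- (y - x0)\<^sup>2 / 2)) - g x0 * of_real (exp (- (y - x0)\<^sup>2 / 2))))"
      by (intro integrable_norm Bochner_Integration.integrable_diff int integrable_mult_right integrable_of_real iE)
    then show ?thesis by (simp add: left_diff_distrib[symmetric] norm_mult)
  qed
  define I where "I = integral\<^sup>L lborel ?k"
  have I0: "I \<ge> 0" unfolding I_def by (intro integral_nonneg_AE) auto
  have diff: "(\<integral>y. g y * of_real (?N n y) \<partial>lborel) - g x0 = (\<integral>y. (g y - g x0) * of_real (?N n y) \<partial>lborel)" for n
  proof -
    have "(\<integral>y. (g y - g x0) * of_real (?N n y) \<partial>lborel)
       = (\<integral>y. g y * of_real (?N n y) - g x0 * of_real (?N n y) \<partial>lborel)" by (simp add: left_diff_distrib)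
    also have "\<dots> = (\<integral>y. g y * of_real (?N n y) \<partial>lborel) - (\<integral>y. g x0 * of_real (?N n y) \<partial>lborel)"
      by (intro Bochner_Integration.integral_diff intn integrable_mult_right integrable_of_real iN)
    also have "(\<integral>y. g x0 * of_real (?N n y) \<partial>lborel) = g x0" using iN by simp
    finally show ?thesis by simp
  qed
  show ?thesis
  proof (rule LIMSEQ_I)
    fix r :: real assume r: "r > 0"
    define \<epsilon> where "\<epsilon> = r / (2 * (1 + I))"
    have e: "\<epsilon> > 0" using r I0 by (simp add: \<epsilon>_def)
    have "isCont g x0" using g by (simp add: continuous_on_eq_continuous_at)
    then obtain \<delta> where \<delta>: "\<delta> > 0" "\<And>y. \<bar>y - x0\<bar> < \<delta> \<Longrightarrow> cmod (g y - g x0) < \<epsilon>"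
      using e unfolding continuous_at_eps_delta dist_norm by (metis real_norm_def)
    have "((\<lambda>n. real (Suc n) * exp (- ((real (Suc n))\<^sup>2 - 1) * \<delta>\<^sup>2 / 2)) \<longlongrightarrow> 0) at_top"
      using \<delta>(1) by real_asymp
    then have "\<forall>\<^sub>F n in sequentially. real (Suc n) * exp (- ((real (Suc n))\<^sup>2 - 1) * \<delta>\<^sup>2 / 2) < \<epsilon>"
      using e by (rule order_tendstoD)
    then obtain n0 where n0: "\<And>n. n \<ge> n0 \<Longrightarrow> real (Suc n) * exp (- ((real (Suc n))\<^sup>2 - 1) * \<delta>\<^sup>2 / 2) < \<epsilon>"
      by (auto simp: eventually_sequentially)
    have "cmod ((\<integral>y. g y * of_real (?N n y) \<partial>lborel) - g x0) < r" if n: "n \<ge> n0" for n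
    proof -
      let ?m = "real (Suc n)"
      have Ndef: "?N n y = ?m / sqrt (2 * pi) * exp (- ?m\<^sup>2 * (y - x0)\<^sup>2 / 2)" for y
        by (simp add: normal_density_def real_sqrt_divide real_sqrt_mult power_divide mult_ac)
      have bound: "cmod ((g y - g x0) * of_real (?N n y)) \<le> \<epsilon> * ?N n y + \<epsilon> * ?k y" for y
      proof (cases "\<bar>y - x0\<bar> < \<delta>")
        case True
        have "cmod ((g y - g x0) * of_real (?N n y)) = cmod (g y - g x0) * ?N n y"
          by (simp add: norm_mult normal_density_nonneg)
        also have "\<dots> \<le> \<epsilon> * ?N n y" using \<delta>(2)[OF True] by (intro mult_right_mono) auto
        finally show ?thesis using e by (simp add: add_increasing2)
      next
        case False
        then have d: "\<delta>\<^sup>2 \<le> (y - x0)\<^sup>2" using \<delta>(1) by (metis abs_le_square_iff abs_of_pos not_less)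
        have m1: "?m\<^sup>2 - 1 \<ge> 0" using one_le_power[of ?m 2] by simp
        have "?N n y \<le> ?m * exp (- ?m\<^sup>2 * (y - x0)\<^sup>2 / 2)"
        proof -
          have "sqrt (2 * pi) \<ge> 1" using pi_ge_two by simp
          then have "?m / sqrt (2 * pi) \<le> ?m / 1" by (intro divide_left_mono) auto
          then show ?thesis unfolding Ndef by (intro mult_right_mono) auto
        qed
        also have "exp (- ?m\<^sup>2 * (y - x0)\<^sup>2 / 2) = exp (- (?m\<^sup>2 - 1) * (y - x0)\<^sup>2 / 2) * exp (- (y - x0)\<^sup>2 / 2)"
          by (simp add: exp_add[symmetric] algebra_simps add_divide_distrib diff_divide_distrib del: of_nat_Suc)
        also have "\<dots> \<le> exp (- (?m\<^sup>2 - 1) * \<delta>\<^sup>2 / 2) * exp (- (y - x0)\<^sup>2 / 2)"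
        proof (rule mult_right_mono)
          have "- c * b / 2 \<le> - c * a / 2" if "a \<le> b" "c \<ge> 0" for a b c :: real
            using mult_left_mono[OF that] by simp
          from this[OF d m1] show "exp (- (?m\<^sup>2 - 1) * (y - x0)\<^sup>2 / 2) \<le> exp (- (?m\<^sup>2 - 1) * \<delta>\<^sup>2 / 2)"
            by (simp only: exp_le_cancel_iff)
        qed simp
        also have "?m * (exp (- (?m\<^sup>2 - 1) * \<delta>\<^sup>2 / 2) * exp (- (y - x0)\<^sup>2 / 2)) \<le> \<epsilon> * exp (- (y - x0)\<^sup>2 / 2)"
          using n0[OF n] unfolding mult.assoc[symmetric] by (intro mult_right_mono) auto
        finally have "?N n y \<le> \<epsilon> * exp (- (y - x0)\<^sup>2 / 2)" by simp
        then have "cmod (g y - g x0) * ?N n y \<le> cmod (g y - g x0) * (\<epsilon> * exp (- (y - x0)\<^sup>2 / 2))"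
          by (intro mult_left_mono) auto
        then have "cmod ((g y - g x0) * of_real (?N n y)) \<le> \<epsilon> * ?k y"
          by (simp add: norm_mult normal_density_nonneg mult_ac)
        then show ?thesis using e normal_density_nonneg[of x0 "1 / ?m" y] by (simp add: add_increasing)
      qed
      have iR: "integrable lborel (\<lambda>y. \<epsilon> * ?N n y + \<epsilon> * ?k y)"
        by (intro Bochner_Integration.integrable_add integrable_mult_right iN ik)
      have "cmod ((\<integral>y. g y * of_real (?N n y) \<partial>lborel) - g x0) \<le> (\<integral>y. cmod ((g y - g x0) * of_real (?N n y)) \<partial>lborel)"
        unfolding diff by (rule integral_norm_bound)
      also have "\<dots> \<le> (\<integral>y. \<epsilon> * ?N n y + \<epsilon> * ?k y \<partial>lborel)"
        using e by (intro integral_mono_AE' iR AE_I2 bound) (simp del: of_nat_Suc)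
      also have "\<dots> = \<epsilon> * 1 + \<epsilon> * I"
        unfolding I_def using iN ik by (subst Bochner_Integration.integral_add) auto
      also have "\<dots> = r / 2" 
      proof -
        have "\<epsilon> * 1 + \<epsilon> * I = \<epsilon> * (1 + I)" by (simp add: distrib_left)
        also have "\<dots> = r / 2"
        proof -
          have "1 + I \<noteq> 0" using I0 by simp
          then show ?thesis unfolding \<epsilon>_def times_divide_eq_left by (rule nonzero_mult_divide_mult_cancel_right)
        qed
        finally show ?thesis .
      qed
      also have "\<dots> < r" using r by simp
      finally show ?thesis .
    qed
    then show "\<exists>no. \<forall>n\<ge>no. norm ((\<integral>y. g y * of_real (?N n y) \<partial>lborel) - g x0) < r" by blast
  qed
qed

text \<open>
  Test the distributional identity on \<open>exp(i t x\<^sub>0)\<close> multiplied by wider and wider Gaussians, whose Fourier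
  transforms are normal densities concentrating at \<open>x\<^sub>0\<close>.
\<close>

theorem fourier_inversion:
  assumes F: "has_L1_fourier g h" and g: "continuous_on UNIV g"
  shows "g x0 = (\<integral>t. h t * iexp (t * x0) \<partial>lborel)"
proof -
  have h: "integrable lborel h" using F by (simp add: has_L1_fourier_def)
  then have [measurable]: "h \<in> borel_measurable borel" by auto
  let ?\<phi> = "\<lambda>n. gauss (1 / (2 * (real (Suc n))\<^sup>2)) (\<i> * of_real x0)"
  have sch: "schwartz (?\<phi> n)" for n by (rule schwartz_gauss) simp
  have eq: "(\<integral>x. h x * ?\<phi> n x \<partial>lborel) = (\<integral>x. g x * of_real (normal_density x0 (1 / real (Suc n)) x) \<partial>lborel)" for n
    using F sch[of n] unfolding has_L1_fourier_def by (simp add: fourier_gauss del: of_nat_Suc)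
  have ig: "integrable lborel (\<lambda>x. g x * gauss c b x)" if "c > 0" for c b
    using F schwartz_gauss[OF that] unfolding has_L1_fourier_def by blast
  have "(\<lambda>n. \<integral>x. g x * of_real (normal_density x0 (1 / real (Suc n)) x) \<partial>lborel) \<longlonglongrightarrow> g x0"
  proof (rule gaussian_approximate_identity[OF g])
    have G: "integrable lborel (\<lambda>x. g x * of_real (K * exp (- c * (x - x0)\<^sup>2)))" if c: "c > 0" for c K
    proof -
      have "integrable lborel (\<lambda>x. (g x * gauss c (of_real (2 * c * x0)) x) * of_real (K * exp (- c * x0\<^sup>2)))"
        by (intro integrable_mult_left ig c)
      moreover have "(g x * gauss c (of_real (2 * c * x0)) x) * of_real (K * exp (- c * x0\<^sup>2))
          = g x * of_real (K * exp (- c * (x - x0)\<^sup>2))" for x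
      proof -
        have "gauss c (of_real (2 * c * x0)) x = of_real (exp (- c * x\<^sup>2 + 2 * c * x0 * x))"
          by (simp add: gauss_def exp_of_real[symmetric])
        moreover have "exp (- c * x\<^sup>2 + 2 * c * x0 * x) * exp (- c * x0\<^sup>2) = exp (- c * (x - x0)\<^sup>2)"
          by (simp add: exp_add[symmetric] power2_diff algebra_simps)
        ultimately show ?thesis by (simp add: mult_ac flip: of_real_mult)
      qed
      ultimately show ?thesis by (simp only:)
    qed
    show "integrable lborel (\<lambda>y. g y * of_real (exp (- (y - x0)\<^sup>2 / 2)))" using G[of "1/2" 1] by simp
    show "integrable lborel (\<lambda>y. g y * of_real (normal_density x0 (1 / real (Suc n)) y))" for n
      using G[of "(real (Suc n))\<^sup>2 / 2" "1 / sqrt (2 * pi * (1 / real (Suc n))\<^sup>2)"]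
      by (simp add: normal_density_def power_divide mult_ac del: of_nat_Suc)
  qed
  moreover have "(\<lambda>n. \<integral>x. h x * ?\<phi> n x \<partial>lborel) \<longlonglongrightarrow> (\<integral>t. h t * iexp (t * x0) \<partial>lborel)"
  proof (rule integral_dominated_convergence[where w = "\<lambda>t. cmod (h t)"])
    have cg: "continuous_on UNIV (gauss c b)" for c b unfolding gauss_def by (intro continuous_intros)
    have [measurable]: "gauss c b \<in> borel_measurable borel" for c b by (rule borel_measurable_continuous_onI[OF cg])
    show "(\<lambda>x. h x * ?\<phi> n x) \<in> borel_measurable lborel" for n by measurable
    show "AE x in lborel. cmod (h x * ?\<phi> n x) \<le> cmod (h x)" for n
      by (intro AE_I2) (simp add: norm_mult cmod_gauss mult_left_le)
    show "AE x in lborel. (\<lambda>n. h x * ?\<phi> n x) \<longlonglongrightarrow> h x * iexp (x * x0)"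
    proof (intro AE_I2 tendsto_mult tendsto_const)
      fix x :: real
      have "(\<lambda>n. - (1 / (2 * (real (Suc n))\<^sup>2)) * x\<^sup>2) \<longlonglongrightarrow> 0" by real_asymp
      then have "(\<lambda>n. exp (of_real (- (1 / (2 * (real (Suc n))\<^sup>2)) * x\<^sup>2) + \<i> * of_real x0 * of_real x)) \<longlonglongrightarrow> exp (of_real 0 + \<i> * of_real x0 * of_real x)"
        by (intro tendsto_intros)
      then show "(\<lambda>n. ?\<phi> n x) \<longlonglongrightarrow> iexp (x * x0)" by (simp add: gauss_def mult_ac del: of_nat_Suc)
    qed
  qed (use h in auto)
  ultimately show ?thesis unfolding eq using LIMSEQ_unique by blast
qed

section \<open>Averages over the standard simplex\<close>

text \<open>
  The region and the map from which \<open>simplex_measure\<close> is built.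
\<close>

definition simplex_dom :: "nat \<Rightarrow> (nat \<Rightarrow> real) set"
  where "simplex_dom n = {s. (\<forall>j\<in>{1..n}. 0 \<le> s j) \<and> sum s {1..n} \<le> 1}"

definition simplex_map :: "nat \<Rightarrow> (nat \<Rightarrow> real) \<Rightarrow> nat \<Rightarrow> real"
  where "simplex_map n s = (\<lambda>j\<in>{0..n}. if j = 0 then 1 - sum s {1..n} else s j)"

lemma simplex_measure_alt:
  "simplex_measure n = distr (restrict_space (Pi\<^sub>M {1..n} (\<lambda>_. lborel)) (simplex_dom n))
     (Pi\<^sub>M {0..n} (\<lambda>_. borel)) (simplex_map n)"
  unfolding simplex_measure_def simplex_dom_def simplex_map_def ..

lemma measurable_simplex_map [measurable]:
  "simplex_map n \<in> Pi\<^sub>M {1..n} (\<lambda>_. lborel) \<rightarrow>\<^sub>M Pi\<^sub>M {0..n} (\<lambda>_. borel)"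
  unfolding simplex_map_def
proof (rule measurable_restrict)
  fix j assume "j \<in> {0..n}"
  then show "(\<lambda>s. if j = 0 then 1 - sum s {1..n} else s j) \<in> Pi\<^sub>M {1..n} (\<lambda>_. lborel) \<rightarrow>\<^sub>M borel"
    by (cases "j = 0") auto
qed

lemma measurable_simplex_map' [measurable]:
  "simplex_map n \<in> restrict_space (Pi\<^sub>M {1..n} (\<lambda>_. lborel)) (simplex_dom n) \<rightarrow>\<^sub>M Pi\<^sub>M {0..n} (\<lambda>_. borel)"
  by (rule measurable_restrict_space1[OF measurable_simplex_map])

lemma simplex_dom_sets [measurable]:
  "simplex_dom n \<inter> space (Pi\<^sub>M {1..n} (\<lambda>_. lborel)) \<in> sets (Pi\<^sub>M {1..n} (\<lambda>_. lborel))"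
proof -
  have "simplex_dom n \<inter> space (Pi\<^sub>M {1..n} (\<lambda>_. lborel))
      = Pi\<^sub>E {1..n} (\<lambda>_. {0..}) \<inter> (\<lambda>x. sum x {1..n}) -` {..1} \<inter> space (Pi\<^sub>M {1..n} (\<lambda>_. lborel))"
    by (auto simp: space_PiM simplex_dom_def)
  also have "\<dots> \<in> sets (Pi\<^sub>M {1..n} (\<lambda>_. lborel))" by measurable
  finally show ?thesis .
qed

lemma sets_simplex_measure [measurable_cong]:
  "sets (simplex_measure n) = sets (Pi\<^sub>M {0..n} (\<lambda>_. borel))"
  by (simp add: simplex_measure_alt)

lemma finite_simplex_measure: "finite_measure (simplex_measure n)"
  by (rule finite_measureI) (simp add: emeasure_simplex_measure)

lemma measure_simplex_measure: "measure (simplex_measure n) (space (simplex_measure n)) = 1 / fact n"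
  by (simp add: measure_def emeasure_simplex_measure)

lemma AE_simplex_measure:
  "AE s in simplex_measure n. (\<forall>j\<in>{..n}. 0 \<le> s j) \<and> (\<Sum>j\<le>n. s j) = 1"
proof -
  have "{s \<in> space (Pi\<^sub>M {0..n} (\<lambda>_. borel :: real measure)). (\<forall>j\<in>{..n}. 0 \<le> s j) \<and> (\<Sum>j\<le>n. s j) = 1}
      \<in> sets (Pi\<^sub>M {0..n} (\<lambda>_. borel))"
    unfolding atMost_atLeast0 by measurable
  moreover have "(\<forall>j\<in>{..n}. 0 \<le> simplex_map n s j) \<and> (\<Sum>j\<le>n. simplex_map n s j) = 1"
    if "s \<in> simplex_dom n" for s
  proof -
    have "(\<Sum>j\<le>n. simplex_map n s j) = simplex_map n s 0 + (\<Sum>j=1..n. simplex_map n s j)"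
      by (simp add: atMost_atLeast0 sum.atLeast_Suc_atMost)
    also have "\<dots> = 1" by (simp add: simplex_map_def)
    finally show ?thesis using that by (auto simp: simplex_map_def simplex_dom_def)
  qed
  ultimately show ?thesis
    unfolding simplex_measure_alt
    by (subst AE_distr_iff[OF measurable_simplex_map']) (auto simp: space_restrict_space intro!: AE_I2)
qed

lemma nn_integral_simplex_measure:
  assumes F: "F \<in> borel_measurable (Pi\<^sub>M {0..n} (\<lambda>_. borel))"
  shows "(\<integral>\<^sup>+s. F s \<partial>simplex_measure n)
    = (\<integral>\<^sup>+s. F (simplex_map n s) * indicator (simplex_dom n) s \<partial>Pi\<^sub>M {1..n} (\<lambda>_. lborel))"
proof -
  have "(\<integral>\<^sup>+s. F s \<partial>simplex_measure n)
      = (\<integral>\<^sup>+s. F (simplex_map n s) \<partial>restrict_space (Pi\<^sub>M {1..n} (\<lambda>_. lborel)) (simplex_dom n))"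
    unfolding simplex_measure_alt by (rule nn_integral_distr[OF measurable_simplex_map']) (simp only: F measurable_distr_eq1)
  also have "\<dots> = (\<integral>\<^sup>+s. F (simplex_map n s) * indicator (simplex_dom n) s \<partial>Pi\<^sub>M {1..n} (\<lambda>_. lborel))"
    by (rule nn_integral_restrict_space[OF simplex_dom_sets])
  finally show ?thesis .
qed

lemma lborel_scale_emeasure:
  assumes r: "r > 0" and A: "A \<in> sets borel"
  shows "emeasure lborel A = ennreal r * emeasure lborel ((\<lambda>x::real. r * x) -` A)"
proof -
  have [measurable]: "(\<lambda>x::real. r * x) -` A \<in> sets borel"
    using measurable_sets[of "\<lambda>x::real. r * x" borel borel A] A by simp
  have "emeasure lborel A = (\<integral>\<^sup>+x. indicator A x \<partial>lborel)" using A by simp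
  also have "\<dots> = ennreal \<bar>r\<bar> * (\<integral>\<^sup>+x. indicator A (0 + r * x) \<partial>lborel)"
    using r A by (intro nn_integral_real_affine) auto
  also have "(\<integral>\<^sup>+x. indicator A (0 + r * x) \<partial>lborel) = (\<integral>\<^sup>+x. indicator ((\<lambda>x. r * x) -` A) x \<partial>lborel)"
    by (intro nn_integral_cong) (auto simp: indicator_def)
  also have "\<dots> = emeasure lborel ((\<lambda>x::real. r * x) -` A)" by simp
  finally show ?thesis using r by simp
qed

lemma nn_integral_PiM_scale:
  assumes r: "r > 0" and I: "finite I" and F: "F \<in> borel_measurable (Pi\<^sub>M I (\<lambda>_. lborel :: real measure))"
  shows "(\<integral>\<^sup>+s. F s \<partial>Pi\<^sub>M I (\<lambda>_. lborel)) = ennreal (r ^ card I) * (\<integral>\<^sup>+s. F (\<lambda>i\<in>I. r * s i) \<partial>Pi\<^sub>M I (\<lambda>_. lborel))"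
proof -
  interpret product_sigma_finite "\<lambda>_. lborel :: real measure" by standard
  let ?M = "Pi\<^sub>M I (\<lambda>_. lborel :: real measure)"
  let ?T = "\<lambda>s. \<lambda>i\<in>I. r * s i"
  have T [measurable]: "?T \<in> ?M \<rightarrow>\<^sub>M ?M" by (intro measurable_restrict) auto
  have "scale_measure (ennreal (r ^ card I)) (distr ?M ?M ?T) = ?M"
  proof (rule PiM_eqI[OF I])
    fix A :: "'a \<Rightarrow> real set" assume A: "\<And>i. i \<in> I \<Longrightarrow> A i \<in> sets lborel"
    have P: "Pi\<^sub>E I A \<in> sets ?M" using I A by (intro sets_PiM_I_finite) auto
    have vA: "(\<lambda>x. r * x) -` A i \<in> sets lborel" if "i \<in> I" for i
      using measurable_sets[of "\<lambda>x::real. r * x" borel borel "A i"] A[OF that] by simp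
    have "?T -` Pi\<^sub>E I A \<inter> space ?M = Pi\<^sub>E I (\<lambda>i. (\<lambda>x. r * x) -` A i)"
      by (auto simp: space_PiM PiE_iff)
    then have "emeasure (distr ?M ?M ?T) (Pi\<^sub>E I A) = emeasure ?M (Pi\<^sub>E I (\<lambda>i. (\<lambda>x. r * x) -` A i))"
      using emeasure_distr[OF T P] by simp
    also have "\<dots> = (\<Prod>i\<in>I. emeasure lborel ((\<lambda>x. r * x) -` A i))"
      using I vA by (intro emeasure_PiM) auto
    finally have "emeasure (scale_measure (ennreal (r ^ card I)) (distr ?M ?M ?T)) (Pi\<^sub>E I A)
        = ennreal (r ^ card I) * (\<Prod>i\<in>I. emeasure lborel ((\<lambda>x. r * x) -` A i))" by simp
    also have "\<dots> = (\<Prod>i\<in>I. ennreal r * emeasure lborel ((\<lambda>x. r * x) -` A i))"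
      using r by (simp add: prod.distrib ennreal_power)
    also have "\<dots> = (\<Prod>i\<in>I. emeasure lborel (A i))"
      using A by (intro prod.cong refl) (simp add: lborel_scale_emeasure[OF r])
    finally show "emeasure (scale_measure (ennreal (r ^ card I)) (distr ?M ?M ?T)) (Pi\<^sub>E I A)
        = (\<Prod>i\<in>I. emeasure lborel (A i))" .
  qed simp
  then have "(\<integral>\<^sup>+s. F s \<partial>?M) = (\<integral>\<^sup>+s. F s \<partial>scale_measure (ennreal (r ^ card I)) (distr ?M ?M ?T))" by simp
  also have "\<dots> = ennreal (r ^ card I) * (\<integral>\<^sup>+s. F s \<partial>distr ?M ?M ?T)"
    using F by (intro nn_integral_scale_measure) simp
  also have "(\<integral>\<^sup>+s. F s \<partial>distr ?M ?M ?T) = (\<integral>\<^sup>+s. F (?T s) \<partial>?M)"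
    by (rule nn_integral_distr[OF T]) (simp only: F measurable_distr_eq1)
  finally show ?thesis .
qed

text \<open>
  The weight that polar coordinates on the simplex put on the distance \<open>r\<close> from a vertex.
\<close>

definition radial :: "nat \<Rightarrow> real measure"
  where "radial n = density lborel (\<lambda>r. ennreal (r ^ n) * indicator {0..1} r)"

lemma sets_radial [measurable_cong, simp]: "sets (radial n) = sets borel"
  by (simp add: radial_def)

lemma emeasure_distr_nn_integral:
  assumes T: "T \<in> borel_measurable M" and X: "X \<in> sets borel"
  shows "emeasure (distr M borel T) X = (\<integral>\<^sup>+s. indicator X (T s) \<partial>M)"
proof -
  have "emeasure (distr M borel T) X = (\<integral>\<^sup>+z. indicator X z \<partial>distr M borel T)" using X by simp
  also have "\<dots> = (\<integral>\<^sup>+s. indicator X (T s) \<partial>M)" by (rule nn_integral_distr[OF T]) (use X in measurable)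
  finally show ?thesis .
qed

lemma simplex_form_extend:
  assumes s: "s \<in> space (Pi\<^sub>M {1..n} (\<lambda>_. lborel :: real measure))" and r: "r > 0"
  shows "(\<Sum>j\<le>n. simplex_map (Suc n) ((\<lambda>i\<in>{1..n}. r * s i)(Suc n := 1 - r)) j * y j)
    = r * (\<Sum>j\<le>n. simplex_map n s j * y j)"
    and "indicator (simplex_dom (Suc n)) ((\<lambda>i\<in>{1..n}. r * s i)(Suc n := 1 - r))
      = (indicator {0..1} r * indicator (simplex_dom n) s :: ennreal)"
proof -
  let ?s = "(\<lambda>i\<in>{1..n}. r * s i)(Suc n := 1 - r)"
  have e: "{1..Suc n} = insert (Suc n) {1..n}" by auto
  have sum: "sum ?s {1..Suc n} = 1 - r + r * sum s {1..n}"
    unfolding e by (simp add: sum_distrib_left)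
  have "(\<Sum>j\<le>n. simplex_map (Suc n) ?s j * y j) = simplex_map (Suc n) ?s 0 * y 0 + (\<Sum>j=1..n. simplex_map (Suc n) ?s j * y j)"
    by (simp add: atMost_atLeast0 sum.atLeast_Suc_atMost)
  also have "\<dots> = r * (simplex_map n s 0 * y 0 + (\<Sum>j=1..n. simplex_map n s j * y j))"
    using sum by (simp add: simplex_map_def sum_distrib_left algebra_simps)
  also have "\<dots> = r * (\<Sum>j\<le>n. simplex_map n s j * y j)"
    by (simp add: atMost_atLeast0 sum.atLeast_Suc_atMost)
  finally show "(\<Sum>j\<le>n. simplex_map (Suc n) ?s j * y j) = r * (\<Sum>j\<le>n. simplex_map n s j * y j)" .
  have "sum ?s {1..Suc n} \<le> 1 \<longleftrightarrow> r * sum s {1..n} \<le> r * 1" unfolding sum by simp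
  also have "\<dots> \<longleftrightarrow> sum s {1..n} \<le> 1" using r by (subst mult_le_cancel_left_pos) auto
  finally have "?s \<in> simplex_dom (Suc n) \<longleftrightarrow> r \<le> 1 \<and> s \<in> simplex_dom n"
    using r unfolding simplex_dom_def e by (auto simp: zero_le_mult_iff)
  then show "indicator (simplex_dom (Suc n)) ?s = (indicator {0..1} r * indicator (simplex_dom n) s :: ennreal)"
    using r by (auto simp: indicator_def)
qed

text \<open>
  Polar coordinates around the vertex of index \<open>n + 1\<close>: the slice on which \<open>s\<^bsub>n+1\<^esub> = 1 - r\<close> is a simplex of one
  dimension less, scaled by \<open>r\<close>. Only linear forms that vanish at this vertex occur, so it is enough to
  compare the distributions of such a form.
\<close>

lemma simplex_polar:
  fixes y :: "nat \<Rightarrow> real"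
  shows "distr (simplex_measure (Suc n)) borel (\<lambda>s. \<Sum>j\<le>n. s j * y j)
    = distr (radial n \<Otimes>\<^sub>M simplex_measure n) borel (\<lambda>(r, s). r * (\<Sum>j\<le>n. s j * y j))"
    (is "?L = ?R")
proof (rule measure_eqI)
  interpret P: product_sigma_finite "\<lambda>_. lborel :: real measure" by standard
  interpret S: finite_measure "simplex_measure n" by (rule finite_simplex_measure)
  have m1: "(\<lambda>s. \<Sum>j\<le>n. s j * y j) \<in> borel_measurable (Pi\<^sub>M {0..m} (\<lambda>_. borel))" if "n \<le> m" for m
    using that by (intro borel_measurable_sum borel_measurable_times measurable_component_singleton) auto
  note [measurable] = m1[OF order_refl] m1[OF le_SucI[OF order_refl]]
  have ms: "(\<lambda>s. \<Sum>j\<le>n. s j * y j) \<in> borel_measurable (simplex_measure m)" if "n \<le> m" for m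
    using m1[OF that] by (simp cong: measurable_cong_sets add: sets_simplex_measure)
  have mp [measurable]: "(\<lambda>(r, s). r * (\<Sum>j\<le>n. s j * y j)) \<in> borel_measurable (radial n \<Otimes>\<^sub>M simplex_measure n)"
    using ms[OF order_refl] by measurable
  fix X assume "X \<in> sets ?L"
  then have X [measurable]: "X \<in> sets borel" by simp
  let ?H = "indicator X :: real \<Rightarrow> ennreal"
  let ?e = "{1..Suc n}"
  have e: "?e = insert (Suc n) {1..n}" by auto
  let ?K = "\<lambda>s. ?H (\<Sum>j\<le>n. simplex_map (Suc n) s j * y j) * indicator (simplex_dom (Suc n)) s"
  have ind: "(\<lambda>s. indicator (simplex_dom m) s :: ennreal) \<in> borel_measurable (Pi\<^sub>M {1..m} (\<lambda>_. lborel))" for m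
    using simplex_dom_sets[of m] by (simp add: borel_measurable_indicator_iff)
  have mK: "?K \<in> borel_measurable (Pi\<^sub>M ?e (\<lambda>_. lborel))"
    by (intro borel_measurable_times_ennreal ind) measurable
  have mK' [measurable]: "?K \<in> borel_measurable (Pi\<^sub>M (insert (Suc n) {1..n}) (\<lambda>_. lborel))"
    using mK unfolding e .
  have mKv: "(\<lambda>s. ?K (s(Suc n := v))) \<in> borel_measurable (Pi\<^sub>M {1..n} (\<lambda>_. lborel))" for v
    by (rule measurable_compose[OF _ mK'], rule measurable_fun_upd[where J = "{1..n}"]) auto
  have mKj: "(\<lambda>v. \<integral>\<^sup>+s. ?K (s(Suc n := v)) \<partial>Pi\<^sub>M {1..n} (\<lambda>_. lborel)) \<in> borel_measurable borel"
  proof -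
    have "(\<lambda>(v, s). ?K (s(Suc n := v))) \<in> borel_measurable (lborel \<Otimes>\<^sub>M Pi\<^sub>M {1..n} (\<lambda>_. lborel))"
      unfolding case_prod_beta'
      by (rule measurable_compose[OF _ mK'], rule measurable_fun_upd[where J = "{1..n}"]) auto
    from sigma_finite_measure.borel_measurable_nn_integral_fst[OF P.sigma_finite this] show ?thesis by simp
  qed
  have "emeasure ?L X = (\<integral>\<^sup>+s. ?H (\<Sum>j\<le>n. s j * y j) \<partial>simplex_measure (Suc n))"
    by (rule emeasure_distr_nn_integral[OF ms X]) simp
  also have "\<dots> = (\<integral>\<^sup>+s. ?K s \<partial>Pi\<^sub>M ?e (\<lambda>_. lborel))"
    by (rule nn_integral_simplex_measure) measurable
  also have "\<dots> = (\<integral>\<^sup>+v. \<integral>\<^sup>+s. ?K (s(Suc n := v)) \<partial>Pi\<^sub>M {1..n} (\<lambda>_. lborel) \<partial>lborel)"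
    unfolding e by (rule P.product_nn_integral_insert_rev[OF _ _ mK']) simp_all
  also have "\<dots> = (\<integral>\<^sup>+r. \<integral>\<^sup>+s. ?K (s(Suc n := 1 + (-1) * r)) \<partial>Pi\<^sub>M {1..n} (\<lambda>_. lborel) \<partial>lborel)"
    by (subst nn_integral_real_affine[OF mKj, of "-1" 1]) auto
  also have "\<dots> = (\<integral>\<^sup>+r. (ennreal (r ^ n) * indicator {0..1} r) *
       (\<integral>\<^sup>+s. ?H (r * (\<Sum>j\<le>n. s j * y j)) \<partial>simplex_measure n) \<partial>lborel)"
  proof (rule nn_integral_cong_AE)
    have "AE r in lborel. r \<noteq> (0::real)" by (rule AE_lborel_singleton)
    then show "AE r in lborel. (\<integral>\<^sup>+s. ?K (s(Suc n := 1 + (-1) * r)) \<partial>Pi\<^sub>M {1..n} (\<lambda>_. lborel)) =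
        (ennreal (r ^ n) * indicator {0..1} r) * (\<integral>\<^sup>+s. ?H (r * (\<Sum>j\<le>n. s j * y j)) \<partial>simplex_measure n)"
    proof eventually_elim
      case (elim r)
      show ?case
      proof (cases "r > 0")
        case True
        have "(\<integral>\<^sup>+s. ?K (s(Suc n := 1 + (-1) * r)) \<partial>Pi\<^sub>M {1..n} (\<lambda>_. lborel)) =
          ennreal (r ^ card {1..n}) * (\<integral>\<^sup>+s. ?K ((\<lambda>i\<in>{1..n}. r * s i)(Suc n := 1 + (-1) * r)) \<partial>Pi\<^sub>M {1..n} (\<lambda>_. lborel))"
          by (rule nn_integral_PiM_scale[OF True _ mKv]) simp
        also have "(\<integral>\<^sup>+s. ?K ((\<lambda>i\<in>{1..n}. r * s i)(Suc n := 1 + (-1) * r)) \<partial>Pi\<^sub>M {1..n} (\<lambda>_. lborel))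
          = (\<integral>\<^sup>+s. indicator {0..1} r * (?H (r * (\<Sum>j\<le>n. simplex_map n s j * y j)) * indicator (simplex_dom n) s) \<partial>Pi\<^sub>M {1..n} (\<lambda>_. lborel))"
        proof (rule nn_integral_cong)
          fix s assume s: "s \<in> space (Pi\<^sub>M {1..n} (\<lambda>_. lborel :: real measure))"
          have v: "1 + (-1) * r = 1 - r" by simp
          show "?K ((\<lambda>i\<in>{1..n}. r * s i)(Suc n := 1 + (-1) * r))
            = indicator {0..1} r * (?H (r * (\<Sum>j\<le>n. simplex_map n s j * y j)) * indicator (simplex_dom n) s)"
            unfolding v simplex_form_extend[OF s True] by (simp only: mult_ac)
        qed
        also have "\<dots> = indicator {0..1} r * (\<integral>\<^sup>+s. ?H (r * (\<Sum>j\<le>n. simplex_map n s j * y j)) * indicator (simplex_dom n) s \<partial>Pi\<^sub>M {1..n} (\<lambda>_. lborel))"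
          by (intro nn_integral_cmult borel_measurable_times_ennreal ind) measurable
        also have "(\<integral>\<^sup>+s. ?H (r * (\<Sum>j\<le>n. simplex_map n s j * y j)) * indicator (simplex_dom n) s \<partial>Pi\<^sub>M {1..n} (\<lambda>_. lborel))
          = (\<integral>\<^sup>+s. ?H (r * (\<Sum>j\<le>n. s j * y j)) \<partial>simplex_measure n)"
          by (rule nn_integral_simplex_measure[symmetric]) measurable
        finally show ?thesis by (simp only: card_atLeastAtMost diff_Suc_1 mult_ac)
      next
        case False
        then have r: "r < 0" using elim by simp
        have "s(Suc n := 1 - r) \<notin> simplex_dom (Suc n)" for s
        proof
          assume "s(Suc n := 1 - r) \<in> simplex_dom (Suc n)"
          then have "\<forall>j\<in>{1..n}. 0 \<le> s j" "1 - r + sum s {1..n} \<le> 1"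
            unfolding simplex_dom_def e by (auto simp: Ball_def split: if_splits)
          moreover from this have "sum s {1..n} \<ge> 0" by (intro sum_nonneg) auto
          ultimately show False using r by simp
        qed
        then show ?thesis using r by (simp add: indicator_def)
      qed
    qed
  qed
  also have "\<dots> = (\<integral>\<^sup>+r. \<integral>\<^sup>+s. ?H (r * (\<Sum>j\<le>n. s j * y j)) \<partial>simplex_measure n \<partial>radial n)"
  proof -
    have "(\<lambda>r. \<integral>\<^sup>+s. ?H (r * (\<Sum>j\<le>n. s j * y j)) \<partial>simplex_measure n) \<in> borel_measurable lborel"
      using ms[OF order_refl] by measurable
    then show ?thesis unfolding radial_def by (subst nn_integral_density) auto
  qed
  also have "\<dots> = (\<integral>\<^sup>+p. ?H (case p of (r, s) \<Rightarrow> r * (\<Sum>j\<le>n. s j * y j)) \<partial>(radial n \<Otimes>\<^sub>M simplex_measure n))"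
    using ms[OF order_refl] by (subst S.nn_integral_fst[symmetric]) auto
  also have "\<dots> = emeasure ?R X"
    by (rule emeasure_distr_nn_integral[OF mp X, symmetric])
  finally show "emeasure ?L X = emeasure ?R X" .
qed simp

lemma measurable_simplex_form:
  "n \<le> m \<Longrightarrow> (\<lambda>s. \<Sum>j\<le>n. s j * y j) \<in> borel_measurable (simplex_measure m)"
  unfolding measurable_cong_sets[OF sets_simplex_measure refl]
  by (intro borel_measurable_sum borel_measurable_times measurable_component_singleton) auto

lemma integral_radial_FTC:
  fixes h h' :: "real \<Rightarrow> complex"
  assumes der: "\<And>x. (h has_vector_derivative h' x) (at x)" and h': "continuous_on UNIV h'"
  shows "(\<integral>r. of_nat (Suc n) * h (c + r * z) + of_real (r * z) * h' (c + r * z) \<partial>radial n) = h (c + z)"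
proof -
  let ?E = "\<lambda>r. of_nat (Suc n) * h (c + r * z) + of_real (r * z) * h' (c + r * z)"
  have h: "continuous_on UNIV h"
    using der by (intro continuous_at_imp_continuous_on ballI) (auto intro: has_vector_derivative_continuous)
  have hc: "continuous_on UNIV (\<lambda>r. h (c + r * z))" "continuous_on UNIV (\<lambda>r. h' (c + r * z))"
    by (auto intro!: continuous_on_compose2[OF h] continuous_on_compose2[OF h'] continuous_intros)
  have E: "continuous_on UNIV ?E" by (intro continuous_intros hc)
  have [measurable]: "?E \<in> borel_measurable borel" by (rule borel_measurable_continuous_onI[OF E])
  have eq: "radial n = density lborel (\<lambda>r. ennreal (r ^ n * indicator {0..1} r))"
    unfolding radial_def by (intro density_cong) (auto simp: indicator_def)
  have "(\<integral>r. ?E r \<partial>radial n) = (\<integral>r. (r ^ n * indicator {0..1} r) *\<^sub>R ?E r \<partial>lborel)"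
    unfolding eq
  proof (rule integral_density)
    show "?E \<in> borel_measurable lborel" using \<open>?E \<in> borel_measurable borel\<close> by (simp only: measurable_lborel2)
  qed (auto simp: indicator_def)
  also have "\<dots> = (LBINT r. indicator {0..1} r *\<^sub>R (of_real (r ^ n) * ?E r))"
    by (intro Bochner_Integration.integral_cong) (auto simp: indicator_def scaleR_conv_of_real)
  also have "\<dots> = of_real (1 ^ Suc n) * h (c + 1 * z) - of_real (0 ^ Suc n) * h (c + 0 * z)"
  proof (rule integral_FTC_Icc)
    fix r :: real
    have "((\<lambda>r. h (c + r * z)) has_vector_derivative z *\<^sub>R h' (c + r * z)) (at r)"
    proof -
      have "((\<lambda>r. c + r * z) has_vector_derivative z) (at r)" by (auto intro!: derivative_eq_intros)
      from vector_diff_chain_at[OF this der] show ?thesis by (simp add: o_def)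
    qed
    moreover have "((\<lambda>r. complex_of_real (r ^ Suc n)) has_vector_derivative of_real (real (Suc n) * r ^ n)) (at r)"
    proof -
      have "((\<lambda>r. r ^ Suc n) has_real_derivative real (Suc n) * r ^ n) (at r)"
        using DERIV_pow[of "Suc n" r UNIV] by simp
      then have "((\<lambda>r. r ^ Suc n) has_vector_derivative real (Suc n) * r ^ n) (at r)"
        by (simp add: has_real_derivative_iff_has_vector_derivative)
      from bounded_linear.has_vector_derivative[OF bounded_linear_of_real this] show ?thesis .
    qed
    ultimately have "((\<lambda>r. complex_of_real (r ^ Suc n) * h (c + r * z)) has_vector_derivative
       of_real (r ^ Suc n) * (z *\<^sub>R h' (c + r * z)) + of_real (real (Suc n) * r ^ n) * h (c + r * z)) (at r)"
      by (intro has_vector_derivative_mult)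
    moreover have "of_real (r ^ Suc n) * (z *\<^sub>R h' (c + r * z)) + of_real (real (Suc n) * r ^ n) * h (c + r * z)
        = of_real (r ^ n) * ?E r"
      by (simp add: scaleR_conv_of_real algebra_simps)
    ultimately have "((\<lambda>r. complex_of_real (r ^ Suc n) * h (c + r * z)) has_vector_derivative of_real (r ^ n) * ?E r) (at r)"
      by (simp only:)
    then show "((\<lambda>r. complex_of_real (r ^ Suc n) * h (c + r * z)) has_vector_derivative of_real (r ^ n) * ?E r) (at r within {0..1})"
      by (rule has_vector_derivative_at_within)
  next
    show "continuous_on {0..1} (\<lambda>r. of_real (r ^ n) * ?E r)"
      by (intro continuous_intros continuous_on_subset[OF E]) auto
  qed simp
  finally show ?thesis by simp
qed

lemma finite_radial: "finite_measure (radial n)"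
proof (rule finite_measureI)
  have "emeasure (radial n) (space (radial n)) = (\<integral>\<^sup>+r. ennreal (r ^ n) * indicator {0..1} r \<partial>lborel)"
    unfolding radial_def by (subst emeasure_density) auto
  also have "\<dots> \<le> (\<integral>\<^sup>+r. indicator {0..1::real} r \<partial>lborel)"
    by (intro nn_integral_mono) (auto simp: indicator_def ennreal_leI power_le_one intro: order_trans[OF ennreal_leI[of _ 1]])
  also have "\<dots> = 1" by simp
  finally show "emeasure (radial n) (space (radial n)) \<noteq> \<infinity>" by (auto simp: top_unique)
qed

lemma AE_radial: "AE r in radial n. 0 \<le> r \<and> r \<le> 1"
  unfolding radial_def by (subst AE_density) (auto simp: indicator_def)

text \<open>
  With the vertex \<open>c = x\<^bsub>n+1\<^esub>\<close> as origin, the integrand is a function \<open>E\<close> of a linear form \<open>z\<close>, and along each ray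
  \<open>r\<^sup>n E(r z)\<close> is the derivative of \<open>r\<^bsup>n+1\<^esup> h(c + r z)\<close>. Only the opposite face contributes a boundary term.
\<close>

lemma simplex_average_by_parts:
  fixes h h' :: "real \<Rightarrow> complex"
  assumes der: "\<And>x. (h has_vector_derivative h' x) (at x)" and h': "continuous_on UNIV h'"
    and bd: "\<And>x. cmod (h x) \<le> K" "\<And>x. cmod (h' x) \<le> K"
  shows "(\<integral>s. of_nat (Suc n) * h (\<Sum>j\<le>Suc n. s j * x j)
      + of_real ((\<Sum>j\<le>Suc n. s j * x j) - x (Suc n)) * h' (\<Sum>j\<le>Suc n. s j * x j) \<partial>simplex_measure (Suc n))
    = (\<integral>s. h (\<Sum>j\<le>n. s j * x j) \<partial>simplex_measure n)"
proof -
  define c where "c = x (Suc n)"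
  define y where "y j = x j - c" for j
  define Y where "Y = (\<Sum>j\<le>n. \<bar>y j\<bar>)"
  \<comment> \<open>Clipping the factor \<open>z\<close> makes \<open>E\<close> bounded and changes nothing on the simplex.\<close>
  define cl where "cl z = max (- Y) (min Y z)" for z
  have Y0: "Y \<ge> 0" unfolding Y_def by (intro sum_nonneg) auto
  have clb: "\<bar>cl z\<bar> \<le> Y" for z using Y0 by (auto simp: cl_def)
  have cl_id: "cl z = z" if "\<bar>z\<bar> \<le> Y" for z using that by (auto simp: cl_def)
  have h: "continuous_on UNIV h"
    using der by (intro continuous_at_imp_continuous_on ballI) (auto intro: has_vector_derivative_continuous)
  define E where "E z = of_nat (Suc n) * h (c + z) + of_real (cl z) * h' (c + z)" for z
  have contE: "continuous_on UNIV E"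
    unfolding E_def cl_def
    by (intro continuous_intros continuous_on_compose2[OF h] continuous_on_compose2[OF h']) auto
  have [measurable]: "E \<in> borel_measurable borel" by (rule borel_measurable_continuous_onI[OF contE])
  have K: "K \<ge> 0" using bd(1)[of 0] norm_ge_zero order_trans by blast
  have Eb: "cmod (E z) \<le> real (Suc n) * K + Y * K" for z
  proof -
    have "cmod (E z) \<le> cmod (of_nat (Suc n) * h (c + z)) + cmod (of_real (cl z) * h' (c + z))"
      unfolding E_def by (rule norm_triangle_ineq)
    also have "\<dots> \<le> real (Suc n) * K + Y * K"
      unfolding norm_mult norm_of_nat norm_of_real by (intro add_mono mult_mono bd clb) (auto simp: Y0)
    finally show ?thesis .
  qed
  interpret S: finite_measure "simplex_measure n" by (rule finite_simplex_measure)
  interpret R: finite_measure "radial n" by (rule finite_radial)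
  interpret SR: pair_sigma_finite "radial n" "simplex_measure n" ..
  interpret RS: finite_measure "radial n \<Otimes>\<^sub>M simplex_measure n"
    by (rule finite_measure_pair_measure) (rule S.finite_measure_axioms R.finite_measure_axioms)+
  note [measurable] = measurable_simplex_form[OF order_refl] measurable_simplex_form[OF le_SucI[OF order_refl]]
  have mp [measurable]: "(\<lambda>(r, s). r * (\<Sum>j\<le>n. s j * y j)) \<in> borel_measurable (radial n \<Otimes>\<^sub>M simplex_measure n)"
    by measurable
  have bnd: "\<bar>\<Sum>j\<le>n. s j * y j\<bar> \<le> Y" if s: "\<forall>j\<le>n. 0 \<le> s j \<and> s j \<le> 1" for s
  proof -
    have "\<bar>\<Sum>j\<le>n. s j * y j\<bar> \<le> (\<Sum>j\<le>n. \<bar>s j * y j\<bar>)" by (rule sum_abs)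
    also have "\<dots> \<le> (\<Sum>j\<le>n. 1 * \<bar>y j\<bar>)"
      unfolding abs_mult by (intro sum_mono mult_right_mono) (use s in auto)
    finally show ?thesis by (simp add: Y_def)
  qed
  have le1: "s j \<le> 1" if "\<forall>j\<in>{..m}. 0 \<le> s j" "(\<Sum>j\<le>m. s j) = 1" "j \<le> m" for s :: "nat \<Rightarrow> real" and j m
    using member_le_sum[of j "{..m}" s] that by auto
  have "(\<integral>s. of_nat (Suc n) * h (\<Sum>j\<le>Suc n. s j * x j)
      + of_real ((\<Sum>j\<le>Suc n. s j * x j) - x (Suc n)) * h' (\<Sum>j\<le>Suc n. s j * x j) \<partial>simplex_measure (Suc n))
    = (\<integral>s. E (\<Sum>j\<le>n. s j * y j) \<partial>simplex_measure (Suc n))"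
  proof (rule integral_cong_AE)
    have hm: "h \<in> borel_measurable borel" "h' \<in> borel_measurable borel"
      by (intro borel_measurable_continuous_onI h h')+
    note [measurable] = hm measurable_simplex_form[of "Suc n" "Suc n" x, OF order_refl]
    show "(\<lambda>s. of_nat (Suc n) * h (\<Sum>j\<le>Suc n. s j * x j)
      + of_real ((\<Sum>j\<le>Suc n. s j * x j) - x (Suc n)) * h' (\<Sum>j\<le>Suc n. s j * x j)) \<in> borel_measurable (simplex_measure (Suc n))"
      by measurable
    show "(\<lambda>s. E (\<Sum>j\<le>n. s j * y j)) \<in> borel_measurable (simplex_measure (Suc n))" by measurable
    show "AE s in simplex_measure (Suc n). of_nat (Suc n) * h (\<Sum>j\<le>Suc n. s j * x j)
      + of_real ((\<Sum>j\<le>Suc n. s j * x j) - x (Suc n)) * h' (\<Sum>j\<le>Suc n. s j * x j) = E (\<Sum>j\<le>n. s j * y j)"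
      using AE_simplex_measure
    proof eventually_elim
      case (elim s)
      let ?z = "\<Sum>j\<le>n. s j * y j"
      have "?z = (\<Sum>j\<le>n. s j * x j) - c * (\<Sum>j\<le>n. s j)"
        by (simp add: y_def right_diff_distrib sum_subtractf sum_distrib_left mult.commute)
      also have "(\<Sum>j\<le>n. s j) = 1 - s (Suc n)" using elim by simp
      finally have p: "(\<Sum>j\<le>Suc n. s j * x j) = c + ?z" by (simp add: c_def algebra_simps)
      have "\<bar>?z\<bar> \<le> Y" using elim le1[of "Suc n" s] by (intro bnd) auto
      then show ?case unfolding p E_def by (simp add: cl_id c_def)
    qed
  qed
  also have "\<dots> = (\<integral>z. E z \<partial>distr (simplex_measure (Suc n)) borel (\<lambda>s. \<Sum>j\<le>n. s j * y j))"
    by (rule integral_distr[symmetric]) measurable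
  also have "\<dots> = (\<integral>p. E (case p of (r, s) \<Rightarrow> r * (\<Sum>j\<le>n. s j * y j)) \<partial>(radial n \<Otimes>\<^sub>M simplex_measure n))"
    unfolding simplex_polar by (rule integral_distr) measurable
  also have "\<dots> = (\<integral>s. \<integral>r. E (r * (\<Sum>j\<le>n. s j * y j)) \<partial>radial n \<partial>simplex_measure n)"
  proof -
    have "integrable (radial n \<Otimes>\<^sub>M simplex_measure n) (\<lambda>(r, s). E (r * (\<Sum>j\<le>n. s j * y j)))"
      unfolding case_prod_beta'
    proof (rule RS.integrable_const_bound[where B = "real (Suc n) * K + Y * K"])
      show "AE p in radial n \<Otimes>\<^sub>M simplex_measure n. cmod (E (fst p * (\<Sum>j\<le>n. snd p j * y j))) \<le> real (Suc n) * K + Y * K"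
        by (intro AE_I2 Eb)
      show "(\<lambda>p. E (fst p * (\<Sum>j\<le>n. snd p j * y j))) \<in> borel_measurable (radial n \<Otimes>\<^sub>M simplex_measure n)"
        using mp by (simp add: case_prod_beta')
    qed
    from SR.integral_snd[OF this] show ?thesis by (simp add: case_prod_beta')
  qed
  also have "\<dots> = (\<integral>s. h (\<Sum>j\<le>n. s j * x j) \<partial>simplex_measure n)"
  proof (rule integral_cong_AE)
    have hm: "h \<in> borel_measurable borel" by (intro borel_measurable_continuous_onI h)
    note [measurable] = hm measurable_simplex_form[of n n x, OF order_refl]
    show "(\<lambda>s. \<integral>r. E (r * (\<Sum>j\<le>n. s j * y j)) \<partial>radial n) \<in> borel_measurable (simplex_measure n)"
      by (rule R.borel_measurable_lebesgue_integral) measurable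
    show "(\<lambda>s. h (\<Sum>j\<le>n. s j * x j)) \<in> borel_measurable (simplex_measure n)" by measurable
    show "AE s in simplex_measure n. (\<integral>r. E (r * (\<Sum>j\<le>n. s j * y j)) \<partial>radial n) = h (\<Sum>j\<le>n. s j * x j)"
      using AE_simplex_measure
    proof eventually_elim
      case (elim s)
      let ?z = "\<Sum>j\<le>n. s j * y j"
      have zY: "\<bar>?z\<bar> \<le> Y" using elim le1[of n s] by (intro bnd) auto
      have "?z = (\<Sum>j\<le>n. s j * x j) - c * (\<Sum>j\<le>n. s j)"
        by (simp add: y_def right_diff_distrib sum_subtractf sum_distrib_left mult.commute)
      then have p: "(\<Sum>j\<le>n. s j * x j) = c + ?z" using elim by simp
      have hcm: "(\<lambda>r. of_nat (Suc n) * h (c + r * ?z) + of_real (r * ?z) * h' (c + r * ?z)) \<in> borel_measurable borel"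
        by (intro borel_measurable_continuous_onI continuous_intros continuous_on_compose2[OF h] continuous_on_compose2[OF h']) auto
      have "(\<integral>r. E (r * ?z) \<partial>radial n) = (\<integral>r. of_nat (Suc n) * h (c + r * ?z) + of_real (r * ?z) * h' (c + r * ?z) \<partial>radial n)"
      proof (rule integral_cong_AE)
        show "AE r in radial n. E (r * ?z) = of_nat (Suc n) * h (c + r * ?z) + of_real (r * ?z) * h' (c + r * ?z)"
          using AE_radial
        proof eventually_elim
          case (elim r)
          have "\<bar>r * ?z\<bar> \<le> 1 * Y" unfolding abs_mult using elim zY by (intro mult_mono) auto
          then show ?case by (simp add: E_def cl_id)
        qed
      qed (use hcm in \<open>auto simp: measurable_cong_sets[OF sets_radial refl]\<close>)
      also have "\<dots> = h (c + ?z)" by (rule integral_radial_FTC[OF der h'])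
      finally show ?case unfolding p .
    qed
  qed
  finally show ?thesis .
qed

section \<open>Divided differences and truncated multiple operator integrals\<close>

subsection \<open>Derivatives of smooth functions\<close>

lemma nth_deriv_0 [simp]: "nth_deriv 0 g = g"
  by (simp add: nth_deriv_def)

lemma nth_deriv_Suc: "nth_deriv (Suc n) g = (\<lambda>x. vector_derivative (nth_deriv n g) (at x))"
  by (simp add: nth_deriv_def)

lemma smooth_has_derivative:
  "smooth g \<Longrightarrow> (nth_deriv n g has_vector_derivative nth_deriv (Suc n) g x) (at x)"
  unfolding nth_deriv_Suc smooth_def by (metis vector_derivative_works)

lemma smooth_continuous: "smooth g \<Longrightarrow> continuous_on UNIV (nth_deriv n g)"
  using smooth_has_derivative by (intro continuous_at_imp_continuous_on ballI) (metis has_vector_derivative_continuous)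

lemma nth_deriv_mult_linear:
  assumes g: "smooth g"
  shows "nth_deriv n (\<lambda>x. g x * (of_real x - c)) = (\<lambda>x. nth_deriv n g x * (of_real x - c) + of_nat n * nth_deriv (n - 1) g x)"
    and "(nth_deriv n (\<lambda>x. g x * (of_real x - c)) has_vector_derivative
       nth_deriv (Suc n) g x * (of_real x - c) + of_nat (Suc n) * nth_deriv n g x) (at x)"
proof -
  have der: "((\<lambda>x. nth_deriv n g x * (of_real x - c) + of_nat n * nth_deriv (n - 1) g x) has_vector_derivative
       nth_deriv (Suc n) g x * (of_real x - c) + of_nat (Suc n) * nth_deriv n g x) (at x)" for n x
  proof -
    have id: "((\<lambda>x. complex_of_real x - c) has_vector_derivative 1) (at x)"
      using has_vector_derivative_diff[OF bounded_linear.has_vector_derivative[OF bounded_linear_of_real has_vector_derivative_id]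
          has_vector_derivative_const[of c]] by simp
    have a: "((\<lambda>x. nth_deriv n g x * (of_real x - c)) has_vector_derivative
        (nth_deriv n g x * 1 + nth_deriv (Suc n) g x * (of_real x - c))) (at x)"
      by (rule has_vector_derivative_mult[OF smooth_has_derivative[OF g] id])
    have b: "((\<lambda>x. of_nat n * nth_deriv (n - 1) g x) has_vector_derivative of_nat n * nth_deriv n g x) (at x)"
    proof (cases n)
      case (Suc m)
      then show ?thesis
        using has_vector_derivative_mult_right[OF smooth_has_derivative[OF g, of m x], of "of_nat n"] by simp
    qed simp
    from has_vector_derivative_add[OF a b] show ?thesis by (simp add: algebra_simps)
  qed
  have eq: "nth_deriv n (\<lambda>x. g x * (of_real x - c)) = (\<lambda>x. nth_deriv n g x * (of_real x - c) + of_nat n * nth_deriv (n - 1) g x)" for n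
  proof (induction n)
    case (Suc n)
    show ?case unfolding nth_deriv_Suc[of n "\<lambda>x. g x * (of_real x - c)"] Suc.IH
      by (intro ext) (simp only: vector_derivative_at[OF der] diff_Suc_1)
  qed simp
  show "nth_deriv n (\<lambda>x. g x * (of_real x - c)) = (\<lambda>x. nth_deriv n g x * (of_real x - c) + of_nat n * nth_deriv (n - 1) g x)"
    by (rule eq)
  show "(nth_deriv n (\<lambda>x. g x * (of_real x - c)) has_vector_derivative
       nth_deriv (Suc n) g x * (of_real x - c) + of_nat (Suc n) * nth_deriv n g x) (at x)"
    unfolding eq by (rule der)
qed

lemma smooth_mult_linear: "smooth g \<Longrightarrow> smooth (\<lambda>x. g x * (of_real x - c))"
  using differentiableI_vector[OF nth_deriv_mult_linear(2)] unfolding smooth_def[of "\<lambda>x. g x * (of_real x - c)"] by blast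

subsection \<open>Divided differences\<close>

text \<open>The Hermite--Genocchi formula for the divided difference of order \<open>n\<close> at \<open>x\<^sub>0, \<dots>, x\<^sub>n\<close>.\<close>

definition div_diff :: "(real \<Rightarrow> complex) \<Rightarrow> nat \<Rightarrow> (nat \<Rightarrow> real) \<Rightarrow> complex"
  where "div_diff g n x = (\<integral>s. nth_deriv n g (\<Sum>j\<le>n. s j * x j) \<partial>simplex_measure n)"

lemma div_diff_cong: "(\<And>j. j \<le> n \<Longrightarrow> x j = y j) \<Longrightarrow> div_diff g n x = div_diff g n y"
  unfolding div_diff_def by (intro Bochner_Integration.integral_cong refl arg_cong[where f = "nth_deriv n g"] sum.cong) auto

lemma integrable_simplex_form:
  assumes h: "continuous_on UNIV h" and bd: "\<And>x. cmod (h x) \<le> K"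
  shows "integrable (simplex_measure n) (\<lambda>s. h (\<Sum>j\<le>n. s j * x j))"
proof -
  interpret finite_measure "simplex_measure n" by (rule finite_simplex_measure)
  have [measurable]: "h \<in> borel_measurable borel" by (rule borel_measurable_continuous_onI[OF h])
  note [measurable] = measurable_simplex_form[OF order_refl]
  show ?thesis by (rule integrable_const_bound[where B = K]) (auto simp: bd)
qed

text \<open>
  By the product rule, the derivative of order \<open>n + 1\<close> of \<open>g\<close> times \<open>p - c\<close> is
  \<open>(p - c) g\<^bsup>(n+1)\<^esup> + (n + 1) g\<^bsup>(n)\<^esup>\<close>. Replace \<open>p - c\<close> by \<open>x\<^bsub>n+1\<^esub> - c\<close>, and integrate the difference by parts.
\<close>

lemma div_diff_mult_linear_Suc:
  assumes g: "smooth g" and bd: "\<And>x. cmod (nth_deriv n g x) \<le> K" "\<And>x. cmod (nth_deriv (Suc n) g x) \<le> K"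
  shows "div_diff (\<lambda>x. g x * (of_real x - c)) (Suc n) x
    = div_diff g (Suc n) x * (of_real (x (Suc n)) - c) + div_diff g n x"
proof -
  let ?p = "\<lambda>s. \<Sum>j\<le>Suc n. s j * x j" and ?S = "simplex_measure (Suc n)"
  let ?A = "\<lambda>s. of_nat (Suc n) * nth_deriv n g (?p s) + of_real (?p s - x (Suc n)) * nth_deriv (Suc n) g (?p s)"
  let ?B = "\<lambda>s. nth_deriv (Suc n) g (?p s)"
  have iB: "integrable ?S ?B" by (rule integrable_simplex_form[OF smooth_continuous[OF g] bd(2)])
  have iA1: "integrable ?S (\<lambda>s. of_nat (Suc n) * nth_deriv n g (?p s))"
    by (intro integrable_mult_right integrable_simplex_form[OF smooth_continuous[OF g] bd(1)])
  have iA2: "integrable ?S (\<lambda>s. of_real (?p s - x (Suc n)) * nth_deriv (Suc n) g (?p s))"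
  proof -
    interpret finite_measure ?S by (rule finite_simplex_measure)
    have [measurable]: "nth_deriv (Suc n) g \<in> borel_measurable borel"
      by (rule borel_measurable_continuous_onI[OF smooth_continuous[OF g]])
    note [measurable] = measurable_simplex_form[where n = "Suc n", OF order_refl]
    define Y where "Y = (\<Sum>j\<le>Suc n. \<bar>x j\<bar>) + \<bar>x (Suc n)\<bar>"
    show ?thesis
    proof (rule integrable_const_bound[where B = "Y * K"])
      show "AE s in ?S. cmod (of_real (?p s - x (Suc n)) * nth_deriv (Suc n) g (?p s)) \<le> Y * K"
        using AE_simplex_measure
      proof eventually_elim
        case (elim s)
        have "\<bar>?p s\<bar> \<le> (\<Sum>j\<le>Suc n. \<bar>s j * x j\<bar>)" by (rule sum_abs)
        also have "\<dots> \<le> (\<Sum>j\<le>Suc n. 1 * \<bar>x j\<bar>)"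
          unfolding abs_mult
        proof (intro sum_mono mult_right_mono)
          fix j assume j: "j \<in> {..Suc n}"
          have "s j \<le> (\<Sum>j\<le>Suc n. s j)" using elim by (intro member_le_sum j) auto
          then show "\<bar>s j\<bar> \<le> 1" using elim j by simp
        qed simp
        finally have "\<bar>?p s - x (Suc n)\<bar> \<le> Y" unfolding Y_def by simp
        moreover have "K \<ge> 0" using bd(1)[of 0] norm_ge_zero order_trans by blast
        ultimately show ?case unfolding norm_mult norm_of_real by (intro mult_mono bd) auto
      qed
    qed measurable
  qed
  have eq: "nth_deriv (Suc n) (\<lambda>x. g x * (of_real x - c)) (?p s) = ?A s + ?B s * (of_real (x (Suc n)) - c)" for s
    by (subst nth_deriv_mult_linear(1)[OF g]) (simp add: algebra_simps)
  have "div_diff (\<lambda>x. g x * (of_real x - c)) (Suc n) x = (\<integral>s. ?A s + ?B s * (of_real (x (Suc n)) - c) \<partial>?S)"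
    unfolding div_diff_def eq ..
  also have "\<dots> = (\<integral>s. ?A s \<partial>?S) + (\<integral>s. ?B s * (of_real (x (Suc n)) - c) \<partial>?S)"
    by (intro Bochner_Integration.integral_add Bochner_Integration.integrable_add iA1 iA2 integrable_mult_left iB)
  also have "(\<integral>s. ?A s \<partial>?S) = div_diff g n x"
    unfolding div_diff_def
    by (rule simplex_average_by_parts[OF smooth_has_derivative[OF g] smooth_continuous[OF g] bd])
  also have "(\<integral>s. ?B s * (of_real (x (Suc n)) - c) \<partial>?S) = div_diff g (Suc n) x * (of_real (x (Suc n)) - c)"
    unfolding div_diff_def by simp
  finally show ?thesis by simp
qed

lemma div_diff_0: assumes g: "continuous_on UNIV g" shows "div_diff g 0 x = g (x 0)"
proof -
  interpret finite_measure "simplex_measure 0" by (rule finite_simplex_measure)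
  have [measurable]: "g \<in> borel_measurable borel" by (rule borel_measurable_continuous_onI[OF g])
  note [measurable] = measurable_simplex_form[where n = 0, OF order_refl]
  have "div_diff g 0 x = (\<integral>s. g (x 0) \<partial>simplex_measure 0)"
    unfolding div_diff_def
  proof (rule integral_cong_AE)
    show "AE s in simplex_measure 0. nth_deriv 0 g (\<Sum>j\<le>0. s j * x j) = g (x 0)"
      using AE_simplex_measure by eventually_elim simp
  qed (simp_all only: nth_deriv_0, measurable)
  then show ?thesis by (simp add: measure_simplex_measure)
qed

subsection \<open>Matrices of multiple operator integrals\<close>

context
  fixes G :: "'i set" and d :: "'i \<Rightarrow> real" and V :: "nat \<Rightarrow> 'i \<Rightarrow> 'i \<Rightarrow> complex"
begin

text \<open>
  The matrix \<open>(i, j) \<mapsto> \<Sum> K(d\<^bsub>i\<^esub>, d\<^bsub>l\<^esub>, \<dots>, d\<^bsub>j\<^esub>) V\<^sub>1(i, l) \<cdots> V\<^sub>n(l', j)\<close>, the sum being over the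
  intermediate indices. The sequences to which \<open>K\<close> is applied continue with \<open>d\<^bsub>i\<^esub>\<close> after the entry of index \<open>n\<close>.
\<close>

primrec schur_sum :: "nat \<Rightarrow> ((nat \<Rightarrow> real) \<Rightarrow> complex) \<Rightarrow> 'i \<Rightarrow> 'i \<Rightarrow> complex" where
  "schur_sum 0 K i j = (if i = j then K (\<lambda>_. d i) else 0)"
| "schur_sum (Suc n) K i j = (\<Sum>l\<in>G. schur_sum n (\<lambda>x. K (x(Suc n := d j))) i l * V n l j)"

lemma schur_sum_add: "schur_sum n (\<lambda>x. K x + L x) i j = schur_sum n K i j + schur_sum n L i j"
  by (induction n arbitrary: K L j) (simp_all add: distrib_right sum.distrib)

lemma schur_sum_cmult: "schur_sum n (\<lambda>x. K x * c) i j = schur_sum n K i j * c"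
  by (induction n arbitrary: K j) (simp_all add: sum_distrib_left sum_distrib_right mult_ac)

lemma schur_sum_last: "schur_sum n (\<lambda>x. K x * \<phi> (x n)) i j = schur_sum n K i j * \<phi> (d j)"
proof (cases n)
  case (Suc m)
  have "schur_sum (Suc m) (\<lambda>x. K x * \<phi> (x (Suc m))) i j
      = (\<Sum>l\<in>G. schur_sum m (\<lambda>x. K (x(Suc m := d j))) i l * \<phi> (d j) * V m l j)"
    by (simp add: schur_sum_cmult)
  then show ?thesis unfolding Suc by (simp add: sum_distrib_left sum_distrib_right mult_ac)
qed simp

lemma schur_sum_integral:
  assumes "\<And>x. integrable M (\<lambda>w. K w x)"
  shows "integrable M (\<lambda>w. schur_sum n (K w) i j) \<and> schur_sum n (\<lambda>x. \<integral>w. K w x \<partial>M) i j = (\<integral>w. schur_sum n (K w) i j \<partial>M)"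
  using assms
proof (induction n arbitrary: K j)
  case (Suc n)
  have IH: "integrable M (\<lambda>w. schur_sum n (\<lambda>x. K w (x(Suc n := d j))) i l)"
    "schur_sum n (\<lambda>x. \<integral>w. K w (x(Suc n := d j)) \<partial>M) i l = (\<integral>w. schur_sum n (\<lambda>x. K w (x(Suc n := d j))) i l \<partial>M)" for l
    using Suc.IH[of "\<lambda>w x. K w (x(Suc n := d j))" l] Suc.prems by auto
  show ?case using IH by (simp add: integrable_sum integrable_mult_left)
qed auto

lemma schur_sum_exp_Suc:
  "schur_sum (Suc n) (\<lambda>x. iexp (t * (\<Sum>j\<le>Suc n. s j * x j))) i j
    = (\<Sum>l\<in>G. schur_sum n (\<lambda>x. iexp (t * (\<Sum>j\<le>n. s j * x j))) i l * V n l j) * iexp (t * s (Suc n) * d j)"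
proof -
  have "iexp (t * (\<Sum>k\<le>Suc n. s k * (x(Suc n := d j)) k)) = iexp (t * (\<Sum>j\<le>n. s j * x j)) * iexp (t * s (Suc n) * d j)" for x
    by (simp add: exp_add[symmetric] distrib_left mult.assoc)
  then have "schur_sum (Suc n) (\<lambda>x. iexp (t * (\<Sum>j\<le>Suc n. s j * x j))) i j
    = (\<Sum>l\<in>G. schur_sum n (\<lambda>x. iexp (t * (\<Sum>j\<le>n. s j * x j))) i l * iexp (t * s (Suc n) * d j) * V n l j)"
    by (simp only: schur_sum.simps schur_sum_cmult)
  then show ?thesis by (simp only: sum_distrib_left sum_distrib_right mult_ac)
qed

text \<open>
  For the kernel of an exponential, the sum is the product of unitary diagonal matrices with the \<open>V\<^sub>k\<close>.
\<close>

lemma schur_sum_exp_contr: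
  assumes fin: "finite G" and "\<And>k. k < n \<Longrightarrow> contraction G (V k)"
  shows "contraction G (schur_sum n (\<lambda>x. iexp (t * (\<Sum>j\<le>n. s j * x j))))"
  using assms(2)
proof (induction n)
  case 0
  have "contraction G (\<lambda>i j. if i = j then iexp (t * (s 0 * d i)) else 0)"
    by (rule contraction_diag[OF fin]) simp
  then show ?case by (rule contraction_cong) simp
next
  case (Suc n)
  let ?E = "schur_sum n (\<lambda>x. iexp (t * (\<Sum>j\<le>n. s j * x j)))"
  let ?P = "\<lambda>i j. if i = j then iexp (t * s (Suc n) * d i) else 0"
  have "contraction G (mat_mult G (mat_mult G ?E (V n)) ?P)"
    using Suc by (intro contraction_mat_mult contraction_diag[OF fin]) auto
  then show ?case
  proof (rule contraction_cong)
    fix i j assume j: "j \<in> G"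
    have "mat_mult G (mat_mult G ?E (V n)) ?P i j = (\<Sum>l\<in>G. if l = j then mat_mult G ?E (V n) i l * iexp (t * s (Suc n) * d l) else 0)"
      unfolding mat_mult_def[of G "mat_mult G ?E (V n)"] by (intro sum.cong) auto
    also have "\<dots> = mat_mult G ?E (V n) i j * iexp (t * s (Suc n) * d j)" using fin j by simp
    also have "\<dots> = schur_sum (Suc n) (\<lambda>x. iexp (t * (\<Sum>j\<le>Suc n. s j * x j))) i j"
      by (simp only: schur_sum_exp_Suc mat_mult_def)
    finally show "mat_mult G (mat_mult G ?E (V n)) ?P i j = schur_sum (Suc n) (\<lambda>x. iexp (t * (\<Sum>j\<le>Suc n. s j * x j))) i j" .
  qed
qed

end

subsection \<open>The trace estimate for truncated multiple operator integrals\<close>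

text \<open>
  The functions \<open>g m\<close> stand for \<open>f u\<^sup>m\<close> with \<open>u(x) = x - i\<close>, and \<open>h m n\<close> for the Fourier transform of the
  derivative of order \<open>n\<close> of \<open>g m\<close>.
\<close>

context
  fixes G :: "'i set" and d :: "'i \<Rightarrow> real" and V :: "nat \<Rightarrow> 'i \<Rightarrow> 'i \<Rightarrow> complex"
    and g :: "nat \<Rightarrow> real \<Rightarrow> complex" and h :: "nat \<Rightarrow> nat \<Rightarrow> real \<Rightarrow> complex" and s :: nat
  assumes fin: "finite G" and V: "\<And>k. contraction G (V k)"
    and smooth: "\<And>m. smooth (g m)" and g_Suc: "\<And>m. g (Suc m) = (\<lambda>x. g m x * (of_real x - \<i>))"
    and h: "\<And>m n. m \<le> s \<Longrightarrow> has_L1_fourier (nth_deriv n (g m)) (h m n)"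
begin

abbreviation (input) "h_norm m n \<equiv> (\<integral>t. cmod (h m n t) \<partial>lborel)"
abbreviation (input) "T_mat m n \<equiv> schur_sum G d V n (div_diff (g m) n)"
abbreviation (input) "res j \<equiv> 1 / (complex_of_real (d j) - \<i>)"
abbreviation (input) "exp_mat n t \<sigma> \<equiv> schur_sum G d V n (\<lambda>x. iexp (t * (\<Sum>j\<le>n. \<sigma> j * x j)))"

lemma h_integrable: "m \<le> s \<Longrightarrow> integrable lborel (h m n)"
  using h[of m n] by (simp add: has_L1_fourier_def)

lemma nth_deriv_inversion: "m \<le> s \<Longrightarrow> nth_deriv n (g m) x = (\<integral>t. iexp (t * x) * h m n t \<partial>lborel)"
  using fourier_inversion[OF h smooth_continuous[OF smooth]] by (simp add: mult.commute)

lemma h_exp_integrable: "m \<le> s \<Longrightarrow> integrable lborel (\<lambda>t. iexp (t * x) * h m n t)"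
proof -
  assume m: "m \<le> s"
  have [measurable]: "h m n \<in> borel_measurable borel" using h_integrable[OF m, of n] by auto
  show ?thesis
    by (rule Bochner_Integration.integrable_bound[OF h_integrable[OF m]]) (auto simp: norm_mult)
qed

lemma nth_deriv_bounded: "m \<le> s \<Longrightarrow> cmod (nth_deriv n (g m) x) \<le> h_norm m n"
proof -
  assume m: "m \<le> s"
  have "cmod (nth_deriv n (g m) x) \<le> (\<integral>t. cmod (iexp (t * x) * h m n t) \<partial>lborel)"
    unfolding nth_deriv_inversion[OF m] by (rule integral_norm_bound)
  then show ?thesis by (simp add: norm_mult)
qed

lemma schur_div_diff_Suc:
  assumes m: "m \<le> s"
  shows "T_mat (Suc m) (Suc n) i j = T_mat m (Suc n) i j * (of_real (d j) - \<i>) + (\<Sum>l\<in>G. T_mat m n i l * V n l j)"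
proof -
  have "div_diff (g (Suc m)) (Suc n) = (\<lambda>x. div_diff (g m) (Suc n) x * (of_real (x (Suc n)) - \<i>) + div_diff (g m) n x)"
    unfolding g_Suc
    by (intro ext div_diff_mult_linear_Suc[OF smooth, where K = "max (h_norm m n) (h_norm m (Suc n))"])
       (auto intro: order_trans[OF nth_deriv_bounded[OF m]])
  then have "T_mat (Suc m) (Suc n) i j = T_mat m (Suc n) i j * (of_real (d j) - \<i>) + schur_sum G d V (Suc n) (div_diff (g m) n) i j"
    using schur_sum_last[of G d V "Suc n" "div_diff (g m) (Suc n)" "\<lambda>z. of_real z - \<i>"]
    by (simp only: schur_sum_add)
  moreover have "(\<lambda>x. div_diff (g m) n (x(Suc n := d j))) = div_diff (g m) n" 
    by (intro ext div_diff_cong) auto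
  ultimately show ?thesis by simp
qed

lemma schur_div_diff_0: "T_mat (Suc m) 0 i j = T_mat m 0 i j * (of_real (d j) - \<i>)"
proof -
  have c: "continuous_on UNIV (g m)" for m using smooth_continuous[OF smooth, of 0 m] by simp
  show ?thesis by (simp add: div_diff_0[OF c]) (simp add: g_Suc)
qed

lemma mtrace_mm_cmult: "mtrace G (mat_mult G (\<lambda>i j. A i j * c) X) = mtrace G (mat_mult G A X) * c"
  by (simp add: mtrace_def mat_mult_def sum_distrib_left sum_distrib_right mult_ac)

lemma schur_exp_integral:
  assumes m: "m \<le> s"
  shows "integrable lborel (\<lambda>t. exp_mat n t \<sigma> i j * h m n t)"
    and "schur_sum G d V n (\<lambda>x. nth_deriv n (g m) (\<Sum>j\<le>n. \<sigma> j * x j)) i j = (\<integral>t. exp_mat n t \<sigma> i j * h m n t \<partial>lborel)"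
  using schur_sum_integral[where M = lborel and K = "\<lambda>t x. iexp (t * (\<Sum>j\<le>n. \<sigma> j * x j)) * h m n t" and n = n
    and G = G and d = d and V = V and i = i and j = j, OF h_exp_integrable[OF m]]
  unfolding nth_deriv_inversion[OF m] schur_sum_cmult by blast+

lemma schur_div_diff_integral:
  assumes m: "m \<le> s"
  shows "T_mat m n i j = (\<integral>\<sigma>. \<integral>t. exp_mat n t \<sigma> i j * h m n t \<partial>lborel \<partial>simplex_measure n)"
    and "integrable (simplex_measure n) (\<lambda>\<sigma>. \<integral>t. exp_mat n t \<sigma> i j * h m n t \<partial>lborel)"
  using schur_sum_integral[where M = "simplex_measure n" and K = "\<lambda>\<sigma> x. nth_deriv n (g m) (\<Sum>j\<le>n. \<sigma> j * x j)" and n = n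
      and G = G and d = d and V = V and i = i and j = j,
      OF integrable_simplex_form[OF smooth_continuous[OF smooth] nth_deriv_bounded[OF m]]]
  unfolding div_diff_def schur_exp_integral(2)[OF m] by blast+

lemma mtrace_mm_integral:
  assumes "\<And>i j. integrable M (\<lambda>w. A w i j)"
  shows "mtrace G (mat_mult G (\<lambda>i j. \<integral>w. A w i j \<partial>M) X) = (\<integral>w. mtrace G (mat_mult G (A w) X) \<partial>M)"
  using assms by (simp add: mtrace_def mat_mult_def integral_sum integrable_sum integrable_mult_left)

text \<open>
  The matrix is an average of the contractions \<open>exp_mat n t \<sigma>\<close> with weights of total mass \<open>h_norm m n / n!\<close>, and a
  contraction times a word with \<open>s\<close> letters is again such a word.
\<close>

lemma trace_div_diff_word:
  assumes m: "m \<le> s" and l: "\<And>i. l i \<ge> 0" and X: "word G l s X" and s: "s \<ge> 1"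
  shows "cmod (mtrace G (mat_mult G (T_mat m n) X)) \<le> (\<Sum>i\<in>G. l i ^ s) * h_norm m n / fact n"
proof -
  let ?\<tau> = "\<Sum>i\<in>G. l i ^ s" and ?S = "simplex_measure n"
  interpret finite_measure ?S by (rule finite_simplex_measure)
  define Y where "Y \<sigma> i j = (\<integral>t. exp_mat n t \<sigma> i j * h m n t \<partial>lborel)" for \<sigma> i j
  have t0: "?\<tau> \<ge> 0" using l by (intro sum_nonneg) auto
  have W0: "h_norm m n \<ge> 0" by (intro integral_nonneg_AE) auto
  have Ebound: "cmod (mtrace G (mat_mult G (exp_mat n t \<sigma>) X)) \<le> ?\<tau>" for t \<sigma>
  proof -
    have "word G l (0 + s) (mat_mult G (exp_mat n t \<sigma>) X)"
      by (intro word_mult[OF _ X] word_contraction schur_sum_exp_contr[OF fin] V)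
    then show ?thesis using word_trace_le[OF fin l _ s] by simp
  qed
  have iY: "integrable ?S (\<lambda>\<sigma>. Y \<sigma> i j)" and TY: "T_mat m n i j = (\<integral>\<sigma>. Y \<sigma> i j \<partial>?S)" for i j
    using schur_div_diff_integral[OF m, of n i j] unfolding Y_def by auto
  have Yb: "cmod (mtrace G (mat_mult G (Y \<sigma>) X)) \<le> ?\<tau> * h_norm m n" for \<sigma>
  proof -
    have iE: "integrable lborel (\<lambda>t. exp_mat n t \<sigma> i j * h m n t)"
      and YE: "Y \<sigma> i j = (\<integral>t. exp_mat n t \<sigma> i j * h m n t \<partial>lborel)" for i j
      using schur_exp_integral[OF m] unfolding Y_def by auto
    have "mtrace G (mat_mult G (Y \<sigma>) X) = mtrace G (mat_mult G (\<lambda>i j. \<integral>t. exp_mat n t \<sigma> i j * h m n t \<partial>lborel) X)"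
      by (simp only: YE[abs_def])
    also have "\<dots> = (\<integral>t. mtrace G (mat_mult G (\<lambda>i j. exp_mat n t \<sigma> i j * h m n t) X) \<partial>lborel)"
      by (rule mtrace_mm_integral[OF iE])
    also have "\<dots> = (\<integral>t. mtrace G (mat_mult G (exp_mat n t \<sigma>) X) * h m n t \<partial>lborel)"
      by (simp only: mtrace_mm_cmult)
    finally have "cmod (mtrace G (mat_mult G (Y \<sigma>) X)) \<le> (\<integral>t. cmod (mtrace G (mat_mult G (exp_mat n t \<sigma>) X) * h m n t) \<partial>lborel)"
      using integral_norm_bound[of lborel] by simp
    also have "\<dots> \<le> (\<integral>t. ?\<tau> * cmod (h m n t) \<partial>lborel)"
    proof (rule integral_mono_AE')
      show "integrable lborel (\<lambda>t. ?\<tau> * cmod (h m n t))"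
        by (intro integrable_mult_right integrable_norm h_integrable m)
      show "AE t in lborel. cmod (mtrace G (mat_mult G (exp_mat n t \<sigma>) X) * h m n t) \<le> ?\<tau> * cmod (h m n t)"
        unfolding norm_mult by (intro AE_I2 mult_right_mono Ebound) auto
      show "AE t in lborel. 0 \<le> ?\<tau> * cmod (h m n t)" using t0 by (intro AE_I2) simp
    qed
    also have "\<dots> = ?\<tau> * h_norm m n" by simp
    finally show ?thesis .
  qed
  have "mtrace G (mat_mult G (T_mat m n) X) = mtrace G (mat_mult G (\<lambda>i j. \<integral>\<sigma>. Y \<sigma> i j \<partial>?S) X)"
    by (simp only: TY[abs_def])
  also have "\<dots> = (\<integral>\<sigma>. mtrace G (mat_mult G (Y \<sigma>) X) \<partial>?S)" by (rule mtrace_mm_integral[OF iY])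
  finally have "cmod (mtrace G (mat_mult G (T_mat m n) X)) \<le> (\<integral>\<sigma>. cmod (mtrace G (mat_mult G (Y \<sigma>) X)) \<partial>?S)"
    using integral_norm_bound[of ?S] by simp
  also have "\<dots> \<le> (\<integral>\<sigma>. ?\<tau> * h_norm m n \<partial>?S)"
    using t0 W0 by (intro integral_mono_AE' AE_I2 Yb) auto
  also have "\<dots> = ?\<tau> * h_norm m n / fact n" by (simp add: measure_simplex_measure)
  finally show ?thesis .
qed

text \<open>
  The resolvent is a diagonal unitary times its absolute value, which is the letter of the words.
\<close>

lemma word_resolvent_left:
  assumes X: "word G (\<lambda>j. cmod (res j)) k X"
  shows "word G (\<lambda>j. cmod (res j)) (Suc k) (\<lambda>i j. res i * X i j)"
proof -
  let ?l = "\<lambda>j. cmod (res j)"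
  let ?P = "\<lambda>i j. if i = j then res i / of_real (?l i) else 0"
  have nz: "complex_of_real (d j) - \<i> \<noteq> 0" for j by (auto simp: complex_eq_iff)
  have "contraction G ?P" using nz by (intro contraction_diag[OF fin]) (simp add: norm_divide)
  then have "word G ?l (Suc k) (mat_mult G ?P (scale_rows ?l X))" by (intro word_left word_letter X)
  then show ?thesis
  proof (rule word_cong)
    fix i j assume i: "i \<in> G"
    show "mat_mult G ?P (scale_rows ?l X) i j = res i * X i j"
      unfolding mat_mult_def using nz[of i] i by (subst diag_sum[OF fin]) (auto simp: scale_rows_def norm_divide)
  qed
qed

text \<open>
  Each step moves one resolvent out of the divided difference into \<open>X\<close>, either raising the power of \<open>x - i\<close> or
  lowering the order \<open>n\<close>; \<open>q\<close> counts the steps that are still to be made. When \<open>\<Gamma> / N\<^sup>n\<close> bounds the weights, these two terms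
  cost together a factor \<open>1 + N\<close>.
\<close>

theorem trace_div_diff_le:
  assumes s: "s \<ge> 1" and N: "N > 0" and \<Gamma>: "\<Gamma> \<ge> 0"
    and W: "\<And>m n. m \<le> s \<Longrightarrow> h_norm m n / fact n \<le> \<Gamma> / N ^ n"
    and "m + q \<le> s" "k + q = s" "word G (\<lambda>j. cmod (res j)) k X"
  shows "cmod (mtrace G (mat_mult G (T_mat m n) X)) \<le> (\<Sum>i\<in>G. cmod (res i) ^ s) * \<Gamma> * (1 + N) ^ q / N ^ n"
  using assms(5-)
proof (induction q arbitrary: n m k X)
  case 0
  have "(\<Sum>i\<in>G. cmod (res i) ^ s) * h_norm m n / fact n \<le> (\<Sum>i\<in>G. cmod (res i) ^ s) * (\<Gamma> / N ^ n)"
    unfolding times_divide_eq_right[symmetric] using 0 by (intro mult_left_mono W sum_nonneg) auto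
  then show ?case
    using trace_div_diff_word[of m "\<lambda>j. cmod (res j)" X n] 0 s by fastforce
next
  case (Suc q)
  let ?\<tau> = "\<Sum>i\<in>G. cmod (res i) ^ s" and ?X = "\<lambda>i j. res i * X i j"
  have \<tau>: "?\<tau> \<ge> 0" by (intro sum_nonneg) auto
  have nz: "complex_of_real (d j) - \<i> \<noteq> 0" for j by (auto simp: complex_eq_iff)
  have m: "m \<le> s" using Suc.prems by simp
  have wX: "word G (\<lambda>j. cmod (res j)) (Suc k) ?X" by (rule word_resolvent_left[OF Suc.prems(3)])
  have IH1: "cmod (mtrace G (mat_mult G (T_mat (Suc m) n) ?X)) \<le> ?\<tau> * \<Gamma> * (1 + N) ^ q / N ^ n" for n
    by (rule Suc.IH[OF _ _ wX]) (use Suc.prems in auto)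
  show ?case
  proof (cases n)
    case 0
    have "mat_mult G (T_mat m 0) X = mat_mult G (T_mat (Suc m) 0) ?X"
      using nz by (intro ext) (simp add: mat_mult_def schur_div_diff_0 del: schur_sum.simps)
    then have "cmod (mtrace G (mat_mult G (T_mat m n) X)) \<le> ?\<tau> * \<Gamma> * (1 + N) ^ q / N ^ n"
      using IH1[of 0] 0 by simp
    also have "\<dots> \<le> ?\<tau> * \<Gamma> * (1 + N) ^ Suc q / N ^ n"
      using N \<Gamma> \<tau> by (intro divide_right_mono mult_left_mono power_increasing) auto
    finally show ?thesis .
  next
    case (Suc n')
    have wV: "word G (\<lambda>j. cmod (res j)) (Suc k) (mat_mult G (V n') ?X)" by (intro word_left V wX)
    have IH2: "cmod (mtrace G (mat_mult G (T_mat m n') (mat_mult G (V n') ?X))) \<le> ?\<tau> * \<Gamma> * (1 + N) ^ q / N ^ n'"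
      by (rule Suc.IH[OF _ _ wV]) (use Suc.prems in auto)
    have "T_mat m n i j = (T_mat (Suc m) n i j - mat_mult G (T_mat m n') (V n') i j) * res j" for i j
      using schur_div_diff_Suc[OF m, of n' i j] nz[of j] unfolding Suc mat_mult_def by simp
    then have "mat_mult G (T_mat m n) X i j = mat_mult G (T_mat (Suc m) n) ?X i j - mat_mult G (mat_mult G (T_mat m n') (V n')) ?X i j" for i j
      unfolding mat_mult_def[of G "T_mat m n"] mat_mult_def[of G "T_mat (Suc m) n"] mat_mult_def[of G "mat_mult G (T_mat m n') (V n')"]
      by (simp only: left_diff_distrib sum_subtractf mult.assoc)
    then have "mtrace G (mat_mult G (T_mat m n) X) = mtrace G (mat_mult G (T_mat (Suc m) n) ?X) - mtrace G (mat_mult G (T_mat m n') (mat_mult G (V n') ?X))"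
      by (simp add: mtrace_def sum_subtractf mat_mult_assoc)
    then have "cmod (mtrace G (mat_mult G (T_mat m n) X)) \<le> ?\<tau> * \<Gamma> * (1 + N) ^ q / N ^ n + ?\<tau> * \<Gamma> * (1 + N) ^ q / N ^ n'"
      using IH1[of n] IH2 norm_triangle_ineq4 by (smt (verit, best))
    also have "\<dots> = ?\<tau> * \<Gamma> * (1 + N) ^ Suc q / N ^ n"
      using N by (simp add: Suc field_simps)
    finally show ?thesis .
  qed
qed

end

section \<open>Truncation to finitely many eigenvectors\<close>

text \<open>
  For orthonormal \<open>G\<close> this is the orthogonal projection onto the span of \<open>G\<close>.
\<close>

definition trunc :: "'h::chilbert_space set \<Rightarrow> 'h \<Rightarrow> 'h"
  where "trunc G y = (\<Sum>e\<in>G. cinner e y *\<^sub>C e)"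

text \<open>
  The factor \<open>1 / K\<close> turns an operator of norm at most \<open>K\<close> into a contraction.
\<close>

definition matrix_of :: "real \<Rightarrow> ('h::chilbert_space \<Rightarrow> 'h) \<Rightarrow> 'h \<Rightarrow> 'h \<Rightarrow> complex"
  where "matrix_of K V i j = cinner i (V j) / of_real K"

lemma trunc_norm:
  assumes "orthonormal B" "finite G" "G \<subseteq> B"
  shows "norm (trunc G y) \<le> norm y"
proof -
  have "(norm (trunc G y))\<^sup>2 \<le> (norm y)\<^sup>2"
    unfolding trunc_def orthonormal_norm_sum[OF assms] by (rule bessel[OF assms])
  then show ?thesis by (rule power2_le_imp_le) simp
qed

lemma trunc_bounded_clinear:
  assumes "orthonormal B" "finite G" "G \<subseteq> B"
  shows "bounded_clinear (trunc G)"
proof -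
  have add: "trunc G (x + y) = trunc G x + trunc G y" for x y
    by (simp add: trunc_def cinner_add_right scaleC_add_left sum.distrib)
  have sc: "trunc G (c *\<^sub>C x) = c *\<^sub>C trunc G x" for c x
    by (simp add: trunc_def cinner_scaleC_right scaleC_scaleC scaleC_sum_right)
  have "bounded_linear (trunc G)"
    by (rule bounded_linear_intro[where K = 1]) (simp_all add: add scaleR_scaleC sc trunc_norm[OF assms])
  then show ?thesis using sc by (simp add: bounded_clinear_def)
qed

lemma trunc_basis:
  assumes "orthonormal B" "finite G" "G \<subseteq> B" "j \<in> G"
  shows "trunc G j = j"
proof -
  have "cinner e j = (if e = j then 1 else 0)" if "e \<in> G" for e
    using assms that unfolding orthonormal_def by blast
  then have "trunc G j = (\<Sum>e\<in>G. (if e = j then 1 else 0) *\<^sub>C e)"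
    unfolding trunc_def by (intro sum.cong refl) simp
  also have "\<dots> = (\<Sum>e\<in>G. if e = j then e else 0)" by (intro sum.cong) auto
  finally show ?thesis using assms by simp
qed

lemma matrix_of_contr:
  assumes o: "orthonormal B" "finite G" "G \<subseteq> B" and V: "bounded_clinear V"
    and K: "K > 0" "\<And>x. norm (V x) \<le> K * norm x"
  shows "contraction G (matrix_of K V)"
  unfolding contraction_def
proof
  fix x :: "'a \<Rightarrow> complex"
  let ?v = "\<Sum>j\<in>G. x j *\<^sub>C j"
  have "(\<Sum>j\<in>G. matrix_of K V i j * x j) = cinner i (V ?v) / of_real K" for i
    by (simp add: matrix_of_def bounded_clinear_sum[OF V] bounded_clinear_scaleC[OF V] cinner_sum_right
        cinner_scaleC_right sum_divide_distrib mult.commute)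
  then have "(\<Sum>i\<in>G. (cmod (\<Sum>j\<in>G. matrix_of K V i j * x j))\<^sup>2) = (\<Sum>i\<in>G. (cmod (cinner i (V ?v)))\<^sup>2) / K\<^sup>2"
    using K by (simp add: norm_divide power_divide sum_divide_distrib)
  also have "\<dots> \<le> (norm (V ?v))\<^sup>2 / K\<^sup>2" by (intro divide_right_mono bessel[OF o]) simp
  also have "\<dots> \<le> (K * norm ?v)\<^sup>2 / K\<^sup>2" by (intro divide_right_mono power_mono K) auto
  also have "\<dots> = (norm ?v)\<^sup>2" using K by (simp add: power_mult_distrib)
  also have "\<dots> = (\<Sum>j\<in>G. (cmod (x j))\<^sup>2)" by (rule orthonormal_norm_sum[OF o])
  finally show "(\<Sum>i\<in>G. (cmod (\<Sum>j\<in>G. matrix_of K V i j * x j))\<^sup>2) \<le> (\<Sum>j\<in>G. (cmod (x j))\<^sup>2)" .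
qed

lemma compression_norm:
  assumes "orthonormal B" "finite G" "G \<subseteq> B" and K: "K \<ge> 0" "\<And>x. norm (V x) \<le> K * norm x"
  shows "norm ((trunc G \<circ> V \<circ> trunc G) x) \<le> K * norm x"
proof -
  have "norm ((trunc G \<circ> V \<circ> trunc G) x) \<le> norm (V (trunc G x))" by (simp add: trunc_norm[OF assms(1-3)])
  also have "\<dots> \<le> K * norm (trunc G x)" by (rule K(2))
  also have "\<dots> \<le> K * norm x" by (intro mult_left_mono trunc_norm[OF assms(1-3)] K(1))
  finally show ?thesis .
qed

context
  fixes D :: "'h::{chilbert_space, second_countable_topology} \<rightharpoonup> 'h" and B d
  assumes sa: "self_adjoint D" and B: "orthonormal_basis B"
    and D: "\<forall>e\<in>B. D e = Some (complex_of_real (d e) *\<^sub>C e)"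
begin

lemma orthonormal_eigenbasis: "orthonormal B" using B by (rule orthonormal_basis_orthonormal)

lemmas group_norm = diag_group_norm[OF sa B D]
lemmas group_clinear = diag_group_bounded_clinear[OF sa B D]
lemmas group_continuous = diag_group_continuous[OF sa B D]
lemmas group_eigenvector = diag_group_eigenvector[OF sa B D]

lemma group_jointly_continuous: "continuous_on UNIV (\<lambda>p. diag_group B d (fst p) (snd p))"
proof (intro continuous_at_imp_continuous_on ballI)
  fix p :: "real \<times> 'h"
  obtain t y where p: "p = (t, y)" by (cases p)
  have "((\<lambda>q. diag_group B d (fst q) (snd q - y) + diag_group B d (fst q) y) \<longlongrightarrow> 0 + diag_group B d t y) (at p)"
  proof (intro tendsto_add)
    have "((\<lambda>q. norm (snd q - y)) \<longlongrightarrow> norm (snd p - y)) (at p)" by (intro tendsto_intros)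
    then have "((\<lambda>q. norm (diag_group B d (fst q) (snd q - y))) \<longlongrightarrow> 0) (at p)" by (simp add: group_norm p)
    then show "((\<lambda>q. diag_group B d (fst q) (snd q - y)) \<longlongrightarrow> 0) (at p)" by (rule tendsto_norm_zero_cancel)
    have "isCont (\<lambda>t. diag_group B d t y) t" using group_continuous[of y] by (simp add: continuous_on_eq_continuous_at)
    moreover have "(fst \<longlongrightarrow> t) (at p)" using tendsto_fst[OF tendsto_ident_at, of p UNIV] by (simp add: p)
    ultimately show "((\<lambda>q. diag_group B d (fst q) y) \<longlongrightarrow> diag_group B d t y) (at p)" by (rule isCont_tendsto_compose)
  qed
  then have "((\<lambda>q. diag_group B d (fst q) (snd q)) \<longlongrightarrow> diag_group B d (fst p) (snd p)) (at p)"
    by (simp add: bounded_clinear_add[OF group_clinear, symmetric] p)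
  then show "isCont (\<lambda>p. diag_group B d (fst p) (snd p)) p" by (simp add: isCont_def)
qed

lemma group_measurable:
  assumes "t \<in> borel_measurable M" "y \<in> borel_measurable M"
  shows "(\<lambda>w. diag_group B d (t w) (y w)) \<in> borel_measurable M"
  using borel_measurable_continuous_on[OF group_jointly_continuous borel_measurable_Pair[OF assms]] by simp

lemma moi_word_measurable:
  assumes Vs: "\<And>V. V \<in> set Vs \<Longrightarrow> bounded_clinear V" and k: "k \<le> length Vs"
    and ts: "\<And>j. j \<le> k \<Longrightarrow> (\<lambda>w. t w * \<sigma> w j) \<in> borel_measurable M" and y: "y \<in> borel_measurable M"
  shows "(\<lambda>w. moi_word (diag_group B d) Vs (t w) (\<sigma> w) k (y w)) \<in> borel_measurable M"
  using k ts y
proof (induction k arbitrary: y)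
  case 0
  then show ?case using group_measurable[OF "0.prems"(2)[of 0] "0.prems"(3)] by simp
next
  case (Suc k)
  have "bounded_clinear (Vs ! k)" using Suc.prems(1) by (intro Vs) simp
  then have c: "continuous_on UNIV (Vs ! k)"
    by (intro linear_continuous_on bounded_clinear_linear)
  have "(\<lambda>w. (Vs ! k) (diag_group B d (t w * \<sigma> w (Suc k)) (y w))) \<in> borel_measurable M"
    using Suc.prems by (intro borel_measurable_continuous_on[OF c] group_measurable) auto
  from Suc.IH[OF _ _ this] Suc.prems show ?case by simp
qed

lemma moi_word_clinear:
  assumes "\<And>V. V \<in> set Vs \<Longrightarrow> bounded_clinear V"
  shows "k \<le> length Vs \<Longrightarrow> bounded_clinear (moi_word (diag_group B d) Vs t \<sigma> k)"
  using assms by (induction k) (auto intro!: bounded_clinear_compose group_clinear)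

lemma moi_word_norm:
  assumes "\<And>V x. V \<in> set Vs \<Longrightarrow> norm (V x) \<le> K * norm x" "K \<ge> 0"
  shows "k \<le> length Vs \<Longrightarrow> norm (moi_word (diag_group B d) Vs t \<sigma> k y) \<le> K ^ k * norm y"
proof (induction k arbitrary: y)
  case (Suc k)
  have "norm (moi_word (diag_group B d) Vs t \<sigma> (Suc k) y) \<le> K ^ k * norm ((Vs ! k) (diag_group B d (t * \<sigma> (Suc k)) y))"
    using Suc by simp
  also have "\<dots> \<le> K ^ k * (K * norm (diag_group B d (t * \<sigma> (Suc k)) y))"
    using Suc.prems assms by (intro mult_left_mono assms) auto
  finally show ?case by (simp add: group_norm mult_ac)
qed (simp add: group_norm)

lemma trunc_tendsto:
  assumes G: "\<And>r. finite (G r)" "\<And>r. G r \<subseteq> B" and ex: "\<And>y. (\<lambda>r. trunc (G r) y) \<longlonglongrightarrow> y"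
    and y: "y \<longlonglongrightarrow> y0"
  shows "(\<lambda>r. trunc (G r) (y r)) \<longlonglongrightarrow> y0"
proof -
  note tc = trunc_bounded_clinear[OF orthonormal_eigenbasis G]
  have "(\<lambda>r. norm (y r - y0)) \<longlonglongrightarrow> 0" using y by (simp add: LIM_zero tendsto_norm_zero)
  then have "(\<lambda>r. trunc (G r) (y r - y0)) \<longlonglongrightarrow> 0"
    by (rule Lim_null_comparison[rotated]) (simp add: trunc_norm[OF orthonormal_eigenbasis G])
  from tendsto_add[OF this ex[of y0]] show ?thesis
    by (simp add: bounded_clinear_diff[OF tc])
qed

text \<open>
  The compressions converge strongly and are uniformly bounded, which passes to products.
\<close>

lemma moi_word_trunc_tendsto:
  assumes G: "\<And>r. finite (G r)" "\<And>r. G r \<subseteq> B" and ex: "\<And>y. (\<lambda>r. trunc (G r) y) \<longlonglongrightarrow> y"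
    and Vs: "\<And>V. V \<in> set Vs \<Longrightarrow> bounded_clinear V"
  shows "k \<le> length Vs \<Longrightarrow> y \<longlonglongrightarrow> y0 \<Longrightarrow>
    (\<lambda>r. moi_word (diag_group B d) (map (\<lambda>V. trunc (G r) \<circ> V \<circ> trunc (G r)) Vs) t \<sigma> k (y r)) \<longlonglongrightarrow> moi_word (diag_group B d) Vs t \<sigma> k y0"
proof (induction k arbitrary: y y0)
  case 0
  then show ?case using bounded_linear.tendsto[OF bounded_clinear_linear[OF group_clinear]] by simp
next
  case (Suc k)
  have V: "bounded_linear (Vs ! k)" using Suc.prems(1) by (intro bounded_clinear_linear Vs) simp
  have "(\<lambda>r. trunc (G r) ((Vs ! k) (trunc (G r) (diag_group B d (t * \<sigma> (Suc k)) (y r))))) \<longlonglongrightarrow> (Vs ! k) (diag_group B d (t * \<sigma> (Suc k)) y0)"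
    by (intro trunc_tendsto[OF G ex] bounded_linear.tendsto[OF V]
        bounded_linear.tendsto[OF bounded_clinear_linear[OF group_clinear]] Suc.prems(2))
  from Suc.IH[OF _ this] Suc.prems(1) show ?case by simp
qed

lemma moi_word_trunc_matrix:
  assumes G: "finite G" "G \<subseteq> B" and Vs: "\<And>V. V \<in> set Vs \<Longrightarrow> bounded_clinear V" and K: "K \<noteq> 0"
    and i: "i \<in> G"
  shows "k \<le> length Vs \<Longrightarrow> j \<in> G \<Longrightarrow>
    cinner i (moi_word (diag_group B d) (map (\<lambda>V. trunc G \<circ> V \<circ> trunc G) Vs) t \<sigma> k j)
    = of_real (K ^ k) * schur_sum G d (\<lambda>k. matrix_of K (Vs ! k)) k (\<lambda>x. iexp (t * (\<Sum>l\<le>k. \<sigma> l * x l))) i j"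
proof (induction k arbitrary: j)
  case 0
  have "j \<in> B" "i \<in> B" using 0 G i by auto
  then show ?case using orthonormal_eigenbasis by (auto simp: group_eigenvector cinner_scaleC_right orthonormal_def mult_ac)
next
  case (Suc k)
  let ?Vs = "map (\<lambda>V. trunc G \<circ> V \<circ> trunc G) Vs"
  have jB: "j \<in> B" using Suc.prems G by auto
  have k: "k < length Vs" using Suc.prems by simp
  have mK: "of_real K * matrix_of K (Vs ! k) l j = cinner l ((Vs ! k) j)" for l
    using K by (simp add: matrix_of_def)
  have V: "bounded_clinear (Vs ! k)" using k by (intro Vs) simp
  have tc: "bounded_clinear (trunc G)" by (rule trunc_bounded_clinear[OF orthonormal_eigenbasis G])
  have wc: "bounded_clinear (moi_word (diag_group B d) ?Vs t \<sigma> k)"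
    using k Vs by (intro moi_word_clinear) (auto intro!: bounded_clinear_compose tc)
  have "moi_word (diag_group B d) ?Vs t \<sigma> (Suc k) j = moi_word (diag_group B d) ?Vs t \<sigma> k (trunc G ((Vs ! k) (trunc G (diag_group B d (t * \<sigma> (Suc k)) j))))"
    using k by simp
  also have "trunc G (diag_group B d (t * \<sigma> (Suc k)) j) = iexp (t * \<sigma> (Suc k) * d j) *\<^sub>C j"
    by (simp add: group_eigenvector[OF jB] bounded_clinear_scaleC[OF tc] trunc_basis[OF orthonormal_eigenbasis G Suc.prems(2)])
  also have "trunc G ((Vs ! k) (iexp (t * \<sigma> (Suc k) * d j) *\<^sub>C j))
      = (\<Sum>l\<in>G. (iexp (t * \<sigma> (Suc k) * d j) * cinner l ((Vs ! k) j)) *\<^sub>C l)"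
    by (simp add: trunc_def bounded_clinear_scaleC[OF V] cinner_scaleC_right)
  finally have step: "moi_word (diag_group B d) ?Vs t \<sigma> (Suc k) j = moi_word (diag_group B d) ?Vs t \<sigma> k
      (\<Sum>l\<in>G. (iexp (t * \<sigma> (Suc k) * d j) * cinner l ((Vs ! k) j)) *\<^sub>C l)" .
  have "cinner i (moi_word (diag_group B d) ?Vs t \<sigma> (Suc k) j)
      = (\<Sum>l\<in>G. iexp (t * \<sigma> (Suc k) * d j) * cinner l ((Vs ! k) j) * cinner i (moi_word (diag_group B d) ?Vs t \<sigma> k l))"
    unfolding step bounded_clinear_sum[OF wc] bounded_clinear_scaleC[OF wc] cinner_sum_right cinner_scaleC_right ..
  also have "\<dots> = (\<Sum>l\<in>G. iexp (t * \<sigma> (Suc k) * d j) * (of_real K * matrix_of K (Vs ! k) l j) * (of_real (K ^ k) *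
      schur_sum G d (\<lambda>k. matrix_of K (Vs ! k)) k (\<lambda>x. iexp (t * (\<Sum>l\<le>k. \<sigma> l * x l))) i l))"
    by (intro sum.cong refl) (simp only: Suc.IH[OF less_imp_le[OF k]] mK)
  also have "\<dots> = of_real (K ^ Suc k) * schur_sum G d (\<lambda>k. matrix_of K (Vs ! k)) (Suc k) (\<lambda>x. iexp (t * (\<Sum>l\<le>Suc k. \<sigma> l * x l))) i j"
  proof -
    have "(\<Sum>l\<in>G. u * (c * m l) * (c' * S l)) = c * c' * ((\<Sum>l\<in>G. S l * m l) * u)" for u c c' :: complex and m S :: "'h \<Rightarrow> complex"
      by (simp add: sum_distrib_left sum_distrib_right mult_ac)
    then show ?thesis unfolding schur_sum_exp_Suc power_Suc of_real_mult[of K] .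
  qed
  finally show ?case .
qed

lemma finite_exhaustion:
  assumes "countable B" "B \<noteq> {}"
  shows "\<exists>G. (\<forall>r::nat. finite (G r) \<and> G r \<subseteq> B) \<and> (\<forall>F. finite F \<longrightarrow> F \<subseteq> B \<longrightarrow> (\<forall>\<^sub>F r in sequentially. F \<subseteq> G r))
     \<and> (\<forall>y. (\<lambda>r. trunc (G r) y) \<longlonglongrightarrow> y)"
proof -
  define G where "G r = from_nat_into B ` {..r}" for r :: nat
  have fin: "finite (G r)" "G r \<subseteq> B" for r
    unfolding G_def using from_nat_into[OF assms(2)] by auto
  have ev: "\<forall>\<^sub>F r in sequentially. F \<subseteq> G r" if F: "finite F" "F \<subseteq> B" for F
  proof -
    have "\<forall>\<^sub>F r in sequentially. x \<in> G r" if "x \<in> F" for x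
    proof -
      obtain m where "from_nat_into B m = x" using from_nat_into_surj[OF assms(1)] F \<open>x \<in> F\<close> by blast
      then have "x \<in> G r" if "r \<ge> m" for r using that unfolding G_def by auto
      then show ?thesis unfolding eventually_sequentially by blast
    qed
    then have "\<forall>\<^sub>F r in sequentially. \<forall>x\<in>F. x \<in> G r" using F(1) by (simp add: eventually_ball_finite)
    then show ?thesis by (simp add: subset_eq)
  qed
  have "(\<lambda>r. trunc (G r) y) \<longlonglongrightarrow> y" for y
  proof -
    have "filterlim G (finite_subsets_at_top B) sequentially"
      unfolding filterlim_def le_filter_def eventually_filtermap
    proof (intro allI impI)
      fix P assume "eventually P (finite_subsets_at_top B)"
      then obtain X where X: "finite X" "X \<subseteq> B" "\<And>Y. finite Y \<Longrightarrow> X \<subseteq> Y \<Longrightarrow> Y \<subseteq> B \<Longrightarrow> P Y"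
        by (auto simp: eventually_finite_subsets_at_top)
      from ev[OF X(1,2)] show "\<forall>\<^sub>F r in sequentially. P (G r)"
        by eventually_elim (use X(3) fin in auto)
    qed
    with onb_expansion[OF B, of y] show ?thesis
      unfolding has_sum_def trunc_def by (rule filterlim_compose)
  qed
  then show ?thesis using fin ev by blast
qed

lemma scaleC_measurable:
  assumes "c \<in> borel_measurable M" "y \<in> borel_measurable M"
  shows "(\<lambda>w. c w *\<^sub>C (y w :: 'h)) \<in> borel_measurable M"
proof -
  have "continuous_on UNIV (\<lambda>p. fst p *\<^sub>C (snd p :: 'h))"
    by (intro bounded_bilinear.continuous_on[OF bounded_bilinear_scaleC] continuous_intros)
  from borel_measurable_continuous_on[OF this borel_measurable_Pair[OF assms]] show ?thesis by simp
qed

lemma moi_word_simplex_measurable: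
  assumes Vs: "\<And>V. V \<in> set Vs \<Longrightarrow> bounded_clinear V" and n: "n = length Vs"
  shows "(\<lambda>p. moi_word (diag_group B d) Vs (snd p) (fst p) n y) \<in> borel_measurable (simplex_measure n \<Otimes>\<^sub>M lborel)"
proof (rule moi_word_measurable[OF Vs])
  fix j assume "j \<le> n"
  then have "(\<lambda>\<sigma>. \<sigma> j) \<in> borel_measurable (simplex_measure n)"
    unfolding measurable_cong_sets[OF sets_simplex_measure refl] by (intro measurable_component_singleton) auto
  then show "(\<lambda>p. snd p * fst p j) \<in> borel_measurable (simplex_measure n \<Otimes>\<^sub>M lborel)"
    by (intro borel_measurable_times measurable_compose[OF measurable_fst]) auto
qed (use n in auto)

lemma moi_word_line_measurable:
  assumes Vs: "\<And>V. V \<in> set Vs \<Longrightarrow> bounded_clinear V" and n: "n = length Vs"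
  shows "(\<lambda>t. moi_word (diag_group B d) Vs t \<sigma> n y) \<in> borel_measurable lborel"
  by (rule moi_word_measurable[OF Vs]) (use n in auto)

context
  fixes h :: "real \<Rightarrow> complex" and Vs :: "('h \<Rightarrow> 'h) list" and n :: nat and K :: real
  assumes h: "integrable lborel h" and n: "n = length Vs"
    and Vs_all: "\<forall>V\<in>set Vs. bounded_clinear V" and K_pos: "K > 0"
    and K_all: "\<forall>V\<in>set Vs. \<forall>x. norm (V x) \<le> K * norm x"
begin

lemma entry_clinear: "V \<in> set Vs \<Longrightarrow> bounded_clinear V"
  and entry_norm: "V \<in> set Vs \<Longrightarrow> norm (V x) \<le> K * norm x"
  using Vs_all K_all by auto

lemma h_measurable: "h \<in> borel_measurable borel" "h \<in> borel_measurable lborel" using h by auto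

lemma moi_integrand_norm: "norm (h t *\<^sub>C moi_word (diag_group B d) Vs t \<sigma> n y) \<le> cmod (h t) * (K ^ n * norm y)"
  unfolding norm_scaleC using K_pos entry_norm n by (intro mult_left_mono moi_word_norm) auto

lemma moi_bound_integrable: "integrable lborel (\<lambda>t. cmod (h t) * c)"
  by (intro integrable_mult_left integrable_norm h)

lemma moi_inner_integrable: "integrable lborel (\<lambda>t. h t *\<^sub>C moi_word (diag_group B d) Vs t \<sigma> n y)"
proof (rule Bochner_Integration.integrable_bound[OF moi_bound_integrable])
  show "(\<lambda>t. h t *\<^sub>C moi_word (diag_group B d) Vs t \<sigma> n y) \<in> borel_measurable lborel"
    by (intro scaleC_measurable moi_word_line_measurable entry_clinear n h_measurable)
  show "AE t in lborel. norm (h t *\<^sub>C moi_word (diag_group B d) Vs t \<sigma> n y) \<le> norm (cmod (h t) * (K ^ n * norm y))"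
    using moi_integrand_norm K_pos by (intro AE_I2) auto
qed

lemma moi_inner_norm:
  "norm (\<integral>t. h t *\<^sub>C moi_word (diag_group B d) Vs t \<sigma> n y \<partial>lborel) \<le> (\<integral>t. cmod (h t) \<partial>lborel) * (K ^ n * norm y)"
proof -
  have "norm (\<integral>t. h t *\<^sub>C moi_word (diag_group B d) Vs t \<sigma> n y \<partial>lborel)
      \<le> (\<integral>t. norm (h t *\<^sub>C moi_word (diag_group B d) Vs t \<sigma> n y) \<partial>lborel)" by (rule integral_norm_bound)
  also have "\<dots> \<le> (\<integral>t. cmod (h t) * (K ^ n * norm y) \<partial>lborel)"
    using K_pos by (intro integral_mono_AE' AE_I2 moi_bound_integrable moi_integrand_norm) auto
  finally show ?thesis by simp
qed

lemma moi_inner_measurable: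
  "(\<lambda>\<sigma>. \<integral>t. h t *\<^sub>C moi_word (diag_group B d) Vs t \<sigma> n y \<partial>lborel) \<in> borel_measurable (simplex_measure n)"
proof (rule lborel.borel_measurable_lebesgue_integral)
  show "(\<lambda>(\<sigma>, t). h t *\<^sub>C moi_word (diag_group B d) Vs t \<sigma> n y) \<in> borel_measurable (simplex_measure n \<Otimes>\<^sub>M lborel)"
    unfolding case_prod_beta'
    by (intro scaleC_measurable moi_word_simplex_measurable entry_clinear n measurable_compose[OF measurable_snd] h_measurable)
qed

lemma moi_outer_integrable:
  "integrable (simplex_measure n) (\<lambda>\<sigma>. \<integral>t. h t *\<^sub>C moi_word (diag_group B d) Vs t \<sigma> n y \<partial>lborel)"
proof -
  interpret finite_measure "simplex_measure n" by (rule finite_simplex_measure)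
  show ?thesis by (rule integrable_const_bound[OF AE_I2 moi_inner_measurable]) (rule moi_inner_norm)
qed

lemma cinner_moi_integral:
  "cinner e (\<integral>\<sigma>. \<integral>t. h t *\<^sub>C moi_word (diag_group B d) Vs t \<sigma> n y \<partial>lborel \<partial>simplex_measure n)
    = (\<integral>\<sigma>. \<integral>t. h t * cinner e (moi_word (diag_group B d) Vs t \<sigma> n y) \<partial>lborel \<partial>simplex_measure n)"
proof -
  have "cinner e (\<integral>\<sigma>. \<integral>t. h t *\<^sub>C moi_word (diag_group B d) Vs t \<sigma> n y \<partial>lborel \<partial>simplex_measure n)
      = (\<integral>\<sigma>. cinner e (\<integral>t. h t *\<^sub>C moi_word (diag_group B d) Vs t \<sigma> n y \<partial>lborel) \<partial>simplex_measure n)"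
    by (rule integral_bounded_linear[OF bounded_linear_cinner_right moi_outer_integrable, symmetric])
  moreover have "cinner e (\<integral>t. h t *\<^sub>C moi_word (diag_group B d) Vs t \<sigma> n y \<partial>lborel)
      = (\<integral>t. h t * cinner e (moi_word (diag_group B d) Vs t \<sigma> n y) \<partial>lborel)" for \<sigma>
    using integral_bounded_linear[OF bounded_linear_cinner_right moi_inner_integrable, of e \<sigma> y]
    by (simp add: cinner_scaleC_right)
  ultimately show ?thesis by simp
qed

end

lemma moi_truncation_limit:
  assumes h: "integrable lborel h" and n: "n = length Vs"
    and Vs: "\<And>V. V \<in> set Vs \<Longrightarrow> bounded_clinear V" and K: "K > 0" "\<And>V x. V \<in> set Vs \<Longrightarrow> norm (V x) \<le> K * norm x"
    and G: "\<And>r. finite (G r)" "\<And>r. G r \<subseteq> B" and ex: "\<And>y. (\<lambda>r. trunc (G r) y) \<longlonglongrightarrow> y"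
  shows "(\<lambda>r. \<integral>\<sigma>. \<integral>t. h t *\<^sub>C moi_word (diag_group B d) (map (\<lambda>V. trunc (G r) \<circ> V \<circ> trunc (G r)) Vs) t \<sigma> n y \<partial>lborel \<partial>simplex_measure n)
    \<longlonglongrightarrow> (\<integral>\<sigma>. \<integral>t. h t *\<^sub>C moi_word (diag_group B d) Vs t \<sigma> n y \<partial>lborel \<partial>simplex_measure n)"
proof -
  let ?Vs = "\<lambda>r. map (\<lambda>V. trunc (G r) \<circ> V \<circ> trunc (G r)) Vs"
  interpret finite_measure "simplex_measure n" by (rule finite_simplex_measure)
  have VsA: "\<forall>V\<in>set Vs. bounded_clinear V" and KA: "\<forall>V\<in>set Vs. \<forall>x. norm (V x) \<le> K * norm x"
    using Vs K by auto
  have n': "n = length (?Vs r)" for r using n by simp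
  have Vs': "bounded_clinear V" if "V \<in> set (?Vs r)" for V r
    using that Vs by (auto intro!: bounded_clinear_compose trunc_bounded_clinear[OF orthonormal_eigenbasis G])
  have K': "norm (V x) \<le> K * norm x" if "V \<in> set (?Vs r)" for V x r
    using that K compression_norm[OF orthonormal_eigenbasis G, of K] by (auto simp del: comp_apply)
  have VsA': "\<forall>V\<in>set (?Vs r). bounded_clinear V" and KA': "\<forall>V\<in>set (?Vs r). \<forall>x. norm (V x) \<le> K * norm x" for r
    using Vs' K' by blast+
  have inner: "(\<lambda>r. \<integral>t. h t *\<^sub>C moi_word (diag_group B d) (?Vs r) t \<sigma> n y \<partial>lborel)
      \<longlonglongrightarrow> (\<integral>t. h t *\<^sub>C moi_word (diag_group B d) Vs t \<sigma> n y \<partial>lborel)" for \<sigma>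
  proof (rule integral_dominated_convergence[where w = "\<lambda>t. cmod (h t) * (K ^ n * norm y)"])
    show "integrable lborel (\<lambda>t. cmod (h t) * (K ^ n * norm y))" by (intro integrable_mult_left integrable_norm h)
    show "(\<lambda>t. h t *\<^sub>C moi_word (diag_group B d) (?Vs r) t \<sigma> n y) \<in> borel_measurable lborel" for r
      using moi_inner_integrable[OF h n' VsA' K(1) KA'] by (rule borel_measurable_integrable)
    show "(\<lambda>t. h t *\<^sub>C moi_word (diag_group B d) Vs t \<sigma> n y) \<in> borel_measurable lborel"
      using moi_inner_integrable[OF h n VsA K(1) KA] by (rule borel_measurable_integrable)
    show "AE t in lborel. norm (h t *\<^sub>C moi_word (diag_group B d) (?Vs r) t \<sigma> n y) \<le> cmod (h t) * (K ^ n * norm y)" for r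
      by (intro AE_I2 moi_integrand_norm[OF h n' VsA' K(1) KA'])
    show "AE t in lborel. (\<lambda>r. h t *\<^sub>C moi_word (diag_group B d) (?Vs r) t \<sigma> n y) \<longlonglongrightarrow> h t *\<^sub>C moi_word (diag_group B d) Vs t \<sigma> n y"
      using n by (intro AE_I2 tendsto_scaleC tendsto_const moi_word_trunc_tendsto[OF G ex Vs]) auto
  qed
  show ?thesis
  proof (rule integral_dominated_convergence[where w = "\<lambda>_. (\<integral>t. cmod (h t) \<partial>lborel) * (K ^ n * norm y)"])
    show "(\<lambda>\<sigma>. \<integral>t. h t *\<^sub>C moi_word (diag_group B d) (?Vs r) t \<sigma> n y \<partial>lborel) \<in> borel_measurable (simplex_measure n)" for r
      by (rule moi_inner_measurable[OF h n' VsA' K(1) KA'])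
    show "(\<lambda>\<sigma>. \<integral>t. h t *\<^sub>C moi_word (diag_group B d) Vs t \<sigma> n y \<partial>lborel) \<in> borel_measurable (simplex_measure n)"
      by (rule moi_inner_measurable[OF h n VsA K(1) KA])
    show "AE \<sigma> in simplex_measure n. norm (\<integral>t. h t *\<^sub>C moi_word (diag_group B d) (?Vs r) t \<sigma> n y \<partial>lborel)
        \<le> (\<integral>t. cmod (h t) \<partial>lborel) * (K ^ n * norm y)" for r
      by (intro AE_I2 moi_inner_norm[OF h n' VsA' K(1) KA'])
  qed (auto intro: inner)
qed

lemma schur_sum_cong: "(\<And>k. k < n \<Longrightarrow> V k = V' k) \<Longrightarrow> schur_sum G d V n L i j = schur_sum G d V' n L i j"
  by (induction n arbitrary: L j) simp_all

text \<open>
  After truncation, the partial trace over \<open>F\<close> is the trace against the diagonal projection onto \<open>F\<close>, a word without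
  letters. The factor \<open>K\<^sup>n\<close> that was split off to make the entries contractions cancels against \<open>\<Gamma> / K\<^sup>n\<close>, so the bound
  is the same for lists of all lengths.
\<close>

lemma moi_partial_trace_le:
  fixes f :: "real \<Rightarrow> complex" and s :: nat and Vs :: "('h \<Rightarrow> 'h) list"
  assumes f: "smooth f" and s: "s \<ge> 1"
    and h: "\<And>m n. m \<le> s \<Longrightarrow> has_L1_fourier (nth_deriv n (\<lambda>x. f x * (of_real x - \<i>) ^ m)) (fourier (nth_deriv n (\<lambda>x. f x * (of_real x - \<i>) ^ m)))"
    and W: "\<And>m n. m \<le> s \<Longrightarrow> (\<integral>t. cmod (fourier (nth_deriv n (\<lambda>x. f x * (of_real x - \<i>) ^ m)) t) \<partial>lborel) / fact n \<le> \<Gamma> / K ^ n"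
    and \<Gamma>: "\<Gamma> \<ge> 0" and Vs: "\<And>V. V \<in> set Vs \<Longrightarrow> bounded_clinear V"
    and K: "K > 0" "\<And>V x. V \<in> set Vs \<Longrightarrow> norm (V x) \<le> K * norm x"
    and \<tau>: "\<And>F. finite F \<Longrightarrow> F \<subseteq> B \<Longrightarrow> (\<Sum>e\<in>F. (1 / cmod (complex_of_real (d e) - \<i>)) ^ s) \<le> \<tau>"
    and F: "finite F" "F \<subseteq> B" and cB: "countable B"
  shows "cmod (\<Sum>e\<in>F. cinner e (moi D f Vs e)) \<le> \<tau> * \<Gamma> * (1 + K) ^ s"
proof (cases "F = {}")
  case True
  then show ?thesis using \<tau>[of "{}"] \<Gamma> K(1) by simp
next
  case False
  then have "B \<noteq> {}" using F by auto
  from finite_exhaustion[OF cB this] obtain G where G0: "\<forall>r::nat. finite (G r) \<and> G r \<subseteq> B"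
    "\<forall>F. finite F \<longrightarrow> F \<subseteq> B \<longrightarrow> (\<forall>\<^sub>F r in sequentially. F \<subseteq> G r)" "\<forall>y. (\<lambda>r. trunc (G r) y) \<longlonglongrightarrow> y"
    by (elim exE conjE)
  then have G: "\<And>r. finite (G r)" "\<And>r. G r \<subseteq> B" "\<forall>\<^sub>F r in sequentially. F \<subseteq> G r"
    and ex: "\<And>y. (\<lambda>r. trunc (G r) y) \<longlonglongrightarrow> y" using F by simp_all
  define g where "g m = (\<lambda>x. f x * (of_real x - \<i>) ^ m)" for m
  have g0: "g 0 = f" by (simp add: g_def)
  have g_Suc: "g (Suc m) = (\<lambda>x. g m x * (of_real x - \<i>))" for m by (simp add: g_def mult_ac)
  have sm: "smooth (g m)" for m by (induction m) (simp_all add: g0 f g_Suc smooth_mult_linear)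
  define hh where "hh m n = fourier (nth_deriv n (g m))" for m n
  have hh: "has_L1_fourier (nth_deriv n (g m)) (hh m n)" if "m \<le> s" for m n
    using h[OF that] unfolding hh_def g_def .
  define n where "n = length Vs"
  let ?h = "hh 0 n" and ?Vs = "\<lambda>r. map (\<lambda>V. trunc (G r) \<circ> V \<circ> trunc (G r)) Vs"
  have ih: "integrable lborel ?h" using hh[of 0 n] by (simp add: has_L1_fourier_def)
  define V where "V G k = (if k < n then matrix_of K (Vs ! k) else identity_mat)" for G :: "'h set" and k
  have Vc: "contraction (G r) (V (G r) k)" for r k
  proof (cases "k < n")
    case True
    then have "Vs ! k \<in> set Vs" by (simp add: n_def)
    then show ?thesis unfolding V_def using True matrix_of_contr[OF orthonormal_eigenbasis G(1,2) Vs K(1)] K(2) by auto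
  qed (simp add: V_def contraction_identity_mat[OF G(1)])
  define I where "I Vs e = (\<integral>\<sigma>. \<integral>t. ?h t *\<^sub>C moi_word (diag_group B d) Vs t \<sigma> n e \<partial>lborel \<partial>simplex_measure n)" for Vs and e :: 'h
  have moi: "moi D f Vs e = I Vs e" for e
    unfolding moi_def I_def Let_def exp_i_eq_diag_group[OF sa B D] n_def[symmetric] hh_def g0 ..
  have lim: "(\<lambda>r. \<Sum>e\<in>F. cinner e (I (?Vs r) e)) \<longlonglongrightarrow> (\<Sum>e\<in>F. cinner e (moi D f Vs e))"
  proof -
    have "(\<lambda>r. I (?Vs r) e) \<longlonglongrightarrow> I Vs e" for e
      unfolding I_def
      by (rule moi_truncation_limit[where G = G and K = K]) (rule ih n_def K(1) G(1,2) ex | erule Vs K(2))+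
    then show ?thesis unfolding moi by (intro tendsto_sum tendsto_cinner tendsto_const)
  qed
  have entry: "cinner i (I (?Vs r) j) = of_real (K ^ n) * schur_sum (G r) d (V (G r)) n (div_diff (g 0) n) i j"
    if ij: "i \<in> G r" "j \<in> G r" for i j r
  proof -
    let ?E = "\<lambda>t \<sigma>. schur_sum (G r) d (V (G r)) n (\<lambda>x. iexp (t * (\<Sum>l\<le>n. \<sigma> l * x l))) i j"
    have n': "n = length (?Vs r)" by (simp add: n_def)
    have Vs': "bounded_clinear V" if "V \<in> set (?Vs r)" for V
      using that Vs by (auto intro!: bounded_clinear_compose trunc_bounded_clinear[OF orthonormal_eigenbasis G(1,2)])
    have K': "norm (V x) \<le> K * norm x" if "V \<in> set (?Vs r)" for V x
      using that K compression_norm[OF orthonormal_eigenbasis G(1,2), of K] by (auto simp del: comp_apply)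
    have VsA': "\<forall>V\<in>set (?Vs r). bounded_clinear V" and KA': "\<forall>V\<in>set (?Vs r). \<forall>x. norm (V x) \<le> K * norm x"
      using Vs' K' by blast+
    have E: "cinner i (moi_word (diag_group B d) (?Vs r) t \<sigma> n j) = of_real (K ^ n) * ?E t \<sigma>" for t \<sigma>
    proof -
      have "cinner i (moi_word (diag_group B d) (?Vs r) t \<sigma> n j)
        = of_real (K ^ n) * schur_sum (G r) d (\<lambda>k. matrix_of K (Vs ! k)) n (\<lambda>x. iexp (t * (\<Sum>l\<le>n. \<sigma> l * x l))) i j"
        using K(1) ij by (intro moi_word_trunc_matrix[OF G(1,2) Vs]) (auto simp: n_def)
      also have "schur_sum (G r) d (\<lambda>k. matrix_of K (Vs ! k)) n (\<lambda>x. iexp (t * (\<Sum>l\<le>n. \<sigma> l * x l))) i j = ?E t \<sigma>"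
        by (rule schur_sum_cong) (simp add: V_def)
      finally show ?thesis .
    qed
    have "cinner i (I (?Vs r) j) = (\<integral>\<sigma>. \<integral>t. ?h t * (of_real (K ^ n) * ?E t \<sigma>) \<partial>lborel \<partial>simplex_measure n)"
      unfolding I_def cinner_moi_integral[OF ih n' VsA' K(1) KA'] E ..
    also have "\<dots> = (\<integral>\<sigma>. \<integral>t. of_real (K ^ n) * (?E t \<sigma> * ?h t) \<partial>lborel \<partial>simplex_measure n)"
      by (simp only: mult_ac)
    also have "\<dots> = of_real (K ^ n) * (\<integral>\<sigma>. \<integral>t. ?E t \<sigma> * ?h t \<partial>lborel \<partial>simplex_measure n)"
      by (simp only: integral_mult_right_zero)
    also have "(\<integral>\<sigma>. \<integral>t. ?E t \<sigma> * ?h t \<partial>lborel \<partial>simplex_measure n) = schur_sum (G r) d (V (G r)) n (div_diff (g 0) n) i j"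
      by (rule schur_div_diff_integral(1)[where g = g and h = hh and V = "V (G r)" and s = s, symmetric])
        (rule G(1) Vc sm g_Suc le0 | erule hh)+
    finally show ?thesis .
  qed
  have bound: "cmod (\<Sum>e\<in>F. cinner e (I (?Vs r) e)) \<le> \<tau> * \<Gamma> * (1 + K) ^ s" if r: "F \<subseteq> G r" for r
  proof -
    let ?T = "schur_sum (G r) d (V (G r)) n (div_diff (g 0) n)"
    let ?X = "\<lambda>i j. if i = j then (if i \<in> F then 1 else 0) else (0::complex)"
    have X: "word (G r) (\<lambda>j. cmod (1 / (complex_of_real (d j) - \<i>))) 0 ?X"
      by (intro word_contraction contraction_diag[OF G(1)]) simp
    have "mat_mult (G r) ?T ?X i i = (if i \<in> F then ?T i i else 0)" if "i \<in> G r" for i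
    proof -
      have "mat_mult (G r) ?T ?X i i = (\<Sum>j\<in>G r. if j = i then (if i \<in> F then ?T i i else 0) else 0)"
        unfolding mat_mult_def by (intro sum.cong) auto
      then show ?thesis using G(1) that by simp
    qed
    then have "mtrace (G r) (mat_mult (G r) ?T ?X) = (\<Sum>i\<in>G r. if i \<in> F then ?T i i else 0)"
      unfolding mtrace_def by (intro sum.cong) auto
    also have "\<dots> = (\<Sum>i\<in>F. ?T i i)" using G(1) r by (simp add: sum.inter_restrict[symmetric] Int_absorb1)
    finally have tr: "(\<Sum>e\<in>F. cinner e (I (?Vs r) e)) = of_real (K ^ n) * mtrace (G r) (mat_mult (G r) ?T ?X)"
      using r by (simp add: sum_distrib_left entry subset_iff)
    have "cmod (mtrace (G r) (mat_mult (G r) ?T ?X)) \<le> (\<Sum>i\<in>G r. cmod (1 / (complex_of_real (d i) - \<i>)) ^ s) * \<Gamma> * (1 + K) ^ s / K ^ n"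
    proof (rule trace_div_diff_le[where g = g and h = hh and V = "V (G r)" and s = s and m = 0 and k = 0 and q = s])
      show "(\<integral>t. cmod (hh m n t) \<partial>lborel) / fact n \<le> \<Gamma> / K ^ n" if "m \<le> s" for m n
        using W[OF that] unfolding hh_def g_def .
    qed (rule G(1) Vc sm g_Suc s K(1) \<Gamma> X | erule hh | simp)+
    also have "\<dots> \<le> \<tau> * \<Gamma> * (1 + K) ^ s / K ^ n"
      using \<tau>[OF G(1,2)] \<Gamma> K(1) by (intro divide_right_mono mult_right_mono) (auto simp: norm_divide)
    finally show ?thesis unfolding tr norm_mult using K(1) by (simp add: norm_power field_simps)
  qed
  show ?thesis
  proof (rule tendsto_upperbound[OF tendsto_norm[OF lim]])
    show "\<forall>\<^sub>F r in sequentially. cmod (\<Sum>e\<in>F. cinner e (I (?Vs r) e)) \<le> \<tau> * \<Gamma> * (1 + K) ^ s"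
      using G(3) by eventually_elim (rule bound)
  qed simp
qed

end

section \<open>The estimate for the cochains\<close>

text \<open>
  With \<open>a = A\<^bsup>1/\<delta>\<^esup>\<close> the left-hand side is \<open>(a\<^sup>n / n!)\<^sup>\<delta>\<close>, and \<open>a\<^sup>n / n! \<le> exp a\<close>.
\<close>

lemma power_over_fact_powr_bounded:
  fixes A \<delta> :: real
  assumes A: "A > 0" and \<delta>: "\<delta> > 0"
  shows "A ^ n * fact n powr (- \<delta>) \<le> exp (A powr (1 / \<delta>)) powr \<delta>"
proof -
  define a where "a = A powr (1 / \<delta>)"
  have a: "a > 0" using A by (simp add: a_def)
  have "(\<Sum>i\<in>{n}. a ^ i /\<^sub>R fact i) \<le> (\<Sum>i. a ^ i /\<^sub>R fact i)"
    using a by (intro sum_le_suminf summable_exp_generic) auto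
  then have le: "a ^ n / fact n \<le> exp a" by (simp add: exp_def divide_inverse mult.commute)
  have "A ^ n = (a powr \<delta>) powr n" using A \<delta> by (simp add: a_def powr_powr powr_realpow)
  also have "\<dots> = (a ^ n) powr \<delta>"
    unfolding powr_realpow[OF a, symmetric] powr_powr by (simp only: mult.commute)
  finally have An: "A ^ n = (a ^ n) powr \<delta>" .
  have "(a ^ n / fact n) powr \<delta> = (a ^ n) powr \<delta> / fact n powr \<delta>" by (rule powr_divide)
  then have "A ^ n * fact n powr (- \<delta>) = (a ^ n / fact n) powr \<delta>"
    by (simp only: An powr_minus divide_inverse)
  also have "\<dots> \<le> exp a powr \<delta>" using le a \<delta> by (intro powr_mono2) auto
  finally show ?thesis by (simp add: a_def)
qed

text \<open>
  This is where \<open>\<gamma> < 1\<close> matters: \<open>C\<^bsup>n+1\<^esup> (n!)\<^bsup>\<gamma>-1\<^esup>\<close> decays faster than every geometric sequence.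
\<close>

lemma E_class_bound:
  assumes f: "f \<in> E_class s \<gamma>" and \<gamma>: "\<gamma> < 1" and K: "K > 0"
  shows "\<exists>\<Gamma>\<ge>0. \<forall>m\<le>s. \<forall>n. has_L1_fourier (nth_deriv n (\<lambda>x. f x * (of_real x - \<i>) ^ m)) (fourier (nth_deriv n (\<lambda>x. f x * (of_real x - \<i>) ^ m)))
    \<and> (\<integral>t. cmod (fourier (nth_deriv n (\<lambda>x. f x * (of_real x - \<i>) ^ m)) t) \<partial>lborel) / fact n \<le> \<Gamma> / K ^ n"
proof -
  obtain C where C: "C \<ge> 1" and fC: "\<And>m n. m \<le> s \<Longrightarrow>
      (\<exists>h. has_L1_fourier (nth_deriv n (\<lambda>x. f x * (of_real x - \<i>) ^ m)) h) \<and>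
      (\<integral>x. cmod (fourier (nth_deriv n (\<lambda>x. f x * (of_real x - \<i>) ^ m)) x) \<partial>lborel) \<le> C ^ (n + 1) * fact n powr \<gamma>"
    using f unfolding E_class_def Let_def by blast
  define \<Gamma> where "\<Gamma> = C * exp ((C * K) powr (1 / (1 - \<gamma>))) powr (1 - \<gamma>)"
  have "\<Gamma> \<ge> 0" using C by (simp add: \<Gamma>_def)
  moreover have "has_L1_fourier g (fourier g)" if "\<exists>h. has_L1_fourier g h" for g
    using someI_ex[OF that] unfolding fourier_def .
  moreover have "w / fact n \<le> \<Gamma> / K ^ n" if w: "w \<le> C ^ (n + 1) * fact n powr \<gamma>" for w n
  proof -
    have "(C * K) ^ n * fact n powr (- (1 - \<gamma>)) \<le> exp ((C * K) powr (1 / (1 - \<gamma>))) powr (1 - \<gamma>)"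
      using C K \<gamma> by (intro power_over_fact_powr_bounded) auto
    then have le: "C * ((C * K) ^ n * fact n powr (\<gamma> - 1)) \<le> \<Gamma>"
      unfolding \<Gamma>_def using C by (intro mult_left_mono) auto
    have "w / fact n \<le> C ^ (n + 1) * fact n powr \<gamma> / fact n" using w by (intro divide_right_mono) auto
    also have "\<dots> = C ^ (n + 1) * fact n powr (\<gamma> - 1)" by (simp add: powr_diff)
    also have "\<dots> = C * ((C * K) ^ n * fact n powr (\<gamma> - 1)) / K ^ n" using K by (simp add: power_mult_distrib)
    also have "\<dots> \<le> \<Gamma> / K ^ n" using le K by (intro divide_right_mono) auto
    finally show ?thesis .
  qed
  ultimately show ?thesis using fC by (intro exI[of _ \<Gamma>]) blast
qed

text \<open>
  The value of a definite description that no number satisfies does not depend on \<open>T\<close>. It serves as the bound in the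
  case that \<open>T\<close> has no trace.
\<close>

lemma op_trace_le:
  assumes B: "orthonormal_basis B"
    and C: "\<And>F. finite F \<Longrightarrow> F \<subseteq> B \<Longrightarrow> cmod (\<Sum>e\<in>F. cinner e (T e)) \<le> C"
  shows "cmod (op_trace T) \<le> max C (cmod (THE c. False))"
proof (cases "\<exists>c. has_trace T c")
  case True
  then obtain c where c: "has_trace T c" by blast
  have "((\<lambda>e. cinner e (T e)) has_sum c') B" if "has_trace T c'" for c'
    using that B by (simp add: has_trace_def)
  then have "op_trace T = c"
    unfolding op_trace_def using c has_sum_unique by (intro the_equality) blast+
  moreover have "cmod c \<le> C"
    using c B by (intro has_sum_norm_le[OF _ C]) (auto simp: has_trace_def)
  ultimately show ?thesis by simp
next
  case False
  then have "has_trace T = (\<lambda>_. False)" by auto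
  then show ?thesis unfolding op_trace_def by simp
qed

text \<open>
  The constant depends on \<open>D\<close>, \<open>f\<close>, \<open>s\<close> and \<open>K\<close>, but not on the length of the list; the factor in front counts the
  cyclic rotations.
\<close>

lemma bracket_bound:
  fixes D :: "'h::{chilbert_space, second_countable_topology} \<rightharpoonup> 'h"
  assumes s: "s \<ge> 1" and sa: "self_adjoint D" and sch: "resolvent_i D \<in> schatten s"
    and f: "f \<in> E_class s \<gamma>" and \<gamma>: "\<gamma> < 1" and K: "K > 0"
  shows "\<exists>C\<ge>0. \<forall>Vs. (\<forall>V\<in>set Vs. bounded_clinear V \<and> onorm V \<le> K) \<longrightarrow> cmod (bracket D f Vs) \<le> real (length Vs) * C"
proof -
  from schatten_resolvent_eigenbasis[OF sa sch] obtain B d \<tau> where B: "orthonormal_basis B"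
    and D: "\<forall>e\<in>B. D e = Some (complex_of_real (d e) *\<^sub>C e)"
    and \<tau>: "\<forall>F. finite F \<longrightarrow> F \<subseteq> B \<longrightarrow> (\<Sum>e\<in>F. (1 / cmod (complex_of_real (d e) - \<i>)) ^ s) \<le> \<tau>"
    by (elim exE conjE)
  have nz: "complex_of_real (d e) - \<i> \<noteq> 0" for e by (auto simp: complex_eq_iff)
  have "(\<lambda>e. (1 / cmod (complex_of_real (d e) - \<i>)) ^ s) summable_on B"
    by (rule nonneg_bdd_above_summable_on) (use \<tau> in \<open>auto simp: bdd_above_def\<close>)
  from summable_countable_real[OF this] have cB: "countable B" using nz by simp
  obtain \<Gamma> where \<Gamma>: "\<Gamma> \<ge> 0" and F: "\<And>m n. m \<le> s \<Longrightarrow> has_L1_fourier (nth_deriv n (\<lambda>x. f x * (of_real x - \<i>) ^ m)) (fourier (nth_deriv n (\<lambda>x. f x * (of_real x - \<i>) ^ m)))"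
    "\<And>m n. m \<le> s \<Longrightarrow> (\<integral>t. cmod (fourier (nth_deriv n (\<lambda>x. f x * (of_real x - \<i>) ^ m)) t) \<partial>lborel) / fact n \<le> \<Gamma> / K ^ n"
    using E_class_bound[OF f \<gamma> K] by blast
  have sm: "smooth f" using f by (simp add: E_class_def)
  define C where "C = max (\<tau> * \<Gamma> * (1 + K) ^ s) (cmod (THE c. False))"
  have C0: "C \<ge> 0" unfolding C_def using norm_ge_zero max.coboundedI2 by blast
  have "cmod (bracket D f Vs) \<le> real (length Vs) * C"
    if Vs: "\<forall>V\<in>set Vs. bounded_clinear V \<and> onorm V \<le> K" for Vs
  proof -
    have tr: "cmod (op_trace (moi D f Ws)) \<le> C" if W: "set Ws = set Vs" for Ws
      unfolding C_def
    proof (rule op_trace_le[OF B])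
      fix E assume E: "finite E" "E \<subseteq> B"
      have bW: "bounded_clinear V" if "V \<in> set Ws" for V using Vs W that by auto
      have nW: "norm (V x) \<le> K * norm x" if V: "V \<in> set Ws" for V x
      proof -
        have "norm (V x) \<le> onorm V * norm x" by (rule bounded_clinear_norm[OF bW[OF V]])
        also have "\<dots> \<le> K * norm x" using Vs W V by (intro mult_right_mono) auto
        finally show ?thesis .
      qed
      show "cmod (\<Sum>e\<in>E. cinner e (moi D f Ws e)) \<le> \<tau> * \<Gamma> * (1 + K) ^ s"
        by (rule moi_partial_trace_le[where d = d]) (rule sa B D sm s \<Gamma> K E cB \<tau>[rule_format] | erule F bW nW | assumption)+
    qed
    have "cmod (bracket D f Vs) \<le> (\<Sum>j<length Vs. cmod (op_trace (moi D f (rotate j Vs))))"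
      unfolding bracket_def by (rule norm_sum)
    also have "\<dots> \<le> (\<Sum>j<length Vs. C)" by (intro sum_mono tr) simp
    finally show ?thesis by simp
  qed
  then show ?thesis using C0 by blast
qed

text \<open>
  Two bounded extensions of \<open>[D, a]\<close> agree on the dense domain of \<open>D\<close>.
\<close>

lemma comm_bounded_clinear:
  fixes D :: "'h::chilbert_space \<rightharpoonup> 'h"
  assumes sa: "self_adjoint D" and ex: "\<exists>b. is_comm D a b"
  shows "bounded_clinear (comm D a)"
proof -
  obtain b where b: "is_comm D a b" using ex by blast
  have "b' = b" if b': "is_comm D a b'" for b'
  proof
    fix x
    have bl: "bounded_clinear b" "bounded_clinear b'" using b b' by (simp_all add: is_comm_def)
    have "closed {x. b' x = b x}"
      by (intro closed_Collect_eq linear_continuous_on bounded_clinear_linear bl)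
    moreover have "b' y = b y" if "y \<in> dom D" for y
      using b[unfolded is_comm_def, THEN conjunct2, rule_format, OF that]
        b'[unfolded is_comm_def, THEN conjunct2, rule_format, OF that] by simp
    then have "dom D \<subseteq> {x. b' x = b x}" by blast
    ultimately have "closure (dom D) \<subseteq> {x. b' x = b x}" by (intro closure_minimal)
    then show "b' x = b x" using sa_dense[OF sa] by auto
  qed
  then have "comm D a = b" unfolding comm_def using b by (intro the_equality)
  then show ?thesis using b by (simp add: is_comm_def)
qed

text \<open>
  Since \<open>(2 k + 1)! = (2 k + 1) (k!)\<^sup>2\<close> times a binomial coefficient, the quotient of the factorials is at most
  \<open>1 / ((2 k + 1) k!)\<close>.
\<close>

lemma fact_square_bound:
  "fact k / fact (2 * k + 1) * real (3 * k + 2) \<le> 2 / (fact k :: real)"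
proof -
  have "fact k * fact k * (2 * k choose k) = (fact (2 * k) :: nat)"
    using binomial_fact_lemma[of k "2 * k"] by (simp add: mult_2)
  moreover have "(2 * k choose k) \<ge> 1" by (simp add: Suc_leI)
  ultimately have "fact k * fact k \<le> (fact (2 * k) :: nat)" by (metis mult.right_neutral mult_le_mono2)
  then have "fact k * fact k \<le> (fact (2 * k) :: real)" by (metis of_nat_fact of_nat_le_iff of_nat_mult)
  then have "fact k * fact k * real (3 * k + 2) \<le> fact (2 * k) * (2 * real (2 * k + 1))"
    by (intro mult_mono) auto
  then have "fact k * fact k * real (3 * k + 2) \<le> 2 * fact (2 * k + 1)" by (simp add: algebra_simps)
  then show ?thesis by (simp add: field_simps del: fact_Suc)
qed

theorem lemma36:
  fixes s :: nat
    and A :: "('h::{chilbert_space, second_countable_topology} \<Rightarrow> 'h) set"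
    and D :: "'h \<rightharpoonup> 'h"
    and f :: "real \<Rightarrow> complex"
    and \<gamma> :: real
    and S :: "('h \<Rightarrow> 'h) set"
  assumes "s \<ge> 1"
    and "spectral_triple s A D"
    and "0 < \<gamma>" and "\<gamma> < 1"
    and "f \<in> E_class s \<gamma>"
    and "S \<subseteq> A"
    and "\<exists>K. \<forall>a\<in>S. norm1 D a \<le> K"
  shows "\<exists>C::real. \<forall>(k::nat) (a :: nat \<Rightarrow> 'h \<Rightarrow> 'h).
    (\<forall>j\<le>2 * k + 1. a j \<in> S) \<longrightarrow> cmod (psi_tilde D f k a) \<le> C / fact k"
proof -
  have sa: "self_adjoint D" and sch: "resolvent_i D \<in> schatten s" and alg: "unital_star_algebra A"
    and cm: "\<And>a. a \<in> A \<Longrightarrow> \<exists>b. is_comm D a b"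
    using assms(2) by (auto simp: spectral_triple_def)
  obtain K0 where K0: "\<And>a. a \<in> S \<Longrightarrow> norm1 D a \<le> K0" using assms(7) by blast
  define K where "K = max 1 K0"
  have K1: "K \<ge> 1" by (simp add: K_def)
  then have KK: "K \<le> K * K" "K * K > 0" by (auto simp: mult_le_cancel_left1)
  have ba: "bounded_clinear a" if "a \<in> S" for a using that assms(6) alg by (auto simp: unital_star_algebra_def)
  have bc: "bounded_clinear (comm D a)" if "a \<in> S" for a using comm_bounded_clinear[OF sa cm] that assms(6) by auto
  have na: "onorm a \<le> K" "onorm (comm D a) \<le> K" if "a \<in> S" for a
    using K0[OF that] onorm_pos_le[OF bounded_clinear_linear[OF ba[OF that]]]
      onorm_pos_le[OF bounded_clinear_linear[OF bc[OF that]]] by (auto simp: norm1_def K_def)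
  obtain C where C0: "C \<ge> 0" and C: "\<And>Vs. \<forall>V\<in>set Vs. bounded_clinear V \<and> onorm V \<le> K * K \<Longrightarrow>
      cmod (bracket D f Vs) \<le> real (length Vs) * C"
    using bracket_bound[OF assms(1) sa sch assms(5) assms(4) KK(2)] by blast
  have phi: "cmod (phi D f n a) \<le> real n * C"
    if n: "n \<ge> 1" and a0: "bounded_clinear (a 0)" "onorm (a 0) \<le> K" and a: "\<And>j. 1 \<le> j \<Longrightarrow> j \<le> n \<Longrightarrow> a j \<in> S" for n a
  proof -
    let ?Vs = "(a 0 \<circ> comm D (a 1)) # map (\<lambda>j. comm D (a j)) [2..<n + 1]"
    have len: "length ?Vs = n" using n by (cases n) auto
    have a1: "a 1 \<in> S" using a n by simp
    have "bounded_clinear V \<and> onorm V \<le> K * K" if "V \<in> set ?Vs" for V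
    proof -
      consider "V = a 0 \<circ> comm D (a 1)" | j where "2 \<le> j" "j \<le> n" "V = comm D (a j)" using \<open>V \<in> set ?Vs\<close> by auto
      then show ?thesis
      proof cases
        case 1
        have "onorm V \<le> onorm (a 0) * onorm (comm D (a 1))"
          unfolding 1 by (intro onorm_compose bounded_clinear_linear a0 bc a1)
        also have "\<dots> \<le> K * K"
          using K1 by (intro mult_mono a0 na a1 onorm_pos_le bounded_clinear_linear bc) auto
        finally show ?thesis unfolding 1 using bounded_clinear_compose[OF a0(1) bc[OF a1]] by simp
      next
        case 2
        then have "a j \<in> S" using a by simp
        then show ?thesis unfolding 2 using bc na(2) KK order_trans by blast
      qed
    qed
    then have "cmod (bracket D f ?Vs) \<le> real (length ?Vs) * C" by (intro C) blast
    then show ?thesis unfolding phi_def len .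
  qed
  have "cmod (psi_tilde D f k a) \<le> (2 * C) / fact k" if a: "\<forall>j\<le>2 * k + 1. a j \<in> S" for k a
  proof -
    have "cmod (phi D f (2 * k + 1) a) \<le> real (2 * k + 1) * C"
      using a by (intro phi ba na) auto
    moreover have "cmod (phi D f (2 * k + 2) (case_nat id a)) \<le> real (2 * k + 2) * C"
    proof (rule phi)
      have "onorm (id :: 'h \<Rightarrow> 'h) \<le> 1" by (rule onorm_bound) auto
      then show "onorm (case_nat id a 0) \<le> K" using K1 by simp
      show "case_nat id a j \<in> S" if "1 \<le> j" "j \<le> 2 * k + 2" for j
        using a that by (cases j) auto
    qed (auto simp: bounded_clinear_id)
    ultimately have "cmod (psi_odd D f k a) \<le> real (2 * k + 1) * C + 1 / 2 * (real (2 * k + 2) * C)"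
      unfolding psi_odd_def B0_def
      using norm_triangle_ineq4[of "phi D f (2 * k + 1) a" "1 / 2 * phi D f (2 * k + 2) (case_nat id a)"]
      by (simp add: norm_mult)
    also have "\<dots> = real (3 * k + 2) * C" by (simp add: algebra_simps)
    finally have psi: "cmod (psi_odd D f k a) \<le> real (3 * k + 2) * C" .
    have "cmod (psi_tilde D f k a) = fact k / fact (2 * k + 1) * cmod (psi_odd D f k a)"
      unfolding psi_tilde_def by (simp add: norm_mult norm_divide norm_power del: fact_Suc)
    also have "\<dots> \<le> fact k / fact (2 * k + 1) * (real (3 * k + 2) * C)"
      using psi by (intro mult_left_mono) auto
    also have "\<dots> = (fact k / fact (2 * k + 1) * real (3 * k + 2)) * C" by (simp only: mult.assoc)
    also have "\<dots> \<le> 2 / fact k * C" by (rule mult_right_mono[OF fact_square_bound C0])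
    finally show ?thesis by simp
  qed
  then show ?thesis by blast
qed

end
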